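(* Let $(M_1^{n_1},c_1)$ and $(M_2^{n_2},c_2)$ be two conformal manifolds and let $c$ be a non-closed conformal product structure on $M=M_1\times M_2$ with adapted Weyl structure $D$. If the dimension $n=n_1+n_2$ of $M$ is neither $2$ nor $4$, then the only $D$-parallel distributions on $M$ (other than $0$ and $TM$) are the kernels $H_2=\ker dp_1$ and $H_1=\ker dp_2$ of the canonical projections $p_1:M\to M_1$ and $p_2:M\to M_2$.
   Context: Manifolds are smooth and connected, and $n_1,n_2\ge 1$. The weight bundle $L$ of an $n$-manifold $M$ is the real line bundle associated to the frame bundle via the representation $|\det|^{1/n}$ of $\mathrm{GL}(n,\mathbb{R})$. A conformal structure is an equivalence class of Riemannian metrics modulo multiplication by positive functions. A Weyl structure is a torsion-free linear connection $D$ on $TM$ preserving the conformal structure; it induces a connection on $L$. $D$ is closed if $L$ has near every point a nowhere zero local $D$-parallel section; equivalently, $D$ is locally the Levi-Civita connection of metrics in $c$. A submersion $p:(M,c)\to(N,c')$ is conformal if $dp_x|_{(\ker dp_x)^\perp}$ is a conformal isomorphism onto $T_{p(x)}N$ for all $x$. A conformal structure $c$ on $M_1\times M_2$ is a conformal product of $(M_1,c_1)$ and $(M_2,c_2)$ if the projections $p_i$ are conformal submersions with $\ker dp_1\perp\ker dp_2$. On a conformal product there is a unique Weyl structure $D$ for which both $H_1$ and $H_2$ are $D$-parallel, called the adapted Weyl structure; the conformal product is called closed if its adapted Weyl structure is closed, and non-closed otherwise. *)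

theory Defs
  imports "HOL-Analysis.Analysis"
begin

section \<open>Smooth functions between Euclidean spaces\<close>

text \<open>Only used on open sets.\<close>

fun Ck_on :: "nat \<Rightarrow> 'a::euclidean_space set \<Rightarrow> ('a \<Rightarrow> 'b::euclidean_space) \<Rightarrow> bool" where
  "Ck_on 0 S f \<longleftrightarrow> continuous_on S f"
| "Ck_on (Suc k) S f \<longleftrightarrow> (\<forall>x\<in>S. f differentiable (at x)) \<and>
     (\<forall>v. Ck_on k S (\<lambda>x. frechet_derivative f (at x) v))"

definition smooth_on :: "'a::euclidean_space set \<Rightarrow> ('a \<Rightarrow> 'b::euclidean_space) \<Rightarrow> bool" where
  "smooth_on S f \<longleftrightarrow> (\<forall>k. Ck_on k S f)"

text \<open>The Leibniz formula with respect to the standard basis.\<close>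

definition endo_det :: "('e::euclidean_space \<Rightarrow> 'e) \<Rightarrow> real" where
  "endo_det f = (\<Sum>p | p permutes Basis. of_int (sign p) * (\<Prod>b\<in>Basis. f b \<bullet> p b))"

definition endo_trace :: "('e::euclidean_space \<Rightarrow> 'e) \<Rightarrow> real" where
  "endo_trace f = (\<Sum>b\<in>Basis. f b \<bullet> b)"


section \<open>Smooth manifolds\<close>

text \<open>
  A manifold has a whole type \<open>'m\<close> as its underlying space. Its smooth structure is given by a smooth
  atlas indexed by the points: to each point \<open>x\<close> belongs a chart whose domain contains \<open>x\<close>, the
  preferred chart at \<open>x\<close>. (Every smooth atlas has such a subatlas.)
\<close>

type_synonym ('m, 'e) atlas = "'m \<Rightarrow> 'm set \<times> ('m \<Rightarrow> 'e)"

definition cdom :: "('m, 'e) atlas \<Rightarrow> 'm \<Rightarrow> 'm set" where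
  "cdom A a = fst (A a)"

definition cmap :: "('m, 'e) atlas \<Rightarrow> 'm \<Rightarrow> 'm \<Rightarrow> 'e" where
  "cmap A a = snd (A a)"

definition cinv :: "('m, 'e) atlas \<Rightarrow> 'm \<Rightarrow> 'e \<Rightarrow> 'm" where
  "cinv A a = inv_into (cdom A a) (cmap A a)"

definition smooth_manifold ::
    "('m::{t2_space, second_countable_topology}, 'e::euclidean_space) atlas \<Rightarrow> bool" where
  "smooth_manifold A \<longleftrightarrow>
     connected (UNIV :: 'm set) \<and>
     (\<forall>a. open (cdom A a) \<and> a \<in> cdom A a \<and> open (cmap A a ` cdom A a) \<and>
          homeomorphism (cdom A a) (cmap A a ` cdom A a) (cmap A a) (cinv A a)) \<and>
     (\<forall>a b. smooth_on (cmap A a ` (cdom A a \<inter> cdom A b)) (cmap A b \<circ> cinv A a))"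

definition prod_atlas :: "('m, 'a) atlas \<Rightarrow> ('n, 'b) atlas \<Rightarrow> ('m \<times> 'n, 'a \<times> 'b) atlas" where
  "prod_atlas A B = (\<lambda>(x, y). (cdom A x \<times> cdom B y, \<lambda>(p, q). (cmap A x p, cmap B y q)))"

text \<open>
  The tangent space at \<open>x\<close> is \<open>'e\<close> itself: a tangent vector is represented by its components in the
  preferred chart at \<open>x\<close>. The change of components at the point \<open>y\<close> from chart \<open>a\<close> to chart \<open>b\<close> is
  \<open>ctrans A a b y\<close>; so \<open>ctrans A y a y\<close> maps \<open>v \<in> T\<^sub>yM\<close> to its components in the chart \<open>a\<close>, and
  \<open>ctrans A a y y\<close> is the inverse operation.
\<close>

definition ctrans :: "('m, 'e::euclidean_space) atlas \<Rightarrow> 'm \<Rightarrow> 'm \<Rightarrow> 'm \<Rightarrow> 'e \<Rightarrow> 'e" where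
  "ctrans A a b y = frechet_derivative (cmap A b \<circ> cinv A a) (at (cmap A a y))"

definition smooth_fun_on ::
    "('m, 'e::euclidean_space) atlas \<Rightarrow> 'm set \<Rightarrow> ('m \<Rightarrow> real) \<Rightarrow> bool" where
  "smooth_fun_on A U f \<longleftrightarrow> (\<forall>a. smooth_on (cmap A a ` (U \<inter> cdom A a)) (f \<circ> cinv A a))"

definition fun_diff :: "('m, 'e::euclidean_space) atlas \<Rightarrow> ('m \<Rightarrow> real) \<Rightarrow> 'm \<Rightarrow> 'e \<Rightarrow> real" where
  "fun_diff A f x = frechet_derivative (f \<circ> cinv A x) (at (cmap A x x))"

definition smooth_map ::
    "('m::topological_space, 'e::euclidean_space) atlas \<Rightarrow> ('n::topological_space, 'f::euclidean_space) atlas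
      \<Rightarrow> ('m \<Rightarrow> 'n) \<Rightarrow> bool" where
  "smooth_map A B p \<longleftrightarrow> continuous_on UNIV p \<and>
     (\<forall>a b. smooth_on (cmap A a ` (cdom A a \<inter> p -` cdom B b)) (cmap B b \<circ> p \<circ> cinv A a))"

definition map_diff ::
    "('m, 'e::euclidean_space) atlas \<Rightarrow> ('n, 'f::euclidean_space) atlas
      \<Rightarrow> ('m \<Rightarrow> 'n) \<Rightarrow> 'm \<Rightarrow> 'e \<Rightarrow> 'f" where
  "map_diff A B p x = frechet_derivative (cmap B (p x) \<circ> p \<circ> cinv A x) (at (cmap A x x))"

definition ker_diff ::
    "('m, 'e::euclidean_space) atlas \<Rightarrow> ('n, 'f::euclidean_space) atlas
      \<Rightarrow> ('m \<Rightarrow> 'n) \<Rightarrow> 'm \<Rightarrow> 'e set" where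
  "ker_diff A B p x = {v. map_diff A B p x v = 0}"


section \<open>Vector fields and linear connections\<close>

definition field_comp ::
    "('m, 'e::euclidean_space) atlas \<Rightarrow> 'm \<Rightarrow> ('m \<Rightarrow> 'e) \<Rightarrow> 'e \<Rightarrow> 'e" where
  "field_comp A a X = (\<lambda>z. let y = cinv A a z in ctrans A y a y (X y))"

definition coord_field :: "('m, 'e::euclidean_space) atlas \<Rightarrow> 'm \<Rightarrow> 'e \<Rightarrow> 'm \<Rightarrow> 'e" where
  "coord_field A a b = (\<lambda>y. ctrans A a y y b)"

definition smooth_field_on ::
    "('m, 'e::euclidean_space) atlas \<Rightarrow> 'm set \<Rightarrow> ('m \<Rightarrow> 'e) \<Rightarrow> bool" where
  "smooth_field_on A U X \<longleftrightarrow> (\<forall>a. smooth_on (cmap A a ` (U \<inter> cdom A a)) (field_comp A a X))"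

definition lie_bracket ::
    "('m, 'e::euclidean_space) atlas \<Rightarrow> ('m \<Rightarrow> 'e) \<Rightarrow> ('m \<Rightarrow> 'e) \<Rightarrow> 'm \<Rightarrow> 'e" where
  "lie_bracket A X Y x =
     frechet_derivative (field_comp A x Y) (at (cmap A x x)) (X x) -
     frechet_derivative (field_comp A x X) (at (cmap A x x)) (Y x)"

text \<open>
  A linear connection on \<open>TM\<close> is a covariant derivative: \<open>D x v Y\<close> stands for \<open>(D\<^sub>v Y)(x)\<close>, where
  \<open>v \<in> T\<^sub>xM\<close> and \<open>Y\<close> is a vector field that is smooth on a neighbourhood of \<open>x\<close>. The values of \<open>D\<close> on
  other \<open>Y\<close> are irrelevant. The second clause says that \<open>D\<close> is compatible with restriction of local
  fields to smaller open sets.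
\<close>

definition linear_connection ::
    "('m::topological_space, 'e::euclidean_space) atlas \<Rightarrow> ('m \<Rightarrow> 'e \<Rightarrow> ('m \<Rightarrow> 'e) \<Rightarrow> 'e) \<Rightarrow> bool" where
  "linear_connection A D \<longleftrightarrow>
     (\<forall>U x Y. open U \<and> x \<in> U \<and> smooth_field_on A U Y \<longrightarrow> linear (\<lambda>v. D x v Y)) \<and>
     (\<forall>U x v Y Z. open U \<and> x \<in> U \<and> smooth_field_on A U Y \<and> (\<forall>y\<in>U. Y y = Z y)
        \<longrightarrow> D x v Y = D x v Z) \<and>
     (\<forall>U x v Y Z. open U \<and> x \<in> U \<and> smooth_field_on A U Y \<and> smooth_field_on A U Z
        \<longrightarrow> D x v (\<lambda>y. Y y + Z y) = D x v Y + D x v Z) \<and>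
     (\<forall>U x v f Y. open U \<and> x \<in> U \<and> smooth_fun_on A U f \<and> smooth_field_on A U Y
        \<longrightarrow> D x v (\<lambda>y. f y *\<^sub>R Y y) = fun_diff A f x v *\<^sub>R Y x + f x *\<^sub>R D x v Y) \<and>
     (\<forall>U X Y. open U \<and> smooth_field_on A U X \<and> smooth_field_on A U Y
        \<longrightarrow> smooth_field_on A U (\<lambda>x. D x (X x) Y))"

definition torsion_free ::
    "('m::topological_space, 'e::euclidean_space) atlas \<Rightarrow> ('m \<Rightarrow> 'e \<Rightarrow> ('m \<Rightarrow> 'e) \<Rightarrow> 'e) \<Rightarrow> bool" where
  "torsion_free A D \<longleftrightarrow>
     (\<forall>U x X Y. open U \<and> x \<in> U \<and> smooth_field_on A U X \<and> smooth_field_on A U Y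
        \<longrightarrow> D x (X x) Y - D x (Y x) X = lie_bracket A X Y x)"

text \<open>A distribution is a smooth subbundle of \<open>TM\<close> of some constant rank \<open>k\<close>.\<close>

definition distribution ::
    "('m::topological_space, 'e::euclidean_space) atlas \<Rightarrow> ('m \<Rightarrow> 'e set) \<Rightarrow> bool" where
  "distribution A E \<longleftrightarrow>
     (\<exists>k::nat. \<forall>x. \<exists>U Y. open U \<and> x \<in> U \<and> (\<forall>i<k. smooth_field_on A U (Y i)) \<and>
        (\<forall>y\<in>U. E y = span ((\<lambda>i. Y i y) ` {..<k}) \<and> dim (E y) = k))"

definition parallel_distribution ::
    "('m::topological_space, 'e::euclidean_space) atlas \<Rightarrow> ('m \<Rightarrow> 'e \<Rightarrow> ('m \<Rightarrow> 'e) \<Rightarrow> 'e)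
      \<Rightarrow> ('m \<Rightarrow> 'e set) \<Rightarrow> bool" where
  "parallel_distribution A D E \<longleftrightarrow> distribution A E \<and>
     (\<forall>U x v Y. open U \<and> x \<in> U \<and> smooth_field_on A U Y \<and> (\<forall>y\<in>U. Y y \<in> E y)
        \<longrightarrow> D x v Y \<in> E x)"


section \<open>Conformal structures and Weyl structures\<close>

definition riemannian_metric ::
    "('m, 'e::euclidean_space) atlas \<Rightarrow> ('m \<Rightarrow> 'e \<Rightarrow> 'e \<Rightarrow> real) \<Rightarrow> bool" where
  "riemannian_metric A g \<longleftrightarrow>
     (\<forall>x. bilinear (g x) \<and> (\<forall>u v. g x u v = g x v u) \<and> (\<forall>u. u \<noteq> 0 \<longrightarrow> g x u u > 0)) \<and>
     (\<forall>a u v. smooth_on (cmap A a ` cdom A a)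
        (\<lambda>z. let y = cinv A a z in g y (coord_field A a u y) (coord_field A a v y)))"

definition conformal_structure ::
    "('m, 'e::euclidean_space) atlas \<Rightarrow> ('m \<Rightarrow> 'e \<Rightarrow> 'e \<Rightarrow> real) set \<Rightarrow> bool" where
  "conformal_structure A c \<longleftrightarrow>
     (\<exists>g. riemannian_metric A g \<and>
        c = {\<lambda>x u v. f x * g x u v | f. smooth_fun_on A UNIV f \<and> (\<forall>x. f x > 0)})"

text \<open>\<open>D\<close> preserves \<open>c\<close> if \<open>D g = \<theta> \<otimes> g\<close> for every \<open>g \<in> c\<close>, with a 1-form \<open>\<theta>\<close> depending on \<open>g\<close>.\<close>

definition preserves_conformal ::
    "('m::topological_space, 'e::euclidean_space) atlas \<Rightarrow> ('m \<Rightarrow> 'e \<Rightarrow> 'e \<Rightarrow> real) set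
      \<Rightarrow> ('m \<Rightarrow> 'e \<Rightarrow> ('m \<Rightarrow> 'e) \<Rightarrow> 'e) \<Rightarrow> bool" where
  "preserves_conformal A c D \<longleftrightarrow>
     (\<forall>g\<in>c. \<exists>\<theta> :: 'm \<Rightarrow> 'e \<Rightarrow> real. \<forall>U x v Y Z.
        open U \<and> x \<in> U \<and> smooth_field_on A U Y \<and> smooth_field_on A U Z \<longrightarrow>
        fun_diff A (\<lambda>y. g y (Y y) (Z y)) x v - g x (D x v Y) (Z x) - g x (Y x) (D x v Z)
          = \<theta> x v * g x (Y x) (Z x))"

definition weyl_structure ::
    "('m::topological_space, 'e::euclidean_space) atlas \<Rightarrow> ('m \<Rightarrow> 'e \<Rightarrow> 'e \<Rightarrow> real) set
      \<Rightarrow> ('m \<Rightarrow> 'e \<Rightarrow> ('m \<Rightarrow> 'e) \<Rightarrow> 'e) \<Rightarrow> bool" where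
  "weyl_structure A c D \<longleftrightarrow>
     linear_connection A D \<and> torsion_free A D \<and> preserves_conformal A c D"


section \<open>The weight bundle\<close>

text \<open>
  The frame of \<open>T\<^sub>xM\<close> defined by the preferred chart at \<open>x\<close> identifies the fibre at \<open>x\<close> of
  \<open>L = GL(M) \<times>\<^bsub>|det|^(1/n)\<^esub> \<real>\<close> with the reals, so a section of \<open>L\<close> is a real function \<open>l\<close>. If \<open>J\<close> is
  the matrix changing the components of vectors from one frame to another, the components of
  elements of \<open>L\<close> change by the factor \<open>|det J|^(1/n)\<close>; \<open>weight_comp A a l\<close> is the component of \<open>l\<close>
  with respect to the coordinate frame of the chart \<open>a\<close>.
\<close>

definition weight_comp ::
    "('m, 'e::euclidean_space) atlas \<Rightarrow> 'm \<Rightarrow> ('m \<Rightarrow> real) \<Rightarrow> 'e \<Rightarrow> real" where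
  "weight_comp A a l =
     (\<lambda>z. let y = cinv A a z in \<bar>endo_det (ctrans A y a y)\<bar> powr (1 / DIM('e)) * l y)"

definition smooth_weight_section_on ::
    "('m, 'e::euclidean_space) atlas \<Rightarrow> 'm set \<Rightarrow> ('m \<Rightarrow> real) \<Rightarrow> bool" where
  "smooth_weight_section_on A U l \<longleftrightarrow>
     (\<forall>a. smooth_on (cmap A a ` (U \<inter> cdom A a)) (weight_comp A a l))"

text \<open>
  The connection induced by \<open>D\<close> on \<open>L\<close>: the derivative of \<open>|det|^(1/n)\<close> at the identity is \<open>tr / n\<close>,
  so the connection form on \<open>L\<close> is \<open>1 / n\<close> times the trace of that of \<open>D\<close>, here taken in the
  coordinate frame of the preferred chart at \<open>x\<close>. This frame is the standard one at \<open>x\<close> itself.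
\<close>

definition weight_deriv ::
    "('m, 'e::euclidean_space) atlas \<Rightarrow> ('m \<Rightarrow> 'e \<Rightarrow> ('m \<Rightarrow> 'e) \<Rightarrow> 'e)
      \<Rightarrow> 'm \<Rightarrow> 'e \<Rightarrow> ('m \<Rightarrow> real) \<Rightarrow> real" where
  "weight_deriv A D x v l =
     frechet_derivative (weight_comp A x l) (at (cmap A x x)) v +
     (1 / DIM('e)) * endo_trace (\<lambda>b. D x v (coord_field A x b)) * l x"

definition closed_weyl ::
    "('m::topological_space, 'e::euclidean_space) atlas
      \<Rightarrow> ('m \<Rightarrow> 'e \<Rightarrow> ('m \<Rightarrow> 'e) \<Rightarrow> 'e) \<Rightarrow> bool" where
  "closed_weyl A D \<longleftrightarrow>
     (\<forall>x. \<exists>U l. open U \<and> x \<in> U \<and> smooth_weight_section_on A U l \<and>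
        (\<forall>y\<in>U. l y \<noteq> 0) \<and> (\<forall>y\<in>U. \<forall>v. weight_deriv A D y v l = 0))"


section \<open>Conformal products\<close>

definition conformal_submersion ::
    "('m::topological_space, 'e::euclidean_space) atlas \<Rightarrow> ('m \<Rightarrow> 'e \<Rightarrow> 'e \<Rightarrow> real) set
      \<Rightarrow> ('n::topological_space, 'f::euclidean_space) atlas \<Rightarrow> ('n \<Rightarrow> 'f \<Rightarrow> 'f \<Rightarrow> real) set
      \<Rightarrow> ('m \<Rightarrow> 'n) \<Rightarrow> bool" where
  "conformal_submersion A c B c' p \<longleftrightarrow>
     smooth_map A B p \<and> (\<forall>x. surj (map_diff A B p x)) \<and>
     (\<forall>x. \<forall>g\<in>c. \<forall>g'\<in>c'.
        let H = {u. \<forall>w\<in>ker_diff A B p x. g x u w = 0} in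
        bij_betw (map_diff A B p x) H UNIV \<and>
        (\<exists>r>0. \<forall>u\<in>H. \<forall>v\<in>H. g' (p x) (map_diff A B p x u) (map_diff A B p x v) = r * g x u v))"

definition conformal_product ::
    "('m::topological_space, 'a::euclidean_space) atlas \<Rightarrow> ('m \<Rightarrow> 'a \<Rightarrow> 'a \<Rightarrow> real) set
      \<Rightarrow> ('n::topological_space, 'b::euclidean_space) atlas \<Rightarrow> ('n \<Rightarrow> 'b \<Rightarrow> 'b \<Rightarrow> real) set
      \<Rightarrow> ('m \<times> 'n \<Rightarrow> 'a \<times> 'b \<Rightarrow> 'a \<times> 'b \<Rightarrow> real) set \<Rightarrow> bool" where
  "conformal_product A1 c1 A2 c2 c \<longleftrightarrow>
     conformal_structure (prod_atlas A1 A2) c \<and>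
     conformal_submersion (prod_atlas A1 A2) c A1 c1 fst \<and>
     conformal_submersion (prod_atlas A1 A2) c A2 c2 snd \<and>
     (\<forall>g\<in>c. \<forall>x. \<forall>u\<in>ker_diff (prod_atlas A1 A2) A1 fst x.
        \<forall>v\<in>ker_diff (prod_atlas A1 A2) A2 snd x. g x u v = 0)"

definition adapted_weyl_structure ::
    "('m::topological_space, 'a::euclidean_space) atlas \<Rightarrow> ('n::topological_space, 'b::euclidean_space) atlas
      \<Rightarrow> ('m \<times> 'n \<Rightarrow> 'a \<times> 'b \<Rightarrow> 'a \<times> 'b \<Rightarrow> real) set
      \<Rightarrow> ('m \<times> 'n \<Rightarrow> 'a \<times> 'b \<Rightarrow> ('m \<times> 'n \<Rightarrow> 'a \<times> 'b) \<Rightarrow> 'a \<times> 'b) \<Rightarrow> bool" where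
  "adapted_weyl_structure A1 A2 c D \<longleftrightarrow>
     weyl_structure (prod_atlas A1 A2) c D \<and>
     parallel_distribution (prod_atlas A1 A2) D (ker_diff (prod_atlas A1 A2) A2 snd) \<and>
     parallel_distribution (prod_atlas A1 A2) D (ker_diff (prod_atlas A1 A2) A1 fst)"

end

theory Submission
  imports Defs
begin

text \<open>
  Write a metric of \<open>c\<close> as \<open>\<alpha> g1 + \<beta> g2\<close> and put \<open>F = ln \<beta> - ln \<alpha>\<close>. Since \<open>D\<close> is torsion-free and
  preserves both factors, its Christoffel symbols are block diagonal, and on the slices of the two
  factors \<open>D\<close> is the Weyl connection of \<open>g1\<close> (of \<open>g2\<close>) with Lee form \<open>dF\<close> (with \<open>- dF\<close>). Hence \<open>D\<close> is
  closed if the mixed second derivatives \<open>B u v\<close> of \<open>F\<close> vanish identically, and the curvature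
  \<open>2 R(u, v)\<close> for \<open>u\<close> in the first and \<open>v\<close> in the second factor is \<open>B u v\<close> times the identity plus a
  skew part that is the sum of \<open>u \<and> B(\<cdot>, v)\<close> and \<open>v \<and> B(u, \<cdot>)\<close>.

  At a point with \<open>B \<noteq> 0\<close>, a subspace invariant under the curvature is trivial or a factor. Choose unit vectors
  \<open>e1\<close>, \<open>f1\<close> that maximise \<open>B\<close>, with maximum \<open>\<sigma>\<close>. If \<open>v \<mapsto> B(\<cdot>, v)\<close> is not \<open>\<sigma>\<close> times an isometry on the
  complement of \<open>f1\<close>, a cubic polynomial in one curvature operator is a rotation of the second
  factor alone; if it is, and the second factor has dimension at least 3, a commutator of curvature operators helps.
  If the factors have dimensions 1 and 2, only the first case occurs, so that up to exchanging the
  factors just \<open>n = 2\<close> and \<open>n = 4\<close> escape.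
  Finally, a parallel distribution that is a factor at one point is this factor everywhere, by
  uniqueness for linear differential equations.
\<close>

section \<open>Smooth maps between Euclidean spaces\<close>

text \<open>A subspace does not notice the multiple of the identity in \<open>2 R(u, v)\<close>, so
  only the skew part counts. Take \<open>v0\<close> orthogonal to \<open>f1\<close>. The operator
  \<open>T\<close> of \<open>e1\<close> and \<open>v0\<close> rotates the plane of \<open>e1\<close>
  and \<open>B(\<cdot>, v0)\<close> in the first factor and the plane of \<open>f1\<close> and
  \<open>v0\<close> in the second, with squared speeds \<open>P = |B(\<cdot>, v0)|^2\<close> and
  \<open>\<sigma>^2 |v0|^2\<close>. If these differ, \<open>T^3 + P T\<close> kills the first
  rotation but not the second; this is the cubic. If they never differ, \<open>B\<close> embeds the
  second factor in the first up to the scale \<open>\<sigma>\<close>, and under this identification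
  the operators have the shape \<open>(S, - S)\<close>. Their commutators have the shape
  \<open>(C, C)\<close>, so adding an operator to a commutator separates the factors, provided that
  rotations of the second factor need not commute. This is what fails for 2 + 2:
  \<open>(S, - S)\<close> also preserves the graph of a map that anticommutes with \<open>S\<close>.
  For 1 + 1 the skew part is zero and every line is invariant. All of this is algebra at a single
  point. It says nothing where \<open>B\<close> vanishes, and therefore the result has to be carried
  along the manifold.\<close>

abbreviation fderiv :: "('a::euclidean_space \<Rightarrow> 'b::euclidean_space) \<Rightarrow> 'a \<Rightarrow> 'a \<Rightarrow> 'b" where
  "fderiv f x \<equiv> frechet_derivative f (at x)"

lemma linear_Basis_sum:
  fixes f :: "'a::euclidean_space \<Rightarrow> 'b::real_vector"
  assumes "linear f"
  shows "f w = (\<Sum>b\<in>Basis. (w \<bullet> b) *\<^sub>R f b)"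
  using linear_sum[OF assms, of "\<lambda>b. (w \<bullet> b) *\<^sub>R b" Basis]
  by (simp add: euclidean_representation linear_cmul[OF assms])

lemma Ck_on_cong:
  assumes "open S" "\<And>x. x \<in> S \<Longrightarrow> f x = g x" "Ck_on k S f"
  shows "Ck_on k S g"
  using assms(2,3)
proof (induction k arbitrary: f g)
  case 0
  then show ?case by (metis Ck_on.simps(1) continuous_on_cong)
next
  case (Suc k)
  have d: "(g has_derivative fderiv f x) (at x)" if "x \<in> S" for x
    using Suc.prems that assms(1)
    by (metis Ck_on.simps(2) frechet_derivative_works has_derivative_transform_within_open)
  have e: "fderiv g x = fderiv f x" if "x \<in> S" for x
    using d[OF that] by (metis frechet_derivative_at)
  have "Ck_on k S (\<lambda>x. fderiv g x v)" for v
    by (rule Suc.IH[of "\<lambda>x. fderiv f x v"]) (use e Suc.prems in auto)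
  then show ?case using d by (auto simp: differentiable_def)
qed

lemma Ck_on_subset: "T \<subseteq> S \<Longrightarrow> Ck_on k S f \<Longrightarrow> Ck_on k T f"
  by (induction k arbitrary: f) (auto intro: continuous_on_subset)

lemma Ck_on_SucD: "Ck_on (Suc k) S f \<Longrightarrow> Ck_on k S f"
proof (induction k arbitrary: f)
  case 0
  then show ?case
    by (auto intro!: continuous_at_imp_continuous_on differentiable_imp_continuous_within)
next
  case (Suc k)
  then show ?case by (metis Ck_on.simps(2))
qed

text \<open>Lets inductions on the order use any explicit derivative in place of
  \<open>frechet_derivative\<close>, which is accessible only through uniqueness.\<close>

lemma Ck_on_SucI:
  assumes "open S" "\<And>x. x \<in> S \<Longrightarrow> (f has_derivative f' x) (at x)" "\<And>v. Ck_on k S (\<lambda>x. f' x v)"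
  shows "Ck_on (Suc k) S f"
proof -
  have e: "fderiv f x = f' x" if "x \<in> S" for x
    using assms(2)[OF that] by (metis frechet_derivative_at)
  have "Ck_on k S (\<lambda>x. fderiv f x v)" for v
    by (rule Ck_on_cong[OF assms(1) _ assms(3)[of v]]) (use e in auto)
  then show ?thesis using assms(2) by (auto simp: differentiable_def)
qed

lemma Ck_on_SucE:
  assumes "Ck_on (Suc k) S f" "x \<in> S"
  shows "(f has_derivative fderiv f x) (at x)"
  using assms by (metis Ck_on.simps(2) frechet_derivative_works)

lemma Ck_on_const: "open S \<Longrightarrow> Ck_on k S (\<lambda>_. c)"
proof (induction k arbitrary: c)
  case 0
  then show ?case by simp
next
  case (Suc k)
  then show ?case by (intro Ck_on_SucI[where f' = "\<lambda>_ _. 0"]) auto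
qed

lemma Ck_on_linear_comp:
  assumes "linear L" "open S" "Ck_on k S f"
  shows "Ck_on k S (\<lambda>x. L (f x))"
  using assms(3)
proof (induction k arbitrary: f)
  case 0
  then show ?case
    using assms(1)
    by (auto simp: linear_conv_bounded_linear intro: continuous_on_compose2[OF linear_continuous_on[of L UNIV]])
next
  case (Suc k)
  have bl: "bounded_linear L" using assms(1) by (simp add: linear_conv_bounded_linear)
  show ?case
  proof (rule Ck_on_SucI[OF assms(2)])
    show "((\<lambda>x. L (f x)) has_derivative (\<lambda>v. L (fderiv f x v))) (at x)" if "x \<in> S" for x
      by (rule bounded_linear.has_derivative[OF bl Ck_on_SucE[OF Suc.prems that]])
    show "Ck_on k S (\<lambda>x. L (fderiv f x v))" for v
      by (rule Suc.IH) (use Suc.prems in auto)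
  qed
qed

lemma Ck_on_id: "open S \<Longrightarrow> Ck_on k S (\<lambda>x. x)"
proof (cases k)
  case (Suc j)
  assume "open S"
  then show ?thesis unfolding Suc
    by (intro Ck_on_SucI[where f' = "\<lambda>_ v. v"]) (auto intro: Ck_on_const)
qed simp

lemma Ck_on_add:
  assumes "open S" "Ck_on k S f" "Ck_on k S g"
  shows "Ck_on k S (\<lambda>x. f x + g x)"
  using assms(2,3)
proof (induction k arbitrary: f g)
  case 0
  then show ?case by (auto intro: continuous_intros)
next
  case (Suc k)
  then show ?case
    by (intro Ck_on_SucI[OF assms(1), where f' = "\<lambda>x v. fderiv f x v + fderiv g x v"])
       (auto intro!: has_derivative_add Ck_on_SucE)
qed

lemma Ck_on_sum:
  assumes "open S" "\<And>i. i \<in> I \<Longrightarrow> Ck_on k S (f i)"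
  shows "Ck_on k S (\<lambda>x. \<Sum>i\<in>I. f i x)"
  using assms(2)
  by (induction I rule: infinite_finite_induct) (auto intro: Ck_on_add Ck_on_const assms(1))

lemma Ck_on_scaleR:
  fixes g :: "'a::euclidean_space \<Rightarrow> 'b::euclidean_space"
  assumes "open S" "Ck_on k S f" "Ck_on k S g"
  shows "Ck_on k S (\<lambda>x. f x *\<^sub>R g x)"
  using assms(2,3)
proof (induction k arbitrary: f g)
  case 0
  then show ?case by (auto intro: continuous_intros)
next
  case (Suc k)
  note fg = Ck_on_SucD[OF Suc.prems(1)] Ck_on_SucD[OF Suc.prems(2)]
  have d: "Ck_on k S (\<lambda>x. fderiv f x v)" "Ck_on k S (\<lambda>x. fderiv g x v)" for v
    using Suc.prems by auto
  have "Ck_on k S (\<lambda>x. f x *\<^sub>R fderiv g x v + fderiv f x v *\<^sub>R g x)" for v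
    by (intro Ck_on_add assms(1) Suc.IH fg d)
  then show ?case
    by (intro Ck_on_SucI[OF assms(1), where f' = "\<lambda>x v. f x *\<^sub>R fderiv g x v + fderiv f x v *\<^sub>R g x"]
        has_derivative_scaleR Ck_on_SucE[OF Suc.prems(1)] Ck_on_SucE[OF Suc.prems(2)])
qed

lemma Ck_on_compose:
  fixes f :: "'b::euclidean_space \<Rightarrow> 'c::euclidean_space"
  assumes "open S" "open T" "\<And>x. x \<in> S \<Longrightarrow> g x \<in> T" "Ck_on k T f" "Ck_on k S g"
  shows "Ck_on k S (\<lambda>x. f (g x))"
  using assms(4,5)
proof (induction k arbitrary: f)
  case 0
  then show ?case using assms(3)
    by (simp, metis continuous_on_compose2 image_subsetI)
next
  case (Suc k)
  \<comment> \<open>The chain rule produces a direction \<open>fderiv g x v\<close> that varies with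
    \<open>x\<close>, whereas \<open>Ck_on\<close> speaks of fixed directions. Expanding it in the
    basis leaves fixed directions and scalar factors.\<close>
  let ?f' = "\<lambda>x v. \<Sum>b\<in>Basis. (fderiv g x v \<bullet> b) *\<^sub>R fderiv f (g x) b"
  have D: "((\<lambda>x. f (g x)) has_derivative ?f' x) (at x)" if x: "x \<in> S" for x
  proof -
    have f: "(f has_derivative fderiv f (g x)) (at (g x))"
      by (rule Ck_on_SucE[OF Suc.prems(1)]) (use assms(3) x in auto)
    have g: "(g has_derivative fderiv g x) (at x)"
      by (rule Ck_on_SucE[OF Suc.prems(2) x])
    have l: "linear (fderiv f (g x))"
      using f has_derivative_linear by blast
    have "fderiv f (g x) w = (\<Sum>b\<in>Basis. (w \<bullet> b) *\<^sub>R fderiv f (g x) b)" for w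
      by (rule linear_Basis_sum[OF l])
    then show ?thesis
      by (intro has_derivative_eq_rhs[OF has_derivative_compose[OF g f]] ext)
  qed
  have C: "Ck_on k S (\<lambda>x. ?f' x v)" for v
  proof (intro Ck_on_sum Ck_on_scaleR assms(1))
    fix b :: 'b
    have "linear (\<lambda>w. w \<bullet> b)" by (auto intro: linearI simp: inner_add_left)
    then show "Ck_on k S (\<lambda>x. fderiv g x v \<bullet> b)"
      by (rule Ck_on_linear_comp[OF _ assms(1)]) (use Suc.prems in auto)
    show "Ck_on k S (\<lambda>x. fderiv f (g x) b)"
      by (rule Suc.IH) (use Suc.prems Ck_on_SucD[OF Suc.prems(2)] in auto)
  qed
  show ?case by (rule Ck_on_SucI[OF assms(1) D C])
qed

lemma smooth_on_cong:
  "open S \<Longrightarrow> (\<And>x. x \<in> S \<Longrightarrow> f x = g x) \<Longrightarrow> smooth_on S f \<Longrightarrow> smooth_on S g"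
  unfolding smooth_on_def using Ck_on_cong by blast

lemma smooth_on_subset: "smooth_on S f \<Longrightarrow> T \<subseteq> S \<Longrightarrow> smooth_on T f"
  unfolding smooth_on_def using Ck_on_subset by blast

lemma smooth_on_continuous_on: "smooth_on S f \<Longrightarrow> continuous_on S f"
  unfolding smooth_on_def by (metis Ck_on.simps(1))

lemma smooth_on_has_derivative:
  "smooth_on S f \<Longrightarrow> x \<in> S \<Longrightarrow> (f has_derivative fderiv f x) (at x)"
  unfolding smooth_on_def using Ck_on_SucE by blast

lemma smooth_on_derivative:
  "smooth_on S f \<Longrightarrow> smooth_on S (\<lambda>x. fderiv f x v)"
  unfolding smooth_on_def by (metis Ck_on.simps(2))

lemma smooth_on_const: "open S \<Longrightarrow> smooth_on S (\<lambda>_. c)"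
  by (simp add: smooth_on_def Ck_on_const)

lemma smooth_on_id: "open S \<Longrightarrow> smooth_on S (\<lambda>x. x)"
  by (simp add: smooth_on_def Ck_on_id)

lemma smooth_on_linear_comp: "linear L \<Longrightarrow> open S \<Longrightarrow> smooth_on S f \<Longrightarrow> smooth_on S (\<lambda>x. L (f x))"
  by (simp add: smooth_on_def Ck_on_linear_comp)

lemma smooth_on_add: "open S \<Longrightarrow> smooth_on S f \<Longrightarrow> smooth_on S g \<Longrightarrow> smooth_on S (\<lambda>x. f x + g x)"
  by (simp add: smooth_on_def Ck_on_add)

lemma smooth_on_sum:
  "open S \<Longrightarrow> (\<And>i. i \<in> I \<Longrightarrow> smooth_on S (f i)) \<Longrightarrow> smooth_on S (\<lambda>x. \<Sum>i\<in>I. f i x)"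
  by (simp add: smooth_on_def Ck_on_sum)

lemma smooth_on_scaleR:
  "open S \<Longrightarrow> smooth_on S f \<Longrightarrow> smooth_on S g \<Longrightarrow> smooth_on S (\<lambda>x. f x *\<^sub>R g x)"
  by (simp add: smooth_on_def Ck_on_scaleR)

lemma smooth_on_mult:
  fixes f g :: "'a::euclidean_space \<Rightarrow> real"
  shows "open S \<Longrightarrow> smooth_on S f \<Longrightarrow> smooth_on S g \<Longrightarrow> smooth_on S (\<lambda>x. f x * g x)"
  using smooth_on_scaleR[of S f g] by simp

lemma smooth_on_minus: "open S \<Longrightarrow> smooth_on S f \<Longrightarrow> smooth_on S (\<lambda>x. - f x)"
  by (rule smooth_on_linear_comp) (auto intro: linearI)

lemma smooth_on_diff:
  "open S \<Longrightarrow> smooth_on S f \<Longrightarrow> smooth_on S g \<Longrightarrow> smooth_on S (\<lambda>x. f x - g x)"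
  using smooth_on_add[of S f "\<lambda>x. - g x"] by (simp add: smooth_on_minus)

lemma smooth_on_prod:
  fixes f :: "'i \<Rightarrow> 'a::euclidean_space \<Rightarrow> real"
  assumes "open S" "\<And>i. i \<in> I \<Longrightarrow> smooth_on S (f i)"
  shows "smooth_on S (\<lambda>x. \<Prod>i\<in>I. f i x)"
  using assms(2)
  by (induction I rule: infinite_finite_induct) (auto intro: smooth_on_mult smooth_on_const assms(1))

lemma smooth_on_inner: "open S \<Longrightarrow> smooth_on S f \<Longrightarrow> smooth_on S (\<lambda>x. f x \<bullet> b)"
  by (rule smooth_on_linear_comp) (auto intro: linearI simp: inner_add_left)

lemma smooth_on_fst: "open S \<Longrightarrow> smooth_on S f \<Longrightarrow> smooth_on S (\<lambda>x. fst (f x))"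
  by (rule smooth_on_linear_comp) (auto intro: linearI)

lemma smooth_on_snd: "open S \<Longrightarrow> smooth_on S f \<Longrightarrow> smooth_on S (\<lambda>x. snd (f x))"
  by (rule smooth_on_linear_comp) (auto intro: linearI)

lemma smooth_on_Pair:
  assumes "open S" "smooth_on S f" "smooth_on S g"
  shows "smooth_on S (\<lambda>x. (f x, g x))"
proof -
  have "smooth_on S (\<lambda>x. (f x, 0) + (0, g x))"
    using assms by (intro smooth_on_add smooth_on_linear_comp[where L = "\<lambda>x. (x, 0)"]
        smooth_on_linear_comp[where L = "\<lambda>x. (0, x)"]) (auto intro: linearI)
  then show ?thesis by simp
qed

lemma smooth_on_compose:
  "\<lbrakk>open S; open T; \<And>x. x \<in> S \<Longrightarrow> g x \<in> T; smooth_on T f; smooth_on S g\<rbrakk> \<Longrightarrow> smooth_on S (\<lambda>x. f (g x))"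
  unfolding smooth_on_def using Ck_on_compose by blast

lemma smooth_on_exp: "smooth_on UNIV (exp :: real \<Rightarrow> real)"
proof -
  have "Ck_on k UNIV (exp :: real \<Rightarrow> real)" for k
  proof (induction k)
    case 0
    then show ?case by (auto intro: continuous_intros)
  next
    case (Suc k)
    have "Ck_on k UNIV (\<lambda>x::real. v *\<^sub>R exp x)" for v
      using Suc by (intro Ck_on_scaleR Ck_on_const) auto
    then show ?case
      by (intro Ck_on_SucI[where f' = "\<lambda>x v. v *\<^sub>R exp x"])
         (auto intro!: derivative_eq_intros)
  qed
  then show ?thesis by (simp add: smooth_on_def)
qed

lemma smooth_on_inverse: "smooth_on {0::real<..} inverse"
proof -
  have "Ck_on k {0::real<..} inverse" for k
  proof (induction k)
    case 0
    then show ?case by (auto intro!: continuous_intros)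
  next
    case (Suc k)
    show ?case
    proof (rule Ck_on_SucI)
      \<comment> \<open>Written with two copies of \<open>inverse\<close>, so that the induction
        hypothesis covers both factors.\<close>
      show "(inverse has_derivative (\<lambda>v. inverse x *\<^sub>R (inverse x *\<^sub>R (- v)))) (at x)"
        if "x \<in> {0<..}" for x :: real
        using that by (auto intro!: derivative_eq_intros)
      show "Ck_on k {0::real<..} (\<lambda>x. inverse x *\<^sub>R (inverse x *\<^sub>R (- v)))" for v
        using Suc by (intro Ck_on_scaleR Ck_on_const) auto
    qed simp
  qed
  then show ?thesis by (simp add: smooth_on_def)
qed

lemma smooth_on_ln: "smooth_on {0::real<..} ln"
proof -
  have "Ck_on k {0::real<..} ln" for k
  proof (cases k)
    case 0
    then show ?thesis by (auto intro!: continuous_intros)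
  next
    case (Suc k)
    show ?thesis unfolding Suc
    proof (rule Ck_on_SucI)
      show "(ln has_derivative (\<lambda>v. inverse x *\<^sub>R v)) (at x)" if "x \<in> {0<..}" for x :: real
        using that by (auto intro!: derivative_eq_intros simp: divide_inverse)
      show "Ck_on k {0::real<..} (\<lambda>x. inverse x *\<^sub>R v)" for v
        using smooth_on_inverse by (intro Ck_on_scaleR Ck_on_const) (auto simp: smooth_on_def)
    qed simp
  qed
  then show ?thesis by (simp add: smooth_on_def)
qed

lemma smooth_on_powr:
  fixes f :: "'a::euclidean_space \<Rightarrow> real"
  assumes "open S" "smooth_on S f" "\<And>x. x \<in> S \<Longrightarrow> 0 < f x"
  shows "smooth_on S (\<lambda>x. f x powr r)"
proof -
  have "smooth_on S (\<lambda>x. ln (f x))"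
    by (intro smooth_on_compose[OF assms(1) open_greaterThan _ smooth_on_ln assms(2)])
       (use assms(3) in auto)
  then have "smooth_on S (\<lambda>x. r * ln (f x))"
    by (intro smooth_on_mult smooth_on_const assms(1))
  then have "smooth_on S (\<lambda>x. exp (r * ln (f x)))"
    using smooth_on_compose[OF assms(1) open_UNIV _ smooth_on_exp] by auto
  then show ?thesis
    by (rule smooth_on_cong[OF assms(1), rotated]) (use assms(3) in \<open>force simp: powr_def\<close>)
qed

lemma smooth_on_divide:
  fixes f g :: "'a::euclidean_space \<Rightarrow> real"
  assumes "open S" "smooth_on S f" "smooth_on S g" "\<And>x. x \<in> S \<Longrightarrow> 0 < g x"
  shows "smooth_on S (\<lambda>x. f x / g x)"
proof -
  have "smooth_on S (\<lambda>x. inverse (g x))"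
    by (intro smooth_on_compose[OF assms(1) open_greaterThan _ smooth_on_inverse assms(3)])
       (use assms(4) in auto)
  then show ?thesis
    using smooth_on_mult[OF assms(1,2)] by (simp add: divide_inverse)
qed

section \<open>Symmetry of second derivatives\<close>

lemma has_vector_derivative_along_line:
  assumes "(f has_derivative f') (at (x + s *\<^sub>R v))"
  shows "((\<lambda>s. f (x + s *\<^sub>R v)) has_vector_derivative f' v) (at s)"
proof -
  have "((\<lambda>s. x + s *\<^sub>R v) has_derivative (\<lambda>d. d *\<^sub>R v)) (at s)"
    by (auto intro!: derivative_eq_intros)
  from has_derivative_compose[OF this assms]
  have "((\<lambda>s. f (x + s *\<^sub>R v)) has_derivative (\<lambda>d. f' (d *\<^sub>R v))) (at s)" .
  then show ?thesis
    using linear_cmul[OF has_derivative_linear[OF assms]] by (simp add: has_vector_derivative_def)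
qed

text \<open>Both mixed partial derivatives are limits of the second difference quotient.\<close>

lemma second_difference_mean_value:
  fixes f :: "'a::euclidean_space \<Rightarrow> real"
  assumes "0 < h" and sub: "\<And>s t. 0 \<le> s \<Longrightarrow> s \<le> h \<Longrightarrow> 0 \<le> t \<Longrightarrow> t \<le> h \<Longrightarrow> x + s *\<^sub>R v + t *\<^sub>R w \<in> S"
    and "smooth_on S f"
  obtains s t where "0 < s" "s < h" "0 < t" "t < h"
    "f (x + h *\<^sub>R v + h *\<^sub>R w) - f (x + h *\<^sub>R v) - f (x + h *\<^sub>R w) + f x =
     h * h * fderiv (\<lambda>y. fderiv f y v) (x + s *\<^sub>R v + t *\<^sub>R w) w"
proof -
  let ?f' = "\<lambda>y. fderiv f y"
  let ?f2 = "\<lambda>y. fderiv (\<lambda>y. ?f' y v) y"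
  \<comment> \<open>The second difference is \<open>u h - u 0\<close>. The mean value theorem is
    applied to it along \<open>v\<close>, and then along \<open>w\<close> to the resulting
    difference of first derivatives.\<close>
  define u where "u s = f (x + s *\<^sub>R v + h *\<^sub>R w) - f (x + s *\<^sub>R v)" for s
  have "(u has_real_derivative (?f' (x + s *\<^sub>R v + h *\<^sub>R w) v - ?f' (x + s *\<^sub>R v) v)) (at s)"
    if "0 \<le> s" "s \<le> h" for s
  proof -
    have a: "x + h *\<^sub>R w + s *\<^sub>R v \<in> S" "x + s *\<^sub>R v \<in> S"
      using sub[of s h] sub[of s 0] that assms(1) by (auto simp: algebra_simps)
    show ?thesis
      using has_vector_derivative_diff[OF
          has_vector_derivative_along_line[OF smooth_on_has_derivative[OF assms(3) a(1)]]
          has_vector_derivative_along_line[OF smooth_on_has_derivative[OF assms(3) a(2)]]]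
      unfolding u_def[abs_def] has_real_derivative_iff_has_vector_derivative
      by (simp add: add_ac)
  qed
  from MVT2[OF assms(1) this] obtain s where s: "0 < s" "s < h"
    "u h - u 0 = h * (?f' (x + s *\<^sub>R v + h *\<^sub>R w) v - ?f' (x + s *\<^sub>R v) v)" by auto
  have "((\<lambda>t. ?f' (x + s *\<^sub>R v + t *\<^sub>R w) v) has_real_derivative ?f2 (x + s *\<^sub>R v + t *\<^sub>R w) w) (at t)"
    if "0 \<le> t" "t \<le> h" for t
  proof -
    have a: "x + s *\<^sub>R v + t *\<^sub>R w \<in> S" using sub[of s t] that s by auto
    show ?thesis
      unfolding has_real_derivative_iff_has_vector_derivative
      by (rule has_vector_derivative_along_line[OF smooth_on_has_derivative[OF smooth_on_derivative[OF assms(3)] a]])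
  qed
  from MVT2[OF assms(1) this] obtain t where t: "0 < t" "t < h"
    "?f' (x + s *\<^sub>R v + h *\<^sub>R w) v - ?f' (x + s *\<^sub>R v) v = h * ?f2 (x + s *\<^sub>R v + t *\<^sub>R w) w" by auto
  show ?thesis
    by (rule that[OF s(1,2) t(1,2)]) (use s(3) t(3) in \<open>simp add: u_def algebra_simps\<close>)
qed

lemma mixed_derivatives_commute_real:
  fixes f :: "'a::euclidean_space \<Rightarrow> real"
  assumes "open S" "smooth_on S f" "x \<in> S"
  shows "fderiv (\<lambda>y. fderiv f y v) x w =
         fderiv (\<lambda>y. fderiv f y w) x v"
proof -
  define p where "p y = fderiv (\<lambda>y. fderiv f y v) y w" for y
  define q where "q y = fderiv (\<lambda>y. fderiv f y w) y v" for y
  have cont: "isCont p x" "isCont q x"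
    using smooth_on_continuous_on[OF smooth_on_derivative[OF smooth_on_derivative[OF assms(2)]]]
      assms(1,3) unfolding p_def q_def by (auto simp: continuous_on_eq_continuous_at)
  obtain r where r: "r > 0" "ball x r \<subseteq> S" using assms(1,3) openE by blast
  have "\<bar>p x - q x\<bar> < e" if e: "e > 0" for e
  proof -
    obtain d1 where d1: "d1 > 0" "\<And>y. dist y x < d1 \<Longrightarrow> dist (p y) (p x) < e / 2"
      using cont(1) e unfolding continuous_at_eps_delta by (metis half_gt_zero)
    obtain d2 where d2: "d2 > 0" "\<And>y. dist y x < d2 \<Longrightarrow> dist (q y) (q x) < e / 2"
      using cont(2) e unfolding continuous_at_eps_delta by (metis half_gt_zero)
    define d where "d = min r (min d1 d2)"
    \<comment> \<open>\<open>N\<close> dominates both directions and the 1 keeps it positive; with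
      \<open>h\<close> below, the whole parallelogram at \<open>x\<close> stays within distance
      \<open>d / 2\<close>.\<close>
    define N where "N = norm v + norm w + 1"
    define h where "h = d / (2 * N)"
    have N: "N > 0" unfolding N_def by (smt (verit) norm_ge_zero)
    have d: "d > 0" using r d1 d2 by (auto simp: d_def)
    have h: "h > 0" using d N by (auto simp: h_def)
    have near: "dist (x + s *\<^sub>R v + t *\<^sub>R w) x < d" if "0 \<le> s" "s \<le> h" "0 \<le> t" "t \<le> h" for s t
    proof -
      have "dist (x + s *\<^sub>R v + t *\<^sub>R w) x \<le> norm (s *\<^sub>R v) + norm (t *\<^sub>R w)"
        by (simp add: dist_norm) (metis norm_scaleR norm_triangle_ineq)
      also have "\<dots> \<le> h * norm v + h * norm w"
        using that by (auto intro!: add_mono mult_right_mono)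
      also have "\<dots> \<le> h * N" using h by (auto simp: N_def algebra_simps)
      also have "\<dots> = d / 2" using N unfolding h_def by (simp add: field_simps)
      finally show ?thesis using d by simp
    qed
    have sub: "x + s *\<^sub>R v + t *\<^sub>R w \<in> S" if "0 \<le> s" "s \<le> h" "0 \<le> t" "t \<le> h" for s t
      using near[OF that] r(2) by (auto simp: d_def dist_commute subset_iff)
    have sub': "x + s *\<^sub>R w + t *\<^sub>R v \<in> S" if "0 \<le> s" "s \<le> h" "0 \<le> t" "t \<le> h" for s t
      using sub[OF that(3,4,1,2)] by (simp add: algebra_simps)
    obtain s t where st: "0 < s" "s < h" "0 < t" "t < h"
      "f (x + h *\<^sub>R v + h *\<^sub>R w) - f (x + h *\<^sub>R v) - f (x + h *\<^sub>R w) + f x = h * h * p (x + s *\<^sub>R v + t *\<^sub>R w)"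
      unfolding p_def by (rule second_difference_mean_value[OF h sub assms(2)])
    obtain s' t' where st': "0 < s'" "s' < h" "0 < t'" "t' < h"
      "f (x + h *\<^sub>R w + h *\<^sub>R v) - f (x + h *\<^sub>R w) - f (x + h *\<^sub>R v) + f x = h * h * q (x + s' *\<^sub>R w + t' *\<^sub>R v)"
      unfolding q_def by (rule second_difference_mean_value[OF h sub' assms(2)])
    \<comment> \<open>Both second differences are the same number, since exchanging \<open>v\<close>
      and \<open>w\<close> only reorders its terms.\<close>
    have "h * h * p (x + s *\<^sub>R v + t *\<^sub>R w) = h * h * q (x + t' *\<^sub>R v + s' *\<^sub>R w)"
      using st(5) st'(5) by (simp add: algebra_simps)
    then have "p (x + s *\<^sub>R v + t *\<^sub>R w) = q (x + t' *\<^sub>R v + s' *\<^sub>R w)"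
      using h by simp
    moreover have "dist (p (x + s *\<^sub>R v + t *\<^sub>R w)) (p x) < e / 2"
      using near[of s t] st by (intro d1) (auto simp: d_def)
    moreover have "dist (q (x + t' *\<^sub>R v + s' *\<^sub>R w)) (q x) < e / 2"
      using near[of t' s'] st' by (intro d2) (auto simp: d_def)
    ultimately show ?thesis unfolding dist_real_def by linarith
  qed
  then have "p x = q x" by (metis abs_le_zero_iff dense_ge eq_iff_diff_eq_0 less_imp_le)
  then show ?thesis by (simp add: p_def q_def)
qed

lemma frechet_derivative_eqI:
  "(f has_derivative f') (at x) \<Longrightarrow> fderiv f x v = f' v"
  using frechet_derivative_at[of f f' x] by simp

lemma frechet_derivative_linear_comp:
  fixes f :: "'a::euclidean_space \<Rightarrow> 'b::euclidean_space" and L :: "'b \<Rightarrow> 'c::euclidean_space"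
  assumes "linear L" "f differentiable (at x)"
  shows "fderiv (\<lambda>y. L (f y)) x v = L (fderiv f x v)"
proof -
  have "bounded_linear L" using assms(1) by (simp add: linear_conv_bounded_linear)
  from bounded_linear.has_derivative[OF this assms(2)[unfolded frechet_derivative_works]]
  show ?thesis by (rule frechet_derivative_eqI)
qed

lemma smooth_on_differentiable: "smooth_on S f \<Longrightarrow> x \<in> S \<Longrightarrow> f differentiable (at x)"
  unfolding differentiable_def using smooth_on_has_derivative by metis

lemma smooth_on_linear_derivative: "smooth_on S f \<Longrightarrow> x \<in> S \<Longrightarrow> linear (fderiv f x)"
  by (rule has_derivative_linear[OF smooth_on_has_derivative])

lemma frechet_derivative_cong_open:
  assumes "open S" "x \<in> S" "\<And>y. y \<in> S \<Longrightarrow> f y = g y"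
  shows "fderiv f x = fderiv g x"
proof -
  have "(f has_derivative D) (at x) \<longleftrightarrow> (g has_derivative D) (at x)" for D
    using has_derivative_transform_within_open[OF _ assms(1,2), of f D UNIV g]
      has_derivative_transform_within_open[OF _ assms(1,2), of g D UNIV f] assms(3) by metis
  then show ?thesis by (simp add: frechet_derivative_def)
qed

lemma frechet_derivative_inner:
  assumes "open S" "smooth_on S f" "x \<in> S"
  shows "fderiv (\<lambda>y. f y \<bullet> b) x v = fderiv f x v \<bullet> b"
  by (rule frechet_derivative_linear_comp[where L = "\<lambda>w. w \<bullet> b"])
     (auto intro: linearI smooth_on_differentiable assms simp: inner_add_left)

lemma mixed_derivatives_commute:
  fixes f :: "'a::euclidean_space \<Rightarrow> 'b::euclidean_space"
  assumes "open S" "smooth_on S f" "x \<in> S"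
  shows "fderiv (\<lambda>y. fderiv f y v) x w =
         fderiv (\<lambda>y. fderiv f y w) x v"
proof (rule euclidean_eqI)
  fix b :: 'b
  have comp: "fderiv (\<lambda>y. fderiv f y v) x w \<bullet> b =
    fderiv (\<lambda>y. fderiv (\<lambda>y. f y \<bullet> b) y v) x w" for v w
  proof -
    have "fderiv (\<lambda>y. fderiv (\<lambda>y. f y \<bullet> b) y v) x =
       fderiv (\<lambda>y. fderiv f y v \<bullet> b) x"
      by (rule frechet_derivative_cong_open[OF assms(1,3)])
         (rule frechet_derivative_inner[OF assms(1,2)])
    then show ?thesis
      by (simp only: frechet_derivative_inner[OF assms(1) smooth_on_derivative[OF assms(2)] assms(3)])
  qed
  show "fderiv (\<lambda>y. fderiv f y v) x w \<bullet> b =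
         fderiv (\<lambda>y. fderiv f y w) x v \<bullet> b"
    unfolding comp
    by (rule mixed_derivatives_commute_real[OF assms(1) smooth_on_inner[OF assms(1,2)] assms(3)])
qed

section \<open>Inner products and invariant subspaces\<close>

definition inner_form :: "('a::euclidean_space \<Rightarrow> 'a \<Rightarrow> real) \<Rightarrow> bool" where
  "inner_form g \<longleftrightarrow> bilinear g \<and> (\<forall>u v. g u v = g v u) \<and> (\<forall>u. u \<noteq> 0 \<longrightarrow> g u u > 0)"

text \<open>The operator of \<open>g\<close> with respect to the standard inner product. It
  transfers orthogonality, representation of forms and determinants to the standard
  structure.\<close>

definition gram_map :: "('a::euclidean_space \<Rightarrow> 'a \<Rightarrow> real) \<Rightarrow> 'a \<Rightarrow> 'a" where
  "gram_map g u = (\<Sum>b\<in>Basis. g u b *\<^sub>R b)"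

context
  fixes g :: "'a::euclidean_space \<Rightarrow> 'a \<Rightarrow> real"
  assumes g: "inner_form g"
begin

lemma inner_form_bilinear: "bilinear g"
  using g by (simp add: inner_form_def)

lemma inner_form_sym: "g u v = g v u"
  using g by (simp add: inner_form_def)

lemma inner_form_pos: "u \<noteq> 0 \<Longrightarrow> g u u > 0"
  using g by (simp add: inner_form_def)

lemma inner_form_eq_0_iff: "g u u = 0 \<longleftrightarrow> u = 0"
  using inner_form_pos[of u] bilinear_lzero[OF inner_form_bilinear] by force

lemma inner_form_nonneg: "g u u \<ge> 0"
  using inner_form_pos[of u] inner_form_eq_0_iff[of u] by force

lemmas inner_form_simps =
  bilinear_ladd[OF inner_form_bilinear] bilinear_radd[OF inner_form_bilinear]
  bilinear_lmul[OF inner_form_bilinear] bilinear_rmul[OF inner_form_bilinear]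
  bilinear_lsub[OF inner_form_bilinear] bilinear_rsub[OF inner_form_bilinear]
  bilinear_lneg[OF inner_form_bilinear] bilinear_rneg[OF inner_form_bilinear]
  bilinear_lzero[OF inner_form_bilinear] bilinear_rzero[OF inner_form_bilinear]

lemma inner_form_eqI: "(\<And>w. g u w = g v w) \<Longrightarrow> u = v"
  using inner_form_eq_0_iff[of "u - v"] by (simp add: inner_form_simps)

lemma gram_map_inner: "gram_map g u \<bullet> v = g u v"
proof -
  have l: "linear (g u)" using inner_form_bilinear by (simp add: bilinear_def)
  show ?thesis
    using linear_Basis_sum[OF l, of v]
    by (simp add: gram_map_def inner_sum_left inner_commute[of v] mult.commute)
qed

lemma linear_gram_map: "linear (gram_map g)"
  by (rule linearI)
     (auto simp: gram_map_def inner_form_simps scaleR_add_left sum.distrib scaleR_sum_right)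

lemma inj_gram_map: "inj (gram_map g)"
  by (rule injI, rule inner_form_eqI) (metis gram_map_inner)

lemma gram_map_inverse:
  obtains h where "linear h" "\<And>u. h (gram_map g u) = u" "\<And>u. gram_map g (h u) = u"
proof -
  obtain h where "linear h" "\<forall>u. h (gram_map g u) = u" "\<forall>u. gram_map g (h u) = u"
    using linear_injective_isomorphism[OF linear_gram_map inj_gram_map] by blast
  then show ?thesis by (intro that) auto
qed

text \<open>Riesz representation: \<open>k v\<close> represents \<open>\<beta> v\<close> for the
  standard inner product, and the inverse of \<open>gram_map g\<close> corrects it to
  \<open>g\<close>. It serves to turn \<open>B(\<cdot>, v)\<close> and \<open>B(u, \<cdot>)\<close>
  into vectors.\<close>

lemma inner_form_represent:
  fixes \<beta> :: "'b::euclidean_space \<Rightarrow> 'a \<Rightarrow> real"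
  assumes "bilinear \<beta>"
  obtains r where "linear r" "\<And>v y. g (r v) y = \<beta> v y"
proof -
  obtain h where h: "linear h" "\<And>u. h (gram_map g u) = u" "\<And>u. gram_map g (h u) = u"
    by (rule gram_map_inverse) blast
  define k where "k v = (\<Sum>b\<in>Basis. \<beta> v b *\<^sub>R b)" for v
  have k: "k v \<bullet> y = \<beta> v y" for v y
  proof -
    have l: "linear (\<beta> v)" using assms by (simp add: bilinear_def)
    show ?thesis
      using linear_Basis_sum[OF l, of y]
      by (simp add: k_def inner_sum_left inner_commute[of y] mult.commute)
  qed
  have "linear k"
    by (rule linearI)
       (auto simp: k_def bilinear_ladd[OF assms] bilinear_lmul[OF assms] scaleR_add_left sum.distrib scaleR_sum_right)
  then have "linear (h \<circ> k)" using h(1) linear_compose by blast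
  moreover have "g ((h \<circ> k) v) y = \<beta> v y" for v y
    by (metis comp_apply gram_map_inner h(3) k)
  ultimately show ?thesis using that by blast
qed

text \<open>Orthogonality to \<open>s\<close> for \<open>g\<close> is standard orthogonality to
  \<open>gram_map g s\<close>, and fewer vectors than the dimension do not span.\<close>

lemma inner_form_orthogonal_exists:
  assumes "card S < DIM('a)" "finite S"
  obtains w where "g w w = 1" "\<And>s. s \<in> S \<Longrightarrow> g s w = 0"
proof -
  have "dim (gram_map g ` S) < DIM('a)"
    using assms card_image_le[OF assms(2), of "gram_map g"] dim_le_card'[of "gram_map g ` S"] by simp
  then obtain w where w: "w \<noteq> 0" "\<And>y. y \<in> span (gram_map g ` S) \<Longrightarrow> orthogonal w y"
    using orthogonal_to_subspace_exists by blast
  have p: "g w w > 0" using inner_form_pos w(1) .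
  show ?thesis
  proof
    show "g (w /\<^sub>R sqrt (g w w)) (w /\<^sub>R sqrt (g w w)) = 1"
      using p by (simp add: inner_form_simps field_simps)
    show "g s (w /\<^sub>R sqrt (g w w)) = 0" if "s \<in> S" for s
      using w(2)[of "gram_map g s"] that
      by (simp add: inner_form_simps span_base orthogonal_def gram_map_inner inner_commute[of w])
  qed
qed

end

text \<open>The algebra at one point. The operator in the last assumption is the skew part of
  \<open>2 R(u, v)\<close>; \<open>\<beta> v\<close> and \<open>\<gamma> u\<close> are the forms
  \<open>B(\<cdot>, v)\<close> and \<open>B(u, \<cdot>)\<close> made into vectors.\<close>

locale product_form =
  fixes g1 :: "'a::euclidean_space \<Rightarrow> 'a \<Rightarrow> real" and g2 :: "'b::euclidean_space \<Rightarrow> 'b \<Rightarrow> real"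
    and B :: "'a \<Rightarrow> 'b \<Rightarrow> real" and \<beta> :: "'b \<Rightarrow> 'a" and \<gamma> :: "'a \<Rightarrow> 'b"
    and E :: "('a \<times> 'b) set"
  assumes g1: "inner_form g1" and g2: "inner_form g2" and B: "bilinear B"
    and \<beta>: "\<And>y v. g1 (\<beta> v) y = B y v" and \<gamma>: "\<And>u w. g2 (\<gamma> u) w = B u w"
    and E: "subspace E"
    and inv: "\<And>u v y w. (y, w) \<in> E \<Longrightarrow>
       (B y v *\<^sub>R u - g1 u y *\<^sub>R \<beta> v, B u w *\<^sub>R v - g2 v w *\<^sub>R \<gamma> u) \<in> E"
begin

lemmas g_simps = inner_form_simps[OF g1] inner_form_simps[OF g2]

text \<open>The map in \<open>J\<close> rotates the plane of \<open>f1\<close> and \<open>v0\<close>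
  and ignores the first factor. If it does not annihilate \<open>E\<close>, then it and its square
  produce \<open>f1\<close>, which the curvature operators of \<open>e1\<close> spread over the
  second factor. Otherwise all second components in \<open>E\<close> vanish, and the operators of
  \<open>f1\<close> spread any nonzero vector over the first factor.\<close>

lemma invariant_subspace_of_rotation:
  assumes \<sigma>: "\<sigma> \<noteq> 0" and e1: "g1 e1 e1 = 1" and f1: "g2 f1 f1 = 1"
    and Be: "\<And>w. B e1 w = \<sigma> * g2 f1 w" and Bf: "\<And>y. B y f1 = \<sigma> * g1 e1 y"
    and v0: "v0 \<noteq> 0" "g2 f1 v0 = 0"
    and J: "\<And>y w. (y, w) \<in> E \<Longrightarrow> (0, g2 f1 w *\<^sub>R v0 - g2 v0 w *\<^sub>R f1) \<in> E"
  shows "E \<in> {{0}, UNIV, UNIV \<times> {0}, {0} \<times> UNIV}"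
proof -
  have \<gamma>e1: "\<gamma> e1 = \<sigma> *\<^sub>R f1"
    by (rule inner_form_eqI[OF g2]) (simp add: \<gamma> Be g_simps)
  have \<beta>f1: "\<beta> f1 = \<sigma> *\<^sub>R e1"
    by (rule inner_form_eqI[OF g1]) (simp add: \<beta> Bf g_simps)
  have inv1: "(\<sigma> * g1 e1 y) *\<^sub>R (u, 0) - (\<sigma> * g1 u y) *\<^sub>R (e1, 0) \<in> E" if "(y, 0) \<in> E" for y u
    using inv[OF that, of f1 u] by (simp add: Bf \<beta>f1 bilinear_rzero[OF B] g_simps mult.commute)
  have one: "(u, 0) \<in> E" if y: "(y, 0) \<in> E" "g1 e1 y \<noteq> 0" for y u
  proof -
    have "y \<noteq> 0" using y(2) by (auto simp: g_simps)
    then have yy: "g1 y y \<noteq> 0" by (simp add: inner_form_eq_0_iff[OF g1])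
    \<comment> \<open>The operators yield only the part of \<open>u\<close> orthogonal to
      \<open>y\<close>; the removed multiple of \<open>y\<close> lies in \<open>E\<close>
      anyway.\<close>
    define u' where "u' = u - (g1 u y / g1 y y) *\<^sub>R y"
    have "g1 u' y = 0" using yy by (simp add: u'_def g_simps)
    then have "(\<sigma> * g1 e1 y) *\<^sub>R (u', 0) \<in> E" using inv1[OF y(1), of u'] by simp
    then have "(1 / (\<sigma> * g1 e1 y)) *\<^sub>R ((\<sigma> * g1 e1 y) *\<^sub>R (u', 0)) \<in> E"
      using E subspace_scale by blast
    then have "(u', 0) \<in> E" using \<sigma> y(2) by simp
    then have "(u', 0) + (g1 u y / g1 y y) *\<^sub>R (y, 0) \<in> E"
      using E subspace_scale subspace_add y(1) by blast
    then show ?thesis by (simp add: u'_def)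
  qed
  have sub1: "UNIV \<times> {0} \<subseteq> E" if y: "(y, 0) \<in> E" "y \<noteq> 0" for y
  proof (cases "g1 e1 y = 0")
    case True
    \<comment> \<open>For \<open>y\<close> orthogonal to \<open>e1\<close>, the choice
      \<open>u = y\<close> in \<open>inv1\<close> leaves a multiple of \<open>e1\<close>, and
      \<open>one\<close> applies to \<open>e1\<close>.\<close>
    have "(1 / (\<sigma> * g1 y y)) *\<^sub>R (- ((\<sigma> * g1 e1 y) *\<^sub>R (y, 0) - (\<sigma> * g1 y y) *\<^sub>R (e1, 0))) \<in> E"
      using inv1[OF y(1), of y] E subspace_neg subspace_scale by blast
    then have "(e1, 0) \<in> E" using True \<sigma> inner_form_eq_0_iff[OF g1] y(2) by simp
    then show ?thesis using one[of e1] e1 by auto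
  qed (use one y in auto)
  show ?thesis
  proof (cases "\<exists>y w. (y, w) \<in> E \<and> (g2 f1 w \<noteq> 0 \<or> g2 v0 w \<noteq> 0)")
    case True
    then obtain y w where yw: "(y, w) \<in> E" "g2 f1 w \<noteq> 0 \<or> g2 v0 w \<noteq> 0" by blast
    define \<alpha> \<kappa> V where "\<alpha> = g2 f1 w" "\<kappa> = g2 v0 w" "V = g2 v0 v0"
    have V: "V > 0" using inner_form_pos[OF g2] v0 by (simp add: \<alpha>_\<kappa>_V_def)
    have v0f1: "g2 v0 f1 = 0" using v0(2) inner_form_sym[OF g2] by metis
    have p: "(0, \<alpha> *\<^sub>R v0 - \<kappa> *\<^sub>R f1) \<in> E" using J[OF yw(1)] by (simp add: \<alpha>_\<kappa>_V_def)
    have q: "(0, - \<kappa> *\<^sub>R v0 - (\<alpha> * V) *\<^sub>R f1) \<in> E" using J[OF p] v0(2) v0f1 f1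
      by (simp add: g_simps \<alpha>_\<kappa>_V_def)
    \<comment> \<open>This combination of the rotation and its square cancels \<open>v0\<close>. The
      coefficient \<open>- N\<close> of \<open>f1\<close> is nonzero because \<open>\<alpha>\<close>
      and \<open>\<kappa>\<close> are not both zero.\<close>
    have "\<kappa> *\<^sub>R (0, \<alpha> *\<^sub>R v0 - \<kappa> *\<^sub>R f1) + \<alpha> *\<^sub>R (0, - \<kappa> *\<^sub>R v0 - (\<alpha> * V) *\<^sub>R f1) \<in> E"
      using p q E subspace_scale subspace_add by blast
    moreover define N where "N = \<kappa>\<^sup>2 + \<alpha>\<^sup>2 * V"
    ultimately have "(0, - N *\<^sub>R f1) \<in> E"
      by (simp add: algebra_simps power2_eq_square)
    then have "(- 1 / N) *\<^sub>R (0, - N *\<^sub>R f1) \<in> E"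
      using E subspace_scale by blast
    moreover have "N > 0" unfolding N_def
      using yw(2) V by (cases "\<alpha> = 0") (auto simp: \<alpha>_\<kappa>_V_def(1,2)[symmetric] add_nonneg_pos)
    ultimately have f1E: "(0, f1) \<in> E" by simp
    have perp: "(0, v) \<in> E" if v: "g2 f1 v = 0" for v
    proof -
      have "g2 v f1 = 0" using v inner_form_sym[OF g2] by metis
      then have "(0, \<sigma> *\<^sub>R v) \<in> E"
        using inv[OF f1E, of v e1]
        by (simp add: Be f1 g_simps bilinear_lzero[OF B] bilinear_rzero[OF B])
      then have "(1 / \<sigma>) *\<^sub>R (0, \<sigma> *\<^sub>R v) \<in> E" using E subspace_scale by blast
      then show ?thesis using \<sigma> by simp
    qed
    have V2: "(0, v) \<in> E" for v
    proof -
      have "(0, v - g2 f1 v *\<^sub>R f1) \<in> E" by (rule perp) (simp add: g_simps f1)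
      then have "(0, v - g2 f1 v *\<^sub>R f1) + g2 f1 v *\<^sub>R (0, f1) \<in> E"
        using f1E E subspace_scale subspace_add by blast
      then show ?thesis by simp
    qed
    show ?thesis
    proof (cases "\<exists>y w. (y, w) \<in> E \<and> y \<noteq> 0")
      case True
      then obtain y w where y: "(y, w) \<in> E" "y \<noteq> 0" by blast
      have "(y, w) - (0, w) \<in> E" using y(1) V2 E subspace_diff by blast
      then have V1: "UNIV \<times> {0} \<subseteq> E" using sub1 y(2) by simp
      have "(a, b) \<in> E" for a b
      proof -
        have "(a, 0) + (0, b) \<in> E" using V1 V2 E subspace_add by blast
        then show ?thesis by simp
      qed
      then show ?thesis by auto
    next
      case False
      then have "E = {0} \<times> UNIV" using V2 by auto
      then show ?thesis by simp
    qed
  next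
    case False
    have w0: "w = 0" if yw: "(y, w) \<in> E" for y w
    proof -
      have f1w: "g2 f1 w = 0" using False yw by blast
      \<comment> \<open>With \<open>u = e1\<close> and \<open>v = w\<close> the second component is
        \<open>f1\<close> times \<open>- (\<sigma> * g2 w w)\<close>. Second components in
        \<open>E\<close> are orthogonal to \<open>f1\<close>, so \<open>g2 w w\<close> must be
        0.\<close>
      have "(B y w *\<^sub>R e1 - g1 e1 y *\<^sub>R \<beta> w, - (\<sigma> * g2 w w) *\<^sub>R f1) \<in> E"
        using inv[OF yw, of w e1] f1w by (simp add: Be \<gamma>e1 ac_simps)
      then have "g2 f1 (- (\<sigma> * g2 w w) *\<^sub>R f1) = 0" using False by blast
      then show ?thesis using \<sigma> f1 inner_form_eq_0_iff[OF g2] by (simp add: g_simps)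
    qed
    show ?thesis
    proof (cases "\<exists>y w. (y, w) \<in> E \<and> y \<noteq> 0")
      case True
      then show ?thesis using w0 sub1 by fastforce
    next
      case False
      then have "E \<subseteq> {0}" using w0 by (auto simp: zero_prod_def)
      then show ?thesis using subspace_0[OF E] by auto
    qed
  qed
qed

text \<open>The operator of \<open>e1\<close> and \<open>v0\<close> has the square
  \<open>- P\<close> on its plane in the first factor and \<open>- (\<sigma>\<^sup>2 * V)\<close> on
  its plane in the second. Its cube plus \<open>P\<close> times itself is therefore 0 on the first
  factor and \<open>P - \<sigma>\<^sup>2 * V\<close> times the operator on the second. For a maximal
  pair an inequality can only mean that \<open>\<beta> v0\<close> is too short.\<close>

lemma rotation_of_short_vector:
  assumes \<sigma>: "\<sigma> \<noteq> 0" and e1: "g1 e1 e1 = 1" and f1: "g2 f1 f1 = 1"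
    and Be: "\<And>w. B e1 w = \<sigma> * g2 f1 w"
    and v0: "g2 f1 v0 = 0" and short: "g1 (\<beta> v0) (\<beta> v0) \<noteq> \<sigma>\<^sup>2 * g2 v0 v0"
    and yw: "(y, w) \<in> E"
  shows "(0, g2 f1 w *\<^sub>R v0 - g2 v0 w *\<^sub>R f1) \<in> E"
proof -
  have \<gamma>e1: "\<gamma> e1 = \<sigma> *\<^sub>R f1"
    by (rule inner_form_eqI[OF g2]) (simp add: \<gamma> Be g_simps)
  define p P V where "p = \<beta> v0" "P = g1 (\<beta> v0) (\<beta> v0)" "V = g2 v0 v0"
  have pe: "g1 p e1 = 0" "g1 e1 p = 0"
    using Be[of v0] v0 \<beta>[of v0 e1] inner_form_sym[OF g1, of p e1] by (simp_all add: p_P_V_def)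
  have vf: "g2 v0 f1 = 0" using v0 inner_form_sym[OF g2] by metis
  have step: "(g1 p y *\<^sub>R e1 - g1 e1 y *\<^sub>R p, \<sigma> *\<^sub>R (g2 f1 w *\<^sub>R v0 - g2 v0 w *\<^sub>R f1)) \<in> E"
    if "(y, w) \<in> E" for y w
    using inv[OF that, of v0 e1] by (simp add: Be \<gamma>e1 \<beta>[of v0, symmetric] p_P_V_def algebra_simps)
  define y1 w1 where "y1 = g1 p y *\<^sub>R e1 - g1 e1 y *\<^sub>R p" "w1 = \<sigma> *\<^sub>R (g2 f1 w *\<^sub>R v0 - g2 v0 w *\<^sub>R f1)"
  define y2 w2 where "y2 = g1 p y1 *\<^sub>R e1 - g1 e1 y1 *\<^sub>R p" "w2 = \<sigma> *\<^sub>R (g2 f1 w1 *\<^sub>R v0 - g2 v0 w1 *\<^sub>R f1)"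
  define y3 w3 where "y3 = g1 p y2 *\<^sub>R e1 - g1 e1 y2 *\<^sub>R p" "w3 = \<sigma> *\<^sub>R (g2 f1 w2 *\<^sub>R v0 - g2 v0 w2 *\<^sub>R f1)"
  have E1: "(y1, w1) \<in> E" using step[OF yw] by (simp add: y1_w1_def)
  have E2: "(y2, w2) \<in> E" using step[OF E1] by (simp add: y2_w2_def)
  have E3: "(y3, w3) \<in> E" using step[OF E2] by (simp add: y3_w3_def)
  have PP: "g1 p p = P" "g2 v0 v0 = V" by (simp_all add: p_P_V_def)
  have c1: "g1 p y1 = - (g1 e1 y * P)" "g1 e1 y1 = g1 p y"
    by (simp_all add: y1_w1_def g_simps pe e1 PP)
  have c2: "g1 p y2 = - (g1 e1 y1 * P)" "g1 e1 y2 = g1 p y1"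
    by (simp_all add: y2_w2_def g_simps pe e1 PP)
  have y3: "y3 = - P *\<^sub>R y1"
    unfolding y3_w3_def c2 c1 unfolding y1_w1_def by (simp add: algebra_simps)
  have d1: "g2 f1 w1 = - \<sigma> * g2 v0 w" "g2 v0 w1 = \<sigma> * g2 f1 w * V"
    by (simp_all add: y1_w1_def g_simps vf v0 f1 PP)
  have d2: "g2 f1 w2 = - \<sigma> * g2 v0 w1" "g2 v0 w2 = \<sigma> * g2 f1 w1 * V"
    by (simp_all add: y2_w2_def g_simps vf v0 f1 PP)
  have w3: "w3 = - (\<sigma>\<^sup>2 * V) *\<^sub>R w1"
    unfolding y3_w3_def d2 d1 unfolding y1_w1_def by (simp add: algebra_simps power2_eq_square)
  have "(y3, w3) + P *\<^sub>R (y1, w1) \<in> E" using E1 E3 E subspace_scale subspace_add by blast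
  moreover have "(y3, w3) + P *\<^sub>R (y1, w1) = (P - \<sigma>\<^sup>2 * V) *\<^sub>R (0, w1)"
    by (simp add: y3 w3 algebra_simps)
  ultimately have "(1 / (\<sigma> * (P - \<sigma>\<^sup>2 * V))) *\<^sub>R ((P - \<sigma>\<^sup>2 * V) *\<^sub>R (0, w1)) \<in> E"
    using E subspace_scale by metis
  moreover have "P - \<sigma>\<^sup>2 * V \<noteq> 0" using short by (simp add: p_P_V_def)
  ultimately show ?thesis using \<sigma> by (simp add: y1_w1_def)
qed

text \<open>By \<open>hom\<close> the map \<open>e\<close> embeds the second factor isometrically in
  the first. Under this identification the operator of \<open>e i\<close> and \<open>j\<close> acts
  with opposite signs on the two factors, but a product of two such operators acts with equal signs.
  A commutator plus a single operator thus cancels in the first factor and doubles in the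
  second.\<close>

lemma rotation_of_homothety:
  assumes \<sigma>: "\<sigma> \<noteq> 0" and hom: "\<And>v w. g1 (\<beta> v) (\<beta> w) = \<sigma>\<^sup>2 * g2 v w" and "linear \<beta>"
    and f: "g2 f1 f1 = 1" "g2 f2 f2 = 1" "g2 f3 f3 = 1" "g2 f1 f2 = 0" "g2 f1 f3 = 0" "g2 f2 f3 = 0"
    and yw: "(y, w) \<in> E"
  shows "(0, g2 f1 w *\<^sub>R f2 - g2 f2 w *\<^sub>R f1) \<in> E"
proof -
  have f': "g2 f2 f1 = 0" "g2 f3 f1 = 0" "g2 f3 f2 = 0" using f inner_form_sym[OF g2] by metis+
  define e where "e v = (1 / \<sigma>) *\<^sub>R \<beta> v" for v
  have ge: "g1 (e v) (e w) = g2 v w" for v w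
    using \<sigma> by (simp add: e_def g_simps hom power2_eq_square)
  have \<gamma>e: "\<gamma> (e v) = \<sigma> *\<^sub>R v" for v
  proof (rule inner_form_eqI[OF g2])
    fix w
    show "g2 (\<gamma> (e v)) w = g2 (\<sigma> *\<^sub>R v) w"
      using \<sigma> hom[of w v] inner_form_sym[OF g2, of v w]
      by (simp add: \<gamma> \<beta>[symmetric] e_def g_simps power2_eq_square)
  qed
  have \<beta>e: "\<beta> v = \<sigma> *\<^sub>R e v" for v using \<sigma> by (simp add: e_def)
  have step: "(g1 (e j) y *\<^sub>R e i - g1 (e i) y *\<^sub>R e j, g2 i w *\<^sub>R j - g2 j w *\<^sub>R i) \<in> E"
    if "(y, w) \<in> E" for y w i j
  proof -
    have "(1 / \<sigma>) *\<^sub>R (B y j *\<^sub>R e i - g1 (e i) y *\<^sub>R \<beta> j, B (e i) w *\<^sub>R j - g2 j w *\<^sub>R \<gamma> (e i)) \<in> E"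
      using inv[OF that, of j "e i"] E subspace_scale by blast
    then show ?thesis using \<sigma>
      by (simp add: \<beta>[of j, symmetric] \<gamma>[of "e i", symmetric] \<gamma>e \<beta>e g_simps algebra_simps)
  qed
  \<comment> \<open>\<open>a\<close> and \<open>b\<close> are the two orders of the rotations in the
    planes of \<open>f3\<close>, \<open>f1\<close> and of \<open>f3\<close>, \<open>f2\<close>;
    their difference rotates the plane of \<open>f1\<close> and \<open>f2\<close>.\<close>
  have a: "(- g1 (e f1) y *\<^sub>R e f2, - g2 f1 w *\<^sub>R f2) \<in> E"
    using step[OF step[OF yw, of f3 f1], of f3 f2] by (simp add: g_simps ge f f')
  have b: "(- g1 (e f2) y *\<^sub>R e f1, - g2 f2 w *\<^sub>R f1) \<in> E"
    using step[OF step[OF yw, of f3 f2], of f3 f1] by (simp add: g_simps ge f f')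
  have "((- g1 (e f2) y *\<^sub>R e f1, - g2 f2 w *\<^sub>R f1) - (- g1 (e f1) y *\<^sub>R e f2, - g2 f1 w *\<^sub>R f2))
      + (g1 (e f2) y *\<^sub>R e f1 - g1 (e f1) y *\<^sub>R e f2, g2 f1 w *\<^sub>R f2 - g2 f2 w *\<^sub>R f1) \<in> E"
    using a b step[OF yw, of f2 f1] E subspace_add subspace_diff by blast
  also have "((- g1 (e f2) y *\<^sub>R e f1, - g2 f2 w *\<^sub>R f1) - (- g1 (e f1) y *\<^sub>R e f2, - g2 f1 w *\<^sub>R f2))
      + (g1 (e f2) y *\<^sub>R e f1 - g1 (e f1) y *\<^sub>R e f2, g2 f1 w *\<^sub>R f2 - g2 f2 w *\<^sub>R f1)
      = (2::real) *\<^sub>R (0, g2 f1 w *\<^sub>R f2 - g2 f2 w *\<^sub>R f1)"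
    by (simp add: scaleR_2)
  finally have "(1/2) *\<^sub>R ((2::real) *\<^sub>R (0, g2 f1 w *\<^sub>R f2 - g2 f2 w *\<^sub>R f1)) \<in> E"
    using E subspace_scale by blast
  then show ?thesis by simp
qed

text \<open>\<open>\<sigma>\<close> is the largest singular value of \<open>B\<close>, and
  \<open>e1\<close>, \<open>f1\<close> are singular vectors for it. The quotient \<open>q\<close> is
  invariant under scaling, so it can be maximised over the standard unit spheres, and the maximiser
  is rescaled to unit length for \<open>g1\<close> and \<open>g2\<close> afterwards.\<close>

lemma maximal_pair:
  assumes "B u0 v0 \<noteq> 0"
  obtains e1 f1 \<sigma> where "\<sigma> > 0" "g1 e1 e1 = 1" "g2 f1 f1 = 1"
    "\<And>u v. (B u v)\<^sup>2 \<le> \<sigma>\<^sup>2 * g1 u u * g2 v v" "B e1 f1 = \<sigma>"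
proof -
  define S where "S = sphere (0::'a) 1 \<times> sphere (0::'b) 1"
  define q where "q x = (B (fst x) (snd x))\<^sup>2 / (g1 (fst x) (fst x) * g2 (snd x) (snd x))" for x
  have pos: "g1 (fst x) (fst x) * g2 (snd x) (snd x) > 0" if "x \<in> S" for x
    using that inner_form_pos[OF g1, of "fst x"] inner_form_pos[OF g2, of "snd x"]
    by (force simp: S_def)
  have Sc: "compact S" by (simp add: S_def compact_Times)
  have Sne: "S \<noteq> {}"
  proof -
    obtain i :: 'a where "i \<in> Basis" using nonempty_Basis by blast
    moreover obtain j :: 'b where "j \<in> Basis" using nonempty_Basis by blast
    ultimately have "(i, j) \<in> S" by (simp add: S_def)
    then show ?thesis by blast
  qed
  have qc: "continuous_on S q"
  proof -
    note c = continuous_on_fst[OF continuous_on_id] continuous_on_snd[OF continuous_on_id]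
    have B': "continuous_on S (\<lambda>x. B (fst x) (snd x))"
      by (rule bilinear_continuous_on_compose[OF c B])
    have g1': "continuous_on S (\<lambda>x. g1 (fst x) (fst x))"
      by (rule bilinear_continuous_on_compose[OF c(1) c(1) inner_form_bilinear[OF g1]])
    have g2': "continuous_on S (\<lambda>x. g2 (snd x) (snd x))"
      by (rule bilinear_continuous_on_compose[OF c(2) c(2) inner_form_bilinear[OF g2]])
    have nz: "\<forall>x\<in>S. g1 (fst x) (fst x) * g2 (snd x) (snd x) \<noteq> 0" using pos by force
    show ?thesis unfolding q_def
      by (rule continuous_on_divide[OF continuous_on_power[OF B'] continuous_on_mult[OF g1' g2'] nz])
  qed
  obtain x where x: "x \<in> S" "\<And>y. y \<in> S \<Longrightarrow> q y \<le> q x"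
    using continuous_attains_sup[OF Sc Sne qc] by metis
  define a b where "a = sqrt (g1 (fst x) (fst x))" "b = sqrt (g2 (snd x) (snd x))"
  have xx: "fst x \<noteq> 0" "snd x \<noteq> 0" using x(1) by (auto simp: S_def)
  have ab: "a > 0" "b > 0" "g1 (fst x) (fst x) = a * a" "g2 (snd x) (snd x) = b * b"
    using inner_form_pos[OF g1 xx(1)] inner_form_pos[OF g2 xx(2)] by (simp_all add: a_b_def)
  have qx: "(B u v)\<^sup>2 \<le> q x * (g1 u u * g2 v v)" for u v
  proof (cases "u = 0 \<or> v = 0")
    case True
    then show ?thesis by (auto simp: g_simps bilinear_lzero[OF B] bilinear_rzero[OF B])
  next
    case False
    have "(u /\<^sub>R norm u, v /\<^sub>R norm v) \<in> S" using False by (simp add: S_def)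
    from x(2)[OF this] have "q (u /\<^sub>R norm u, v /\<^sub>R norm v) \<le> q x" .
    moreover have "q (u /\<^sub>R norm u, v /\<^sub>R norm v) = (B u v)\<^sup>2 / (g1 u u * g2 v v)"
      using False by (simp add: q_def g_simps bilinear_lmul[OF B] bilinear_rmul[OF B] field_simps power2_eq_square)
    moreover have "g1 u u * g2 v v > 0"
      using False inner_form_pos[OF g1, of u] inner_form_pos[OF g2, of v] by simp
    ultimately show ?thesis by (simp add: field_simps)
  qed
  \<comment> \<open>Reverses the second vector if necessary, so that the maximal value of
    \<open>B\<close> itself is positive.\<close>
  define s where "s = (if B (fst x) (snd x) < 0 then - 1 else 1 :: real)"
  have s: "s * s = 1" "s * B (fst x) (snd x) = \<bar>B (fst x) (snd x)\<bar>" by (auto simp: s_def)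
  define \<sigma> where "\<sigma> = \<bar>B (fst x) (snd x)\<bar> / (a * b)"
  have qs: "q x = \<sigma>\<^sup>2" using ab by (simp add: q_def \<sigma>_def power2_eq_square field_simps)
  have "\<sigma> \<noteq> 0" using qx[of u0 v0] assms by (auto simp: qs)
  then have "\<sigma> > 0" using ab by (simp add: \<sigma>_def)
  then show ?thesis
  proof (rule that)
    show "g1 (fst x /\<^sub>R a) (fst x /\<^sub>R a) = 1" using ab by (simp add: g_simps field_simps)
    show "g2 ((s / b) *\<^sub>R snd x) ((s / b) *\<^sub>R snd x) = 1" using ab s(1) by (simp add: g_simps field_simps)
    show "B (fst x /\<^sub>R a) ((s / b) *\<^sub>R snd x) = \<sigma>"
      using ab s(2) by (simp add: \<sigma>_def bilinear_lmul[OF B] bilinear_rmul[OF B] field_simps)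
    show "(B u v)\<^sup>2 \<le> \<sigma>\<^sup>2 * g1 u u * g2 v v" for u v
      using qx[of u v] by (simp add: qs mult.assoc)
  qed
qed

text \<open>First-order condition at a maximum: the right-hand side has no linear term in
  \<open>t\<close>, so the linear term \<open>2 * \<sigma> * b * t\<close> on the left must
  vanish.\<close>

lemma perturbation_zero:
  fixes \<sigma> b C :: real
  assumes "\<sigma> > 0" "\<And>t. (\<sigma> + t * b)\<^sup>2 \<le> \<sigma>\<^sup>2 * (1 + t\<^sup>2 * C)" "C \<ge> 0"
  shows "b = 0"
proof (rule ccontr)
  assume b: "b \<noteq> 0"
  define D where "D = \<sigma>\<^sup>2 * C"
  have D: "D \<ge> 0" using assms by (simp add: D_def)
  have *: "2 * \<sigma> * b * t \<le> D * t\<^sup>2" for t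
  proof -
    have "(\<sigma> + t * b)\<^sup>2 = \<sigma>\<^sup>2 + 2 * \<sigma> * b * t + (t * b)\<^sup>2"
      by (simp add: power2_eq_square algebra_simps)
    moreover have "\<sigma>\<^sup>2 * (1 + t\<^sup>2 * C) = \<sigma>\<^sup>2 + D * t\<^sup>2" by (simp add: D_def algebra_simps)
    ultimately show ?thesis using assms(2)[of t] zero_le_power2[of "t * b"] by linarith
  qed
  \<comment> \<open>Here the linear term is twice \<open>(\<sigma> * b)\<^sup>2 / (D + 1)\<close>
    and the quadratic term at most that number; the 1 covers \<open>D = 0\<close>.\<close>
  define t where "t = \<sigma> * b / (D + 1)"
  have "2 * \<sigma> * b * t = 2 * (\<sigma> * b)\<^sup>2 / (D + 1)" by (simp add: t_def power2_eq_square)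
  moreover have "D * t\<^sup>2 = (D / (D + 1)) * ((\<sigma> * b)\<^sup>2 / (D + 1))" by (simp add: t_def power2_eq_square)
  moreover have "(D / (D + 1)) * ((\<sigma> * b)\<^sup>2 / (D + 1)) \<le> 1 * ((\<sigma> * b)\<^sup>2 / (D + 1))"
    using D by (intro mult_right_mono) auto
  ultimately have "(\<sigma> * b)\<^sup>2 / (D + 1) \<le> 0" using *[of t] by simp
  moreover have "(\<sigma> * b)\<^sup>2 / (D + 1) > 0" using b assms(1) D by simp
  ultimately show False by simp
qed

lemma invariant_subspace:
  assumes "B u0 v0 \<noteq> 0" and dims: "DIM('b) \<ge> 3 \<or> (DIM('a) = 1 \<and> DIM('b) = 2)"
  shows "E \<in> {{0}, UNIV, UNIV \<times> {0}, {0} \<times> UNIV}"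
proof -
  obtain e1 f1 \<sigma> where \<sigma>: "\<sigma> > 0" and e1: "g1 e1 e1 = 1" and f1: "g2 f1 f1 = 1"
    and max: "\<And>u v. (B u v)\<^sup>2 \<le> \<sigma>\<^sup>2 * g1 u u * g2 v v" and Bef: "B e1 f1 = \<sigma>"
    using maximal_pair[OF assms(1)] by metis
  \<comment> \<open>Moving \<open>f1\<close> in an orthogonal direction changes its squared length
    to second order only, so maximality leaves \<open>B e1\<close> no first-order change.\<close>
  have B0: "B e1 w = 0" if "g2 f1 w = 0" for w
  proof (rule perturbation_zero[OF \<sigma>])
    show "(\<sigma> + t * B e1 w)\<^sup>2 \<le> \<sigma>\<^sup>2 * (1 + t\<^sup>2 * g2 w w)" for t
      using max[of e1 "f1 + t *\<^sub>R w"] that inner_form_sym[OF g2, of w f1]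
      by (simp add: g_simps bilinear_radd[OF B] bilinear_rmul[OF B] Bef e1 f1 power2_eq_square algebra_simps)
  qed (rule inner_form_nonneg[OF g2])
  have B1: "B y f1 = 0" if "g1 e1 y = 0" for y
  proof (rule perturbation_zero[OF \<sigma>])
    show "(\<sigma> + t * B y f1)\<^sup>2 \<le> \<sigma>\<^sup>2 * (1 + t\<^sup>2 * g1 y y)" for t
      using max[of "e1 + t *\<^sub>R y" f1] that inner_form_sym[OF g1, of y e1]
      by (simp add: g_simps bilinear_ladd[OF B] bilinear_lmul[OF B] Bef e1 f1 power2_eq_square algebra_simps)
  qed (rule inner_form_nonneg[OF g1])
  have Be: "B e1 w = \<sigma> * g2 f1 w" for w
    using B0[of "w - g2 f1 w *\<^sub>R f1"]
    by (simp add: g_simps f1 bilinear_rsub[OF B] bilinear_rmul[OF B] Bef)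
  have Bf: "B y f1 = \<sigma> * g1 e1 y" for y
    using B1[of "y - g1 e1 y *\<^sub>R e1"]
    by (simp add: g_simps e1 bilinear_lsub[OF B] bilinear_lmul[OF B] Bef)
  have \<sigma>0: "\<sigma> \<noteq> 0" using \<sigma> by simp
  show ?thesis
  proof (cases "\<exists>v0. g2 f1 v0 = 0 \<and> g1 (\<beta> v0) (\<beta> v0) \<noteq> \<sigma>\<^sup>2 * g2 v0 v0")
    case True
    then obtain v0 where v0: "g2 f1 v0 = 0" "g1 (\<beta> v0) (\<beta> v0) \<noteq> \<sigma>\<^sup>2 * g2 v0 v0" by blast
    have "\<beta> 0 = 0" by (rule inner_form_eqI[OF g1]) (simp add: \<beta> g_simps bilinear_rzero[OF B])
    then have "v0 \<noteq> 0" using v0(2) by (auto simp: g_simps)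
    then show ?thesis
      by (rule invariant_subspace_of_rotation[OF \<sigma>0 e1 f1 Be Bf _ v0(1)])
         (rule rotation_of_short_vector[OF \<sigma>0 e1 f1 Be v0])
  next
    case False
    then have hom0: "g1 (\<beta> v) (\<beta> v) = \<sigma>\<^sup>2 * g2 v v" if "g2 f1 v = 0" for v using that by blast
    have "DIM('b) > 1" using dims by auto
    then obtain f2 where f2: "g2 f2 f2 = 1" "g2 f1 f2 = 0"
      using inner_form_orthogonal_exists[OF g2, of "{f1}"] by auto
    \<comment> \<open>On a one-dimensional first factor \<open>\<beta> f2\<close>, being orthogonal
      to \<open>e1\<close>, would vanish, but \<open>hom0\<close> gives it the length
      \<open>\<sigma>\<close>.\<close>
    have "DIM('a) \<noteq> 1"
    proof
      assume "DIM('a) = 1"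
      then obtain b :: 'a where b: "Basis = {b}" by (metis card_1_singletonE)
      have rep: "y = (y \<bullet> b) *\<^sub>R b" for y :: 'a
        using euclidean_representation[of y] unfolding b by simp
      have "g1 e1 (\<beta> f2) = 0"
        using \<beta>[of f2 e1] Be[of f2] f2 inner_form_sym[OF g1] by simp
      then have "g1 ((e1 \<bullet> b) *\<^sub>R b) ((\<beta> f2 \<bullet> b) *\<^sub>R b) = 0"
        by (simp only: rep[symmetric])
      then have "(e1 \<bullet> b) * ((\<beta> f2 \<bullet> b) * g1 b b) = 0" by (auto simp: g_simps)
      moreover have "g1 b b \<noteq> 0" using inner_form_eq_0_iff[OF g1] b nonzero_Basis by blast
      moreover have "e1 \<bullet> b \<noteq> 0"
      proof
        assume "e1 \<bullet> b = 0"
        then have "e1 = 0" by (subst rep) simp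
        then show False using e1 by (simp add: g_simps)
      qed
      ultimately have "\<beta> f2 \<bullet> b = 0" by simp
      then have "\<beta> f2 = 0" by (subst rep) simp
      then show False using hom0[OF f2(2)] f2(1) \<sigma> by (simp add: g_simps)
    qed
    then have "DIM('b) \<ge> 3" using dims by simp
    moreover have "card {f1, f2} \<le> 2" by (simp add: card_insert_if)
    ultimately have "card {f1, f2} < DIM('b)" by linarith
    then obtain f3 where "g2 f3 f3 = 1" "\<And>s. s \<in> {f1, f2} \<Longrightarrow> g2 s f3 = 0"
      by (rule inner_form_orthogonal_exists[OF g2]) auto
    then have f3: "g2 f3 f3 = 1" "g2 f1 f3 = 0" "g2 f2 f3 = 0" by auto
    have \<beta>lin: "linear \<beta>"
      by (rule linearI; rule inner_form_eqI[OF g1])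
         (simp_all add: g_simps \<beta> bilinear_radd[OF B] bilinear_rmul[OF B])
    have \<beta>f1: "\<beta> f1 = \<sigma> *\<^sub>R e1"
      by (rule inner_form_eqI[OF g1]) (simp add: \<beta> Bf g_simps)
    \<comment> \<open>\<open>hom0\<close> speaks of the complement of \<open>f1\<close> only. Since
      \<open>\<beta> f1\<close> is \<open>\<sigma>\<close> times \<open>e1\<close> and orthogonal to
      the image of the complement, it extends by Pythagoras; polarisation then gives all scalar
      products.\<close>
    have hom1: "g1 (\<beta> v) (\<beta> v) = \<sigma>\<^sup>2 * g2 v v" for v
    proof -
      define v' c where "v' = v - g2 f1 v *\<^sub>R f1" "c = g2 f1 v"
      have v: "v = v' + c *\<^sub>R f1" by (simp add: v'_c_def)
      have o: "g2 f1 v' = 0" "g2 v' f1 = 0"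
        using inner_form_sym[OF g2, of v' f1] by (simp_all add: v'_c_def g_simps f1)
      have o': "g1 (\<beta> v') e1 = 0" "g1 e1 (\<beta> v') = 0"
        using \<beta>[of v' e1] Be[of v'] o inner_form_sym[OF g1, of e1 "\<beta> v'"] by simp_all
      show ?thesis
        unfolding v using hom0[OF o(1)]
        by (simp add: linear_add[OF \<beta>lin] linear_cmul[OF \<beta>lin] \<beta>f1 g_simps o o' e1 f1 power2_eq_square algebra_simps)
    qed
    have hom: "g1 (\<beta> v) (\<beta> w) = \<sigma>\<^sup>2 * g2 v w" for v w
      using hom1[of "v + w"] hom1[of v] hom1[of w] inner_form_sym[OF g1, of "\<beta> w" "\<beta> v"]
        inner_form_sym[OF g2, of w v]
      by (simp add: linear_add[OF \<beta>lin] g_simps algebra_simps)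
    have "f2 \<noteq> 0" using f2 by (auto simp: g_simps)
    then show ?thesis
      by (rule invariant_subspace_of_rotation[OF \<sigma>0 e1 f1 Be Bf _ f2(2)])
         (rule rotation_of_homothety[OF \<sigma>0 hom \<beta>lin f1 f2(1) f3(1) f2(2) f3(2,3)])
  qed
qed

end

section \<open>Determinants\<close>

text \<open>A permutation of the columns is absorbed by substituting \<open>p \<circ> q\<close> for
  the summation variable, at the cost of the sign of \<open>q\<close>.\<close>

lemma endo_det_reindex:
  fixes f :: "'e::euclidean_space \<Rightarrow> 'e"
  assumes q: "q permutes Basis"
  shows "(\<Sum>p | p permutes Basis. of_int (sign p) * (\<Prod>b\<in>Basis. f (q b) \<bullet> p b)) =
         of_int (sign q) * endo_det f" (is "?l = _")
proof -
  have "?l = (\<Sum>p | p permutes Basis. of_int (sign (p \<circ> q)) * (\<Prod>b\<in>Basis. f (q b) \<bullet> (p \<circ> q) b))"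
    by (rule sum_permutations_compose_right[OF q])
  also have "\<dots> = (\<Sum>p | p permutes Basis. of_int (sign q) * (of_int (sign p) * (\<Prod>b\<in>Basis. f b \<bullet> p b)))"
  proof (rule sum.cong[OF refl])
    fix p :: "'e \<Rightarrow> 'e"
    assume "p \<in> {p. p permutes Basis}"
    then have p: "p permutes Basis" by simp
    have "sign (p \<circ> q) = sign p * sign q"
      using p q permutation_permutes finite_Basis by (metis sign_compose)
    moreover have "(\<Prod>b\<in>Basis. f (q b) \<bullet> (p \<circ> q) b) = (\<Prod>b\<in>Basis. f b \<bullet> p b)"
      using prod.permute[OF q, of "\<lambda>b. f b \<bullet> p b"] by (simp add: comp_def)
    ultimately show "of_int (sign (p \<circ> q)) * (\<Prod>b\<in>Basis. f (q b) \<bullet> (p \<circ> q) b)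
        = of_int (sign q) * (of_int (sign p) * (\<Prod>b\<in>Basis. f b \<bullet> p b))"
      by simp
  qed
  finally show ?thesis by (simp add: endo_det_def sum_distrib_left)
qed

text \<open>Exchanging the two equal columns reverses the sign and changes nothing.\<close>

lemma endo_det_not_inj:
  fixes f :: "'e::euclidean_space \<Rightarrow> 'e"
  assumes "i \<in> Basis" "j \<in> Basis" "i \<noteq> j" "f i = f j"
  shows "endo_det f = 0"
proof -
  let ?q = "Transposition.transpose i j"
  have q: "?q permutes Basis" using assms by (simp add: permutes_swap_id)
  have "f (?q b) = f b" for b using assms(4) by (auto simp: Transposition.transpose_def)
  then have "endo_det f = of_int (sign ?q) * endo_det f"
    using endo_det_reindex[OF q, of f] by (simp add: endo_det_def)
  then show ?thesis using assms(3) by (simp add: sign_swap_id)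
qed

text \<open>Multilinearity expands the left-hand side over all maps \<open>\<phi>\<close> of the
  basis to itself. Those that repeat a column contribute 0, and the injective ones are
  permutations.\<close>

lemma endo_det_mult:
  fixes f g :: "'e::euclidean_space \<Rightarrow> 'e"
  assumes "linear f"
  shows "endo_det (\<lambda>x. f (g x)) = endo_det f * endo_det g"
proof -
  let ?P = "{p. p permutes (Basis :: 'e set)}"
  let ?F = "PiE (Basis :: 'e set) (\<lambda>_. Basis)"
  define c where "c \<phi> = (\<Prod>b\<in>Basis. g b \<bullet> \<phi> b)" for \<phi> :: "'e \<Rightarrow> 'e"
  define s where "s \<phi> = endo_det (\<lambda>b. f (\<phi> b))" for \<phi> :: "'e \<Rightarrow> 'e"
  have fg: "f (g b) \<bullet> d = (\<Sum>e\<in>Basis. (g b \<bullet> e) * (f e \<bullet> d))" for b d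
    by (rule Linear_Algebra.linear_componentwise[OF assms])
  have "endo_det (\<lambda>x. f (g x)) =
    (\<Sum>p\<in>?P. \<Sum>\<phi>\<in>?F. of_int (sign p) * (c \<phi> * (\<Prod>b\<in>Basis. f (\<phi> b) \<bullet> p b)))"
    by (simp add: endo_det_def fg prod_sum_PiE prod.distrib c_def sum_distrib_left)
  also have "\<dots> = (\<Sum>\<phi>\<in>?F. c \<phi> * s \<phi>)"
    by (subst sum.swap) (simp add: s_def endo_det_def sum_distrib_left mult_ac)
  \<comment> \<open>Elements of \<open>PiE\<close> are \<open>undefined\<close> outside the basis
    whereas permutations are the identity there, hence the \<open>restrict\<close>.\<close>
  also have "\<dots> = (\<Sum>\<phi>\<in>(\<lambda>p. restrict p Basis) ` ?P. c \<phi> * s \<phi>)"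
  proof (rule sum.mono_neutral_right)
    show "finite ?F" by (simp add: finite_PiE)
    show "(\<lambda>p. restrict p Basis) ` ?P \<subseteq> ?F"
      by (rule image_subsetI) (simp add: permutes_in_image)
    show "\<forall>\<phi>\<in>?F - (\<lambda>p. restrict p Basis) ` ?P. c \<phi> * s \<phi> = 0"
    proof
      fix \<phi>
      assume \<phi>: "\<phi> \<in> ?F - (\<lambda>p. restrict p Basis) ` ?P"
      have "\<not> inj_on \<phi> Basis"
      proof
        assume inj: "inj_on \<phi> Basis"
        have im: "\<phi> ` Basis \<subseteq> Basis" using \<phi> by auto
        have bij: "bij_betw \<phi> Basis Basis"
          using inj im by (simp add: bij_betw_def endo_inj_surj)
        define p where "p b = (if b \<in> Basis then \<phi> b else b)" for b
        have "bij_betw p Basis Basis \<longleftrightarrow> bij_betw \<phi> Basis Basis"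
          by (rule bij_betw_cong) (simp add: p_def)
        with bij have "bij_betw p Basis Basis" by simp
        then have "p permutes Basis" by (rule bij_imp_permutes) (simp add: p_def)
        moreover have "\<phi> = restrict p Basis"
          using \<phi> by (auto simp: p_def fun_eq_iff PiE_def extensional_def)
        ultimately show False using \<phi> by blast
      qed
      then obtain i j where "i \<in> Basis" "j \<in> Basis" "i \<noteq> j" "\<phi> i = \<phi> j"
        by (auto simp: inj_on_def)
      then have "s \<phi> = 0" unfolding s_def by (intro endo_det_not_inj[of i j]) auto
      then show "c \<phi> * s \<phi> = 0" by simp
    qed
  qed
  also have "\<dots> = (\<Sum>p\<in>?P. c (restrict p Basis) * s (restrict p Basis))"
  proof (rule sum.reindex_cong[where l = "\<lambda>p. restrict p Basis"])
    show "inj_on (\<lambda>p. restrict p (Basis :: 'e set)) ?P"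
    proof (rule inj_onI, rule ext)
      fix p q :: "'e \<Rightarrow> 'e" and x
      assume pq: "p \<in> ?P" "q \<in> ?P" "restrict p Basis = restrict q Basis"
      show "p x = q x"
        using fun_cong[OF pq(3), of x] pq(1,2) by (cases "x \<in> Basis") (simp_all add: permutes_not_in)
    qed
  qed auto
  also have "\<dots> = (\<Sum>p\<in>?P. endo_det f * (of_int (sign p) * c p))"
  proof (rule sum.cong[OF refl])
    fix p :: "'e \<Rightarrow> 'e"
    assume "p \<in> ?P"
    then have p: "p permutes Basis" by simp
    have "s (restrict p Basis) = of_int (sign p) * endo_det f"
      using endo_det_reindex[OF p, of f] by (simp add: s_def endo_det_def)
    moreover have "c (restrict p Basis) = c p" by (simp add: c_def)
    ultimately show "c (restrict p Basis) * s (restrict p Basis) = endo_det f * (of_int (sign p) * c p)"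
      by simp
  qed
  also have "\<dots> = endo_det f * endo_det g"
    by (simp add: endo_det_def[of g] c_def sum_distrib_left)
  finally show ?thesis .
qed

text \<open>If \<open>i\<close> is moved, so is its image. Hence a non-identity permutation makes at
  least two factors of its Leibniz product vanish at the identity matrix, and one of them remains
  when the product rule differentiates the other.\<close>

lemma prod_inner_perm_eq_0:
  assumes "p permutes Basis" "p \<noteq> id"
  obtains i j :: "'e::euclidean_space"
  where "i \<in> Basis" "j \<in> Basis" "i \<noteq> j" "p i \<noteq> i" "p j \<noteq> j"
proof -
  obtain i where i: "p i \<noteq> i" using assms(2) by (auto simp: fun_eq_iff)
  then have iB: "i \<in> Basis" using assms(1) by (meson permutes_not_in)
  then have "p i \<in> Basis" using assms(1) by (simp add: permutes_in_image)
  moreover have "p (p i) \<noteq> p i" using i assms(1) by (metis permutes_inj injD)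
  ultimately show ?thesis using that i iB by metis
qed

lemma endo_det_id: "endo_det (\<lambda>x. x :: 'e::euclidean_space) = 1"
proof -
  have "(\<Prod>b\<in>Basis. b \<bullet> p b) = 0" if p: "p permutes Basis" "p \<noteq> id" for p :: "'e \<Rightarrow> 'e"
  proof -
    obtain i where i: "i \<in> Basis" "p i \<noteq> i" using prod_inner_perm_eq_0[OF p] by metis
    then have "i \<bullet> p i = 0" using p(1) by (simp add: inner_Basis permutes_in_image)
    then show ?thesis using i(1) by (simp add: prod_zero_iff) (use i(1) in blast)
  qed
  then have "endo_det (\<lambda>x. x :: 'e) = (\<Sum>p | p permutes (Basis :: 'e set). if p = id then 1 else 0)"
    unfolding endo_det_def by (intro sum.cong refl) (auto simp: inner_Basis)
  also have "\<dots> = 1"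
    by (subst sum.delta) (auto simp: finite_permutations permutes_id)
  finally show ?thesis .
qed

text \<open>Invariance under transposition: summing over inverse permutations only reorders each
  product.\<close>

lemma endo_det_adjoint:
  assumes "\<And>b c. b \<in> Basis \<Longrightarrow> c \<in> Basis \<Longrightarrow> h b \<bullet> c = b \<bullet> f c"
  shows "endo_det h = endo_det (f :: 'e::euclidean_space \<Rightarrow> 'e)"
proof -
  have "endo_det h = (\<Sum>p | p permutes (Basis :: 'e set). of_int (sign (inv p)) * (\<Prod>b\<in>Basis. h b \<bullet> inv p b))"
    unfolding endo_det_def by (rule sum_permutations_inverse)
  also have "\<dots> = (\<Sum>p | p permutes (Basis :: 'e set). of_int (sign p) * (\<Prod>b\<in>Basis. f b \<bullet> p b))"
  proof (rule sum.cong[OF refl])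
    fix p :: "'e \<Rightarrow> 'e"
    assume "p \<in> {p. p permutes Basis}"
    then have p: "p permutes Basis" by simp
    have "(\<Prod>b\<in>Basis. h b \<bullet> inv p b) = (\<Prod>b\<in>Basis. h (p b) \<bullet> inv p (p b))"
      using prod.permute[OF p, of "\<lambda>b. h b \<bullet> inv p b"] by (simp add: comp_def)
    also have "\<dots> = (\<Prod>b\<in>Basis. f b \<bullet> p b)"
      by (rule prod.cong[OF refl])
         (simp add: permutes_inverses[OF p] assms permutes_in_image[OF p] inner_commute[of "p _"])
    finally show "of_int (sign (inv p)) * (\<Prod>b\<in>Basis. h b \<bullet> inv p b) =
        of_int (sign p) * (\<Prod>b\<in>Basis. f b \<bullet> p b)"
      using p permutation_permutes finite_Basis by (metis sign_inverse)
  qed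
  finally show ?thesis by (simp add: endo_det_def)
qed

lemma endo_det_cong: "(\<And>b. b \<in> Basis \<Longrightarrow> f b = g b) \<Longrightarrow> endo_det f = endo_det g"
  by (simp add: endo_det_def)

lemma endo_det_nonzero:
  fixes f g :: "'e::euclidean_space \<Rightarrow> 'e"
  assumes "linear f" "\<And>x. f (g x) = x"
  shows "endo_det f \<noteq> 0" "endo_det g \<noteq> 0"
  using endo_det_mult[OF assms(1), of g] assms(2) by (auto simp: endo_det_id)

section \<open>Traces and the derivative of the determinant\<close>

lemma endo_trace_commute:
  fixes f g :: "'e::euclidean_space \<Rightarrow> 'e"
  assumes "linear f" "linear g"
  shows "endo_trace (\<lambda>x. f (g x)) = endo_trace (\<lambda>x. g (f x))"
proof -
  have *: "f (g b) \<bullet> b = (\<Sum>e\<in>Basis. (g b \<bullet> e) * (f e \<bullet> b))"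
    if "linear f" for f g :: "'e \<Rightarrow> 'e" and b
    by (rule Linear_Algebra.linear_componentwise[OF that])
  have "endo_trace (\<lambda>x. f (g x)) = (\<Sum>b\<in>Basis. \<Sum>e\<in>Basis. (g b \<bullet> e) * (f e \<bullet> b))"
    unfolding endo_trace_def by (rule sum.cong[OF refl *[OF assms(1)]])
  also have "\<dots> = (\<Sum>e\<in>Basis. \<Sum>b\<in>Basis. (f e \<bullet> b) * (g b \<bullet> e))"
    by (subst sum.swap) (simp only: mult.commute)
  also have "\<dots> = endo_trace (\<lambda>x. g (f x))"
    unfolding endo_trace_def by (rule sum.cong[OF refl *[OF assms(2), symmetric]])
  finally show ?thesis .
qed

text \<open>Every summand of the product rule keeps a zero factor unless the permutation is the
  identity, and the identity contributes the trace.\<close>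

lemma has_derivative_endo_det_at_id:
  fixes G :: "'z::real_normed_vector \<Rightarrow> 'e::euclidean_space \<Rightarrow> 'e"
  assumes "\<And>b c. b \<in> Basis \<Longrightarrow> c \<in> Basis \<Longrightarrow>
      ((\<lambda>z. G z b \<bullet> c) has_derivative (\<lambda>v. G' v b \<bullet> c)) (at z)"
    and "\<And>b. b \<in> Basis \<Longrightarrow> G z b = b"
  shows "((\<lambda>z. endo_det (G z)) has_derivative (\<lambda>v. endo_trace (G' v))) (at z)"
proof -
  let ?P = "{p. p permutes (Basis :: 'e set)}"
  define T where "T p v = (\<Sum>i\<in>Basis. (G' v i \<bullet> p i) * (\<Prod>j\<in>Basis - {i}. G z j \<bullet> p j))" for p v
  have d: "((\<lambda>z. \<Prod>b\<in>Basis. G z b \<bullet> p b) has_derivative T p) (at z)" if p: "p permutes Basis" for p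
    unfolding T_def
    by (rule has_derivative_prod) (rule assms(1), use p in \<open>auto simp: permutes_in_image\<close>)
  have D: "((\<lambda>z. endo_det (G z)) has_derivative (\<lambda>v. \<Sum>p\<in>?P. of_int (sign p) * T p v)) (at z)"
    unfolding endo_det_def
    by (intro has_derivative_sum has_derivative_mult_right) (use d in auto)
  have T0: "T p v = 0" if p: "p permutes Basis" "p \<noteq> id" for p v
  proof -
    obtain i j where ij: "i \<in> Basis" "j \<in> Basis" "i \<noteq> j" "p i \<noteq> i" "p j \<noteq> j"
      using prod_inner_perm_eq_0[OF p] by metis
    have z: "G z b \<bullet> p b = 0" if "b \<in> Basis" "p b \<noteq> b" for b
      using that p(1) assms(2) by (simp add: inner_Basis permutes_in_image)
    have "(\<Prod>j\<in>Basis - {b}. G z j \<bullet> p j) = 0" if "b \<in> Basis" for b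
    proof (cases "b = i")
      case True
      then show ?thesis using ij z by (intro prod_zero) auto
    next
      case False
      then show ?thesis using ij z by (intro prod_zero) auto
    qed
    then show ?thesis unfolding T_def by (intro sum.neutral ballI) (simp only: mult_zero_right)
  qed
  have "(\<Sum>p\<in>?P. of_int (sign p) * T p v) = endo_trace (G' v)" for v
  proof -
    have "(\<Sum>p\<in>?P. of_int (sign p) * T p v) = (\<Sum>p\<in>?P. if p = id then endo_trace (G' v) else 0)"
    proof (rule sum.cong[OF refl])
      fix p :: "'e \<Rightarrow> 'e"
      assume "p \<in> ?P"
      moreover have "(\<Prod>j\<in>Basis - {i}. G z j \<bullet> j) = 1" for i
        by (rule prod.neutral) (simp add: assms(2))
      then have "T id v = endo_trace (G' v)" by (simp add: T_def endo_trace_def)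
      ultimately show "of_int (sign p) * T p v = (if p = id then endo_trace (G' v) else 0)"
        using T0 by auto
    qed
    also have "\<dots> = endo_trace (G' v)"
      by (subst sum.delta) (auto simp: finite_permutations permutes_id)
    finally show ?thesis .
  qed
  then show ?thesis using D by simp
qed

text \<open>Jacobi's formula. Composition with the fixed inverse \<open>h\<close> of
  \<open>G z\<close> moves the base point to the identity, and multiplicativity restores the
  factor.\<close>

lemma has_derivative_endo_det:
  fixes G :: "'z::real_normed_vector \<Rightarrow> 'e::euclidean_space \<Rightarrow> 'e"
  assumes d: "\<And>b c. b \<in> Basis \<Longrightarrow> c \<in> Basis \<Longrightarrow>
      ((\<lambda>z. G z b \<bullet> c) has_derivative (\<lambda>v. G' v b \<bullet> c)) (at z)"
    and lin: "linear (G z)" "linear h" and h: "\<And>x. G z (h x) = x" "\<And>x. h (G z x) = x"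
  shows "((\<lambda>z. endo_det (G z)) has_derivative (\<lambda>v. endo_det (G z) * endo_trace (\<lambda>b. h (G' v b)))) (at z)"
proof -
  have hs: "h x \<bullet> c = (\<Sum>e\<in>Basis. (x \<bullet> e) * (h e \<bullet> c))" for x c
    by (rule Linear_Algebra.linear_componentwise[OF lin(2)])
  have "((\<lambda>y. h (G y b) \<bullet> c) has_derivative (\<lambda>v. h (G' v b) \<bullet> c)) (at z)"
    if "b \<in> Basis" "c \<in> Basis" for b c
    unfolding hs[of "G _ b"] hs[of "G' _ b"]
    by (intro has_derivative_sum has_derivative_mult_left d that)
  then have "((\<lambda>y. endo_det (\<lambda>x. h (G y x))) has_derivative (\<lambda>v. endo_trace (\<lambda>b. h (G' v b)))) (at z)"
    by (rule has_derivative_endo_det_at_id) (simp_all add: h)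
  then have "((\<lambda>y. endo_det (G z) * endo_det (\<lambda>x. h (G y x))) has_derivative
      (\<lambda>v. endo_det (G z) * endo_trace (\<lambda>b. h (G' v b)))) (at z)"
    by (rule has_derivative_mult_right)
  moreover have "endo_det (G z) * endo_det (\<lambda>x. h (G y x)) = endo_det (G y)" for y
    using endo_det_mult[OF lin(1), of "\<lambda>x. h (G y x)"] by (simp add: h)
  ultimately show ?thesis by simp
qed

lemma smooth_on_endo_det:
  assumes "open S" "\<And>b c. b \<in> Basis \<Longrightarrow> c \<in> Basis \<Longrightarrow> smooth_on S (\<lambda>z. G z b \<bullet> c)"
  shows "smooth_on S (\<lambda>z. endo_det (G z :: 'e::euclidean_space \<Rightarrow> 'e))"
  unfolding endo_det_def
proof (rule smooth_on_sum[OF assms(1)])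
  fix p :: "'e \<Rightarrow> 'e"
  assume "p \<in> {p. p permutes Basis}"
  then have "smooth_on S (\<lambda>z. G z b \<bullet> p b)" if "b \<in> Basis" for b
    using assms(2) that by (simp add: permutes_in_image)
  then have "smooth_on S (\<lambda>z. \<Prod>b\<in>Basis. G z b \<bullet> p b)"
    by (rule smooth_on_prod[OF assms(1)])
  then show "smooth_on S (\<lambda>z. of_int (sign p) * (\<Prod>b\<in>Basis. G z b \<bullet> p b))"
    by (rule smooth_on_mult[OF assms(1) smooth_on_const[OF assms(1)]])
qed

section \<open>Charts and Christoffel symbols\<close>

locale smooth_mfd =
  fixes A :: "('m::{t2_space, second_countable_topology}, 'e::euclidean_space) atlas"
  assumes smooth_manifold: "smooth_manifold A"
begin

definition crange :: "'m \<Rightarrow> 'e set" where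
  "crange a = cmap A a ` cdom A a"

lemma open_cdom: "open (cdom A a)" and centre_in_cdom: "a \<in> cdom A a"
  and open_crange: "open (crange a)"
  and chart_homeomorphism: "homeomorphism (cdom A a) (crange a) (cmap A a) (cinv A a)"
  using smooth_manifold by (simp_all add: smooth_manifold_def crange_def)

lemma smooth_transition: "smooth_on (cmap A a ` (cdom A a \<inter> cdom A b)) (cmap A b \<circ> cinv A a)"
  using smooth_manifold by (simp add: smooth_manifold_def)

lemma cinv_cmap: "y \<in> cdom A a \<Longrightarrow> cinv A a (cmap A a y) = y"
  using chart_homeomorphism[of a] by (simp add: homeomorphism_def)

lemma cmap_cinv: "z \<in> crange a \<Longrightarrow> cmap A a (cinv A a z) = z"
  using chart_homeomorphism[of a] by (simp add: homeomorphism_def)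

lemma cinv_in_cdom: "z \<in> crange a \<Longrightarrow> cinv A a z \<in> cdom A a"
  using chart_homeomorphism[of a] by (force simp: homeomorphism_def)

lemma cmap_in_crange: "y \<in> cdom A a \<Longrightarrow> cmap A a y \<in> crange a"
  by (simp add: crange_def)

lemma open_chart_image:
  assumes "open U" shows "open (cmap A a ` (U \<inter> cdom A a))"
proof -
  have "openin (top_of_set (cdom A a)) (U \<inter> cdom A a)"
    using openin_open_Int[OF assms, of "cdom A a"] by (simp add: Int_commute)
  then have "openin (top_of_set (crange a)) (cmap A a ` (U \<inter> cdom A a))"
    by (rule homeomorphism_imp_open_map[OF chart_homeomorphism])
  then show ?thesis using open_crange openin_open_trans by blast
qed

lemma chart_image_iff: "z \<in> cmap A a ` (U \<inter> cdom A a) \<longleftrightarrow> z \<in> crange a \<and> cinv A a z \<in> U"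
proof
  assume "z \<in> cmap A a ` (U \<inter> cdom A a)"
  then show "z \<in> crange a \<and> cinv A a z \<in> U" by (auto simp: cinv_cmap cmap_in_crange)
next
  assume z: "z \<in> crange a \<and> cinv A a z \<in> U"
  then have "cinv A a z \<in> U \<inter> cdom A a" "z = cmap A a (cinv A a z)"
    using cinv_in_cdom cmap_cinv by auto
  then show "z \<in> cmap A a ` (U \<inter> cdom A a)" by blast
qed

lemma continuous_cinv: "continuous_on (crange a) (cinv A a)"
  using chart_homeomorphism[of a] by (simp add: homeomorphism_def)

lemma ctrans_has_derivative:
  assumes "y \<in> cdom A a" "y \<in> cdom A b"
  shows "((\<lambda>z. cmap A b (cinv A a z)) has_derivative ctrans A a b y) (at (cmap A a y))"
  using smooth_on_has_derivative[OF smooth_transition[of a b], of "cmap A a y"] assms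
  by (simp add: ctrans_def comp_def)

lemma linear_ctrans: "y \<in> cdom A a \<Longrightarrow> y \<in> cdom A b \<Longrightarrow> linear (ctrans A a b y)"
  by (rule has_derivative_linear[OF ctrans_has_derivative])

text \<open>Near the point the composed transition maps equal the direct one, so this cocycle rule
  is the chain rule.\<close>

lemma ctrans_comp:
  assumes "y \<in> cdom A a" "y \<in> cdom A b" "y \<in> cdom A c"
  shows "ctrans A b c y (ctrans A a b y v) = ctrans A a c y v"
proof -
  have "((\<lambda>z. cmap A c (cinv A b z)) has_derivative ctrans A b c y)
          (at (cmap A b (cinv A a (cmap A a y))))"
    using ctrans_has_derivative[OF assms(2,3)] by (simp add: cinv_cmap assms)
  from has_derivative_compose[OF ctrans_has_derivative[OF assms(1,2)] this]
  have d: "((\<lambda>z. cmap A c (cinv A b (cmap A b (cinv A a z)))) has_derivative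
      (\<lambda>v. ctrans A b c y (ctrans A a b y v))) (at (cmap A a y))" .
  have "((\<lambda>z. cmap A c (cinv A a z)) has_derivative
      (\<lambda>v. ctrans A b c y (ctrans A a b y v))) (at (cmap A a y))"
  proof (rule has_derivative_transform_within_open[OF d])
    show "open (cmap A a ` (cdom A b \<inter> cdom A a))" by (rule open_chart_image[OF open_cdom])
    show "cmap A a y \<in> cmap A a ` (cdom A b \<inter> cdom A a)" using assms by auto
  qed (auto simp: chart_image_iff cinv_cmap)
  then show ?thesis
    using has_derivative_unique[OF _ ctrans_has_derivative[OF assms(1,3)]] by metis
qed

lemma ctrans_refl:
  assumes "y \<in> cdom A a"
  shows "ctrans A a a y v = v"
proof -
  have "((\<lambda>z. cmap A a (cinv A a z)) has_derivative (\<lambda>v. v)) (at (cmap A a y))"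
    by (rule has_derivative_transform_within_open[OF has_derivative_ident open_crange cmap_in_crange[OF assms]])
       (simp add: cmap_cinv)
  then show ?thesis using has_derivative_unique[OF _ ctrans_has_derivative[OF assms assms]] by metis
qed

lemma ctrans_inverse:
  "y \<in> cdom A a \<Longrightarrow> y \<in> cdom A b \<Longrightarrow> ctrans A b a y (ctrans A a b y v) = v"
  by (simp add: ctrans_comp ctrans_refl)

lemma ctrans_eq_0_iff:
  assumes "y \<in> cdom A a" "y \<in> cdom A b"
  shows "ctrans A a b y v = 0 \<longleftrightarrow> v = 0"
  using ctrans_inverse[OF assms, of v] linear_0[OF linear_ctrans[OF assms]]
    linear_0[OF linear_ctrans[OF assms(2,1)]] by metis

lemma smooth_on_transition:
  assumes "S \<subseteq> cmap A a ` (cdom A a \<inter> cdom A b)"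
  shows "smooth_on S (\<lambda>z. cmap A b (cinv A a z))"
  using smooth_on_subset[OF smooth_transition assms] by (simp add: comp_def)

lemma smooth_on_ctrans:
  assumes "open U" "U \<subseteq> cdom A x"
  shows "smooth_on (cmap A a ` (U \<inter> cdom A a)) (\<lambda>z. ctrans A x a (cinv A a z) b)"
proof -
  let ?S = "cmap A a ` (U \<inter> cdom A a)"
  let ?T = "cmap A x ` (cdom A a \<inter> cdom A x)"
  have S: "open ?S" by (rule open_chart_image[OF assms(1)])
  have sub: "?S \<subseteq> cmap A a ` (cdom A a \<inter> cdom A x)" using assms(2) by auto
  have T: "smooth_on ?T (\<lambda>p. fderiv (cmap A a \<circ> cinv A x) p b)"
    using smooth_on_derivative[OF smooth_transition[of x a]] by (simp add: Int_commute)
  have "smooth_on ?S (\<lambda>z. fderiv (cmap A a \<circ> cinv A x) (cmap A x (cinv A a z)) b)"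
    by (rule smooth_on_compose[OF S open_chart_image[OF open_cdom] _ T smooth_on_transition[OF sub]])
       (use assms(2) cinv_cmap in auto)
  then show ?thesis by (simp add: ctrans_def)
qed

text \<open>One chart containing \<open>U\<close> suffices, because all others differ from it by
  smooth transitions.\<close>

lemma smooth_fun_onI:
  assumes "open U" "U \<subseteq> cdom A x" "smooth_on (cmap A x ` U) (\<lambda>z. f (cinv A x z))"
  shows "smooth_fun_on A U f"
  unfolding smooth_fun_on_def
proof
  fix a
  let ?S = "cmap A a ` (U \<inter> cdom A a)"
  have S: "open ?S" by (rule open_chart_image[OF assms(1)])
  have U: "open (cmap A x ` U)" using open_chart_image[OF assms(1), of x] assms(2) by (simp add: Int_absorb2)
  have sub: "?S \<subseteq> cmap A a ` (cdom A a \<inter> cdom A x)" using assms(2) by auto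
  have "smooth_on ?S (\<lambda>z. f (cinv A x (cmap A x (cinv A a z))))"
    by (rule smooth_on_compose[OF S U _ assms(3) smooth_on_transition[OF sub]])
       (use cinv_cmap in auto)
  then show "smooth_on ?S (f \<circ> cinv A a)"
    by (rule smooth_on_cong[OF S, rotated]) (use assms(2) cinv_cmap in auto)
qed

lemma smooth_fun_on_chart:
  "smooth_fun_on A U f \<Longrightarrow> smooth_on (cmap A a ` (U \<inter> cdom A a)) (\<lambda>z. f (cinv A a z))"
  by (simp add: smooth_fun_on_def comp_def)

text \<open>\<open>fun_diff\<close> uses the preferred chart of the point \<open>y\<close> itself.
  This form refers to one fixed chart, in which \<open>y\<close> can vary.\<close>

lemma fun_diff_chart:
  assumes "open U" "y \<in> U" "y \<in> cdom A x" "smooth_fun_on A U f"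
  shows "fun_diff A f y (ctrans A x y y w) = fderiv (\<lambda>z. f (cinv A x z)) (cmap A x y) w"
proof -
  have yy: "y \<in> cdom A y" by (rule centre_in_cdom)
  have "((\<lambda>z. f (cinv A y z)) has_derivative fun_diff A f y) (at (cmap A y y))"
    using smooth_on_has_derivative[OF smooth_fun_on_chart[OF assms(4), of y], of "cmap A y y"] yy assms(2)
    by (simp add: fun_diff_def comp_def)
  then have "((\<lambda>z. f (cinv A y z)) has_derivative fun_diff A f y) (at (cmap A y (cinv A x (cmap A x y))))"
    by (simp add: cinv_cmap assms(3))
  from has_derivative_compose[OF ctrans_has_derivative[OF assms(3) yy] this]
  have d: "((\<lambda>z. f (cinv A y (cmap A y (cinv A x z)))) has_derivative (\<lambda>w. fun_diff A f y (ctrans A x y y w)))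
     (at (cmap A x y))" .
  have "((\<lambda>z. f (cinv A x z)) has_derivative (\<lambda>w. fun_diff A f y (ctrans A x y y w))) (at (cmap A x y))"
  proof (rule has_derivative_transform_within_open[OF d])
    show "open (cmap A x ` (cdom A y \<inter> cdom A x))" by (rule open_chart_image[OF open_cdom])
    show "cmap A x y \<in> cmap A x ` (cdom A y \<inter> cdom A x)" using assms yy by auto
  qed (auto simp: chart_image_iff cinv_cmap)
  then show ?thesis by (simp add: frechet_derivative_eqI)
qed

lemma field_comp_cmap: "y \<in> cdom A x \<Longrightarrow> field_comp A x X (cmap A x y) = ctrans A y x y (X y)"
  by (simp add: field_comp_def cinv_cmap Let_def)

lemma smooth_field_onI:
  assumes "open U" "U \<subseteq> cdom A x" "smooth_on (cmap A x ` U) (field_comp A x X)"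
  shows "smooth_field_on A U X"
  unfolding smooth_field_on_def
proof
  fix a
  let ?S = "cmap A a ` (U \<inter> cdom A a)"
  have S: "open ?S" by (rule open_chart_image[OF assms(1)])
  have U: "open (cmap A x ` U)" using open_chart_image[OF assms(1), of x] assms(2) by (simp add: Int_absorb2)
  have sub: "?S \<subseteq> cmap A a ` (cdom A a \<inter> cdom A x)" using assms(2) by auto
  have c: "smooth_on ?S (\<lambda>z. field_comp A x X (cmap A x (cinv A a z)))"
    by (rule smooth_on_compose[OF S U _ assms(3) smooth_on_transition[OF sub]])
       (use cinv_cmap in auto)
  \<comment> \<open>\<open>ctrans\<close> is known to be smooth on fixed vectors only, so the
    components of the field are expanded in the basis.\<close>
  have "smooth_on ?S (\<lambda>z. \<Sum>b\<in>Basis. (field_comp A x X (cmap A x (cinv A a z)) \<bullet> b) *\<^sub>R ctrans A x a (cinv A a z) b)"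
    by (intro smooth_on_sum[OF S] smooth_on_scaleR[OF S] smooth_on_inner[OF S c] smooth_on_ctrans[OF assms(1,2)])
  then show "smooth_on ?S (field_comp A a X)"
  proof (rule smooth_on_cong[OF S, rotated])
    fix z assume "z \<in> ?S"
    then obtain y where y: "y \<in> U" "y \<in> cdom A a" "z = cmap A a y" "y \<in> cdom A x" using assms(2) by auto
    define w where "w = field_comp A x X (cmap A x y)"
    have l: "linear (ctrans A x a y)" using linear_ctrans y by auto
    have "(\<Sum>b\<in>Basis. (w \<bullet> b) *\<^sub>R ctrans A x a y b) = ctrans A x a y w"
      by (rule linear_Basis_sum[OF l, symmetric])
    also have "\<dots> = ctrans A y a y (X y)"
      by (simp add: w_def field_comp_cmap y centre_in_cdom ctrans_comp)
    finally show "(\<Sum>b\<in>Basis. (field_comp A x X (cmap A x (cinv A a z)) \<bullet> b) *\<^sub>R ctrans A x a (cinv A a z) b)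
        = field_comp A a X z"
      by (simp add: y cinv_cmap field_comp_cmap w_def)
  qed
qed

lemma smooth_field_on_chart:
  "smooth_field_on A U X \<Longrightarrow> smooth_on (cmap A a ` (U \<inter> cdom A a)) (field_comp A a X)"
  by (simp add: smooth_field_on_def)

lemma smooth_field_on_subset: "smooth_field_on A U X \<Longrightarrow> V \<subseteq> U \<Longrightarrow> smooth_field_on A V X"
  unfolding smooth_field_on_def by (meson Int_mono image_mono order_refl smooth_on_subset)

lemma field_comp_coord: "y \<in> cdom A x \<Longrightarrow> field_comp A x (coord_field A x b) (cmap A x y) = b"
  by (simp add: field_comp_cmap coord_field_def ctrans_inverse centre_in_cdom)

lemma smooth_coord_field:
  assumes "open U" "U \<subseteq> cdom A x"
  shows "smooth_field_on A U (coord_field A x b)"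
proof (rule smooth_field_onI[OF assms])
  have U: "open (cmap A x ` U)" using open_chart_image[OF assms(1), of x] assms(2) by (simp add: Int_absorb2)
  show "smooth_on (cmap A x ` U) (field_comp A x (coord_field A x b))"
    by (rule smooth_on_cong[OF U _ smooth_on_const[OF U, of b]])
       (use assms(2) field_comp_coord in auto)
qed

lemma smooth_field_add:
  assumes "open U" "smooth_field_on A U X" "smooth_field_on A U Y"
  shows "smooth_field_on A U (\<lambda>y. X y + Y y)"
  unfolding smooth_field_on_def
proof
  fix a
  have S: "open (cmap A a ` (U \<inter> cdom A a))" by (rule open_chart_image[OF assms(1)])
  show "smooth_on (cmap A a ` (U \<inter> cdom A a)) (field_comp A a (\<lambda>y. X y + Y y))"
    by (rule smooth_on_cong[OF S _ smooth_on_add[OF S smooth_field_on_chart[OF assms(2)] smooth_field_on_chart[OF assms(3)]]])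
       (auto simp: field_comp_cmap linear_add[OF linear_ctrans] centre_in_cdom)
qed

lemma smooth_field_scale:
  assumes "open U" "smooth_fun_on A U f" "smooth_field_on A U Y"
  shows "smooth_field_on A U (\<lambda>y. f y *\<^sub>R Y y)"
  unfolding smooth_field_on_def
proof
  fix a
  have S: "open (cmap A a ` (U \<inter> cdom A a))" by (rule open_chart_image[OF assms(1)])
  show "smooth_on (cmap A a ` (U \<inter> cdom A a)) (field_comp A a (\<lambda>y. f y *\<^sub>R Y y))"
    by (rule smooth_on_cong[OF S _ smooth_on_scaleR[OF S smooth_fun_on_chart[OF assms(2)] smooth_field_on_chart[OF assms(3)]]])
       (auto simp: field_comp_cmap cinv_cmap linear_cmul[OF linear_ctrans] centre_in_cdom)
qed

lemma smooth_fun_const: "open U \<Longrightarrow> smooth_fun_on A U (\<lambda>_. c)"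
  unfolding smooth_fun_on_def comp_def by (intro allI smooth_on_const open_chart_image)

lemma fun_diff_const: "fun_diff A (\<lambda>_. c) x v = 0"
  by (simp add: fun_diff_def comp_def)

lemma smooth_field_zero: "open U \<Longrightarrow> smooth_field_on A U (\<lambda>_. 0)"
  unfolding smooth_field_on_def
proof
  fix a
  assume "open U"
  then have S: "open (cmap A a ` (U \<inter> cdom A a))" by (rule open_chart_image)
  show "smooth_on (cmap A a ` (U \<inter> cdom A a)) (field_comp A a (\<lambda>_. 0))"
    by (rule smooth_on_cong[OF S _ smooth_on_const[OF S, of 0]])
       (auto simp: field_comp_cmap linear_0[OF linear_ctrans] centre_in_cdom)
qed

lemma smooth_field_sum:
  assumes "open U" "finite I" "\<And>i. i \<in> I \<Longrightarrow> smooth_fun_on A U (f i)" "\<And>i. i \<in> I \<Longrightarrow> smooth_field_on A U (Y i)"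
  shows "smooth_field_on A U (\<lambda>y. \<Sum>i\<in>I. f i y *\<^sub>R Y i y)"
  using assms(2-4)
proof (induction I rule: finite_induct)
  case empty
  then show ?case using smooth_field_zero[OF assms(1)] by simp
next
  case (insert i I)
  then show ?case
    using smooth_field_add[OF assms(1) smooth_field_scale[OF assms(1), of "f i" "Y i"], of "\<lambda>y. \<Sum>i\<in>I. f i y *\<^sub>R Y i y"]
    by simp
qed

text \<open>In the chart at \<open>y\<close> the components of a coordinate field of the chart at
  \<open>x\<close> are a directional derivative of the transition map. The bracket is the difference
  of its two mixed second derivatives.\<close>

lemma lie_bracket_coord_fields:
  assumes y: "y \<in> cdom A x"
  shows "lie_bracket A (coord_field A x u) (coord_field A x v) y = 0"
proof -
  have yy: "y \<in> cdom A y" by (rule centre_in_cdom)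
  let ?\<tau> = "\<lambda>z. cmap A y (cinv A x z)"
  let ?S = "cmap A x ` (cdom A y \<inter> cdom A x)"
  have S: "open ?S" by (rule open_chart_image[OF open_cdom])
  have sm: "smooth_on ?S ?\<tau>" by (rule smooth_on_transition) auto
  have yS: "cmap A x y \<in> ?S" using y yy by auto
  have "fderiv (field_comp A y (coord_field A x v)) (cmap A y y) (coord_field A x u y) =
      fderiv (\<lambda>p. fderiv ?\<tau> p v) (cmap A x y) u" for u v
  proof -
    have "((\<lambda>p. fderiv ?\<tau> p v) has_derivative
        fderiv (\<lambda>p. fderiv ?\<tau> p v) (cmap A x y)) (at (cmap A x (cinv A y (cmap A y y))))"
      using smooth_on_has_derivative[OF smooth_on_derivative[OF sm] yS] by (simp add: cinv_cmap yy)
    from has_derivative_compose[OF ctrans_has_derivative[OF yy y] this]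
    have d: "((\<lambda>z. fderiv ?\<tau> (cmap A x (cinv A y z)) v) has_derivative
        (\<lambda>w. fderiv (\<lambda>p. fderiv ?\<tau> p v) (cmap A x y) (ctrans A y x y w)))
        (at (cmap A y y))" .
    have "(field_comp A y (coord_field A x v) has_derivative
        (\<lambda>w. fderiv (\<lambda>p. fderiv ?\<tau> p v) (cmap A x y) (ctrans A y x y w)))
        (at (cmap A y y))"
    proof (rule has_derivative_transform_within_open[OF d])
      show "open (cmap A y ` (cdom A x \<inter> cdom A y))" by (rule open_chart_image[OF open_cdom])
      show "cmap A y y \<in> cmap A y ` (cdom A x \<inter> cdom A y)" using y yy by auto
      fix z assume "z \<in> cmap A y ` (cdom A x \<inter> cdom A y)"
      then obtain q where q: "q \<in> cdom A x" "q \<in> cdom A y" "z = cmap A y q" by auto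
      show "fderiv ?\<tau> (cmap A x (cinv A y z)) v = field_comp A y (coord_field A x v) z"
        unfolding q(3) field_comp_cmap[OF q(2)] cinv_cmap[OF q(2)] coord_field_def
          ctrans_comp[OF q(1) centre_in_cdom q(2)]
        by (simp add: ctrans_def comp_def)
    qed
    then show ?thesis
      by (simp add: frechet_derivative_eqI coord_field_def ctrans_inverse[OF y yy])
  qed
  then show ?thesis
    unfolding lie_bracket_def using mixed_derivatives_commute[OF S sm yS, of v u] by simp
qed

end

section \<open>Connections in a chart\<close>

locale mfd_connection = smooth_mfd A
  for A :: "('m::{t2_space, second_countable_topology}, 'e::euclidean_space) atlas" +
  fixes D :: "'m \<Rightarrow> 'e \<Rightarrow> ('m \<Rightarrow> 'e) \<Rightarrow> 'e"
  assumes linear_connection: "linear_connection A D"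
begin

lemma D_linear: "open U \<Longrightarrow> x \<in> U \<Longrightarrow> smooth_field_on A U Y \<Longrightarrow> linear (\<lambda>v. D x v Y)"
  using linear_connection unfolding linear_connection_def by (elim conjE) metis

lemma D_cong:
  "open U \<Longrightarrow> x \<in> U \<Longrightarrow> smooth_field_on A U Y \<Longrightarrow> (\<And>y. y \<in> U \<Longrightarrow> Y y = Z y) \<Longrightarrow> D x v Y = D x v Z"
  using linear_connection unfolding linear_connection_def by (elim conjE) metis

lemma D_add:
  "open U \<Longrightarrow> x \<in> U \<Longrightarrow> smooth_field_on A U Y \<Longrightarrow> smooth_field_on A U Z
     \<Longrightarrow> D x v (\<lambda>y. Y y + Z y) = D x v Y + D x v Z"
  using linear_connection unfolding linear_connection_def by (elim conjE) metis

lemma D_scale: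
  "open U \<Longrightarrow> x \<in> U \<Longrightarrow> smooth_fun_on A U f \<Longrightarrow> smooth_field_on A U Y
     \<Longrightarrow> D x v (\<lambda>y. f y *\<^sub>R Y y) = fun_diff A f x v *\<^sub>R Y x + f x *\<^sub>R D x v Y"
  using linear_connection unfolding linear_connection_def by (elim conjE) metis

lemma D_smooth:
  "open U \<Longrightarrow> smooth_field_on A U X \<Longrightarrow> smooth_field_on A U Y \<Longrightarrow> smooth_field_on A U (\<lambda>x. D x (X x) Y)"
  using linear_connection unfolding linear_connection_def by (elim conjE) metis

lemma D_zero: "D x v (\<lambda>_. 0) = 0"
  using D_add[of UNIV x "\<lambda>_. 0" "\<lambda>_. 0" v] smooth_field_zero[of UNIV] by simp

lemma D_sum:
  assumes "open U" "x \<in> U" "finite I"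
    "\<And>i. i \<in> I \<Longrightarrow> smooth_fun_on A U (f i)" "\<And>i. i \<in> I \<Longrightarrow> smooth_field_on A U (Y i)"
  shows "D x v (\<lambda>y. \<Sum>i\<in>I. f i y *\<^sub>R Y i y) = (\<Sum>i\<in>I. fun_diff A (f i) x v *\<^sub>R Y i x + f i x *\<^sub>R D x v (Y i))"
  using assms(3-5)
proof (induction I rule: finite_induct)
  case empty
  then show ?case by (simp add: D_zero)
next
  case (insert i I)
  have "D x v (\<lambda>y. f i y *\<^sub>R Y i y + (\<Sum>i\<in>I. f i y *\<^sub>R Y i y)) =
      D x v (\<lambda>y. f i y *\<^sub>R Y i y) + D x v (\<lambda>y. \<Sum>i\<in>I. f i y *\<^sub>R Y i y)"
    using insert by (intro D_add[OF assms(1,2)] smooth_field_scale smooth_field_sum assms(1)) auto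
  also have "D x v (\<lambda>y. f i y *\<^sub>R Y i y) = fun_diff A (f i) x v *\<^sub>R Y i x + f i x *\<^sub>R D x v (Y i)"
    using insert by (intro D_scale[OF assms(1,2)]) auto
  finally show ?case using insert by simp
qed

text \<open>The Christoffel symbols of the chart at \<open>x\<close> as a bilinear map in
  \<open>v\<close> and \<open>w\<close>. They depend on the coordinate \<open>z\<close> instead of
  the point, so that they can be differentiated.\<close>

definition chr :: "'m \<Rightarrow> 'e \<Rightarrow> 'e \<Rightarrow> 'e \<Rightarrow> 'e" where
  "chr x z v w = field_comp A x (\<lambda>y. D y (coord_field A x v y) (coord_field A x w)) z"

lemma chr_cmap:
  "y \<in> cdom A x \<Longrightarrow> chr x (cmap A x y) v w = ctrans A y x y (D y (coord_field A x v y) (coord_field A x w))"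
  by (simp add: chr_def field_comp_cmap)

lemma D_coord:
  "y \<in> cdom A x \<Longrightarrow> D y (coord_field A x v y) (coord_field A x w) = coord_field A x (chr x (cmap A x y) v w) y"
  by (simp add: chr_cmap coord_field_def ctrans_inverse centre_in_cdom)

lemma coord_field_add: "y \<in> cdom A x \<Longrightarrow> coord_field A x (v + w) y = coord_field A x v y + coord_field A x w y"
  by (simp add: coord_field_def linear_add[OF linear_ctrans] centre_in_cdom)

lemma coord_field_scale: "y \<in> cdom A x \<Longrightarrow> coord_field A x (r *\<^sub>R v) y = r *\<^sub>R coord_field A x v y"
  by (simp add: coord_field_def linear_cmul[OF linear_ctrans] centre_in_cdom)

lemma smooth_coord: "smooth_field_on A (cdom A x) (coord_field A x b)"
  by (rule smooth_coord_field[OF open_cdom order_refl])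

lemma bilinear_chr:
  assumes "z \<in> crange x"
  shows "bilinear (chr x z)"
proof -
  obtain y where y: "y \<in> cdom A x" "z = cmap A x y" using assms by (auto simp: crange_def)
  have l: "linear (ctrans A y x y)" by (rule linear_ctrans[OF centre_in_cdom y(1)])
  have Dl: "linear (\<lambda>v. D y v (coord_field A x w))" for w
    by (rule D_linear[OF open_cdom y(1) smooth_coord])
  have Da: "D y v (coord_field A x (w + w')) = D y v (coord_field A x w) + D y v (coord_field A x w')" for v w w'
  proof -
    have "D y v (coord_field A x (w + w')) = D y v (\<lambda>y. coord_field A x w y + coord_field A x w' y)"
      by (rule D_cong[OF open_cdom y(1) smooth_coord]) (rule coord_field_add)
    then show ?thesis by (simp add: D_add[OF open_cdom y(1) smooth_coord smooth_coord])
  qed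
  have Ds: "D y v (coord_field A x (r *\<^sub>R w)) = r *\<^sub>R D y v (coord_field A x w)" for v w r
  proof -
    have "D y v (coord_field A x (r *\<^sub>R w)) = D y v (\<lambda>y. r *\<^sub>R coord_field A x w y)"
      by (rule D_cong[OF open_cdom y(1) smooth_coord]) (rule coord_field_scale)
    then show ?thesis
      by (simp add: D_scale[OF open_cdom y(1) smooth_fun_const[OF open_cdom] smooth_coord] fun_diff_const)
  qed
  show ?thesis unfolding bilinear_def y(2) chr_cmap[OF y(1)]
    by (intro conjI allI linearI)
       (simp_all add: Da Ds coord_field_add[OF y(1)] coord_field_scale[OF y(1)] linear_add[OF l] linear_cmul[OF l]
         linear_add[OF Dl] linear_cmul[OF Dl])
qed

lemma smooth_chr: "smooth_on (crange x) (\<lambda>z. chr x z v w)"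
  using smooth_field_on_chart[OF D_smooth[OF open_cdom smooth_coord[of x v] smooth_coord[of x w]], of x]
  by (simp add: crange_def chr_def[abs_def])

text \<open>Near \<open>y\<close> the field is a combination of coordinate fields with smooth
  coefficients; additivity and the Leibniz rule then give the derivative of the components plus the
  Christoffel term.\<close>

lemma covariant_derivative_chart:
  assumes "open U" "U \<subseteq> cdom A x" "y \<in> U" "smooth_field_on A U Y"
  shows "ctrans A y x y (D y (coord_field A x v y) Y) =
     fderiv (field_comp A x Y) (cmap A x y) v + chr x (cmap A x y) v (field_comp A x Y (cmap A x y))"
proof -
  let ?y = "field_comp A x Y"
  have ydom: "y \<in> cdom A x" using assms by auto
  have S: "open (cmap A x ` U)" using open_chart_image[OF assms(1), of x] assms(2) by (simp add: Int_absorb2)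
  have sy: "smooth_on (cmap A x ` U) ?y"
    using smooth_field_on_chart[OF assms(4), of x] assms(2) by (simp add: Int_absorb2)
  define f where "f b p = ?y (cmap A x p) \<bullet> b" for b p
  have eq: "f b (cinv A x z) = ?y z \<bullet> b" if "z \<in> cmap A x ` U" for b z
    using that assms(2) by (auto simp: f_def cinv_cmap)
  have sf: "smooth_fun_on A U (f b)" for b
    by (rule smooth_fun_onI[OF assms(1,2)], rule smooth_on_cong[OF S _ smooth_on_inner[OF S sy]])
       (simp add: eq)
  have Y: "Y p = (\<Sum>b\<in>Basis. f b p *\<^sub>R coord_field A x b p)" if "p \<in> U" for p
  proof -
    have p: "p \<in> cdom A x" using that assms(2) by auto
    have l: "linear (ctrans A x p p)" by (rule linear_ctrans[OF p centre_in_cdom])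
    have "(\<Sum>b\<in>Basis. f b p *\<^sub>R coord_field A x b p) = ctrans A x p p (\<Sum>b\<in>Basis. f b p *\<^sub>R b)"
      by (simp add: coord_field_def linear_sum[OF l] linear_cmul[OF l])
    also have "(\<Sum>b\<in>Basis. f b p *\<^sub>R b) = ?y (cmap A x p)"
      by (simp add: f_def euclidean_representation)
    finally show ?thesis by (simp add: field_comp_cmap[OF p] ctrans_inverse[OF centre_in_cdom p])
  qed
  have l: "linear (ctrans A y x y)" by (rule linear_ctrans[OF centre_in_cdom ydom])
  have lc: "linear (chr x (cmap A x y) v)"
    using bilinear_chr[OF cmap_in_crange[OF ydom]] by (simp add: bilinear_def)
  have fd: "fun_diff A (f b) y (coord_field A x v y) = fderiv ?y (cmap A x y) v \<bullet> b" for b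
  proof -
    have "fun_diff A (f b) y (coord_field A x v y) = fderiv (\<lambda>z. f b (cinv A x z)) (cmap A x y) v"
      unfolding coord_field_def by (rule fun_diff_chart[OF assms(1,3) ydom sf])
    also have "\<dots> = fderiv (\<lambda>z. ?y z \<bullet> b) (cmap A x y) v"
      using frechet_derivative_cong_open[OF S, of "cmap A x y" "\<lambda>z. f b (cinv A x z)" "\<lambda>z. ?y z \<bullet> b"] assms(3) eq
      by auto
    also have "\<dots> = fderiv ?y (cmap A x y) v \<bullet> b"
      by (rule frechet_derivative_inner[OF S sy]) (use assms(3) in auto)
    finally show ?thesis .
  qed
  have "D y (coord_field A x v y) Y = D y (coord_field A x v y) (\<lambda>p. \<Sum>b\<in>Basis. f b p *\<^sub>R coord_field A x b p)"
    by (rule D_cong[OF assms(1,3,4)]) (rule Y)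
  also have "\<dots> = (\<Sum>b\<in>Basis. (fderiv ?y (cmap A x y) v \<bullet> b) *\<^sub>R coord_field A x b y
      + f b y *\<^sub>R D y (coord_field A x v y) (coord_field A x b))"
    by (subst D_sum[OF assms(1,3) finite_Basis sf smooth_coord_field[OF assms(1,2)]]) (simp add: fd)
  finally have "ctrans A y x y (D y (coord_field A x v y) Y) =
     (\<Sum>b\<in>Basis. (fderiv ?y (cmap A x y) v \<bullet> b) *\<^sub>R b + f b y *\<^sub>R chr x (cmap A x y) v b)"
    by (simp add: linear_sum[OF l] linear_add[OF l] linear_cmul[OF l] chr_cmap[OF ydom]
        coord_field_def ctrans_inverse[OF ydom centre_in_cdom])
  also have "\<dots> = fderiv ?y (cmap A x y) v + chr x (cmap A x y) v (\<Sum>b\<in>Basis. f b y *\<^sub>R b)"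
    by (simp add: sum.distrib euclidean_representation linear_sum[OF lc] linear_cmul[OF lc])
  also have "(\<Sum>b\<in>Basis. f b y *\<^sub>R b) = ?y (cmap A x y)"
    by (simp add: f_def euclidean_representation)
  finally show ?thesis .
qed

lemma chr_sym:
  assumes "torsion_free A D" "z \<in> crange x"
  shows "chr x z v w = chr x z w v"
proof -
  obtain y where y: "y \<in> cdom A x" "z = cmap A x y" using assms(2) by (auto simp: crange_def)
  have "D y (coord_field A x v y) (coord_field A x w) - D y (coord_field A x w y) (coord_field A x v) = 0"
    using assms(1) y(1) open_cdom smooth_coord unfolding torsion_free_def
    by (metis lie_bracket_coord_fields[OF y(1)])
  then show ?thesis by (simp add: y(2) chr_cmap[OF y(1)])
qed

end

section \<open>Parallel sections of the weight bundle\<close>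

locale riemannian_mfd = smooth_mfd A
  for A :: "('m::{t2_space, second_countable_topology}, 'e::euclidean_space) atlas" +
  fixes g :: "'m \<Rightarrow> 'e \<Rightarrow> 'e \<Rightarrow> real"
  assumes riemannian: "riemannian_metric A g"
begin

definition gc :: "'m \<Rightarrow> 'e \<Rightarrow> 'e \<Rightarrow> 'e \<Rightarrow> real" where
  "gc x z w w' = g (cinv A x z) (coord_field A x w (cinv A x z)) (coord_field A x w' (cinv A x z))"

lemma inner_form_g: "inner_form (g y)"
  using riemannian by (simp add: riemannian_metric_def inner_form_def)

lemma inner_form_gc:
  assumes "z \<in> crange x"
  shows "inner_form (gc x z)"
proof -
  obtain y where y: "y \<in> cdom A x" "z = cmap A x y" using assms by (auto simp: crange_def)
  have l: "linear (ctrans A x y y)" by (rule linear_ctrans[OF y(1) centre_in_cdom])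
  show ?thesis
    unfolding inner_form_def bilinear_def gc_def y(2) cinv_cmap[OF y(1)] coord_field_def
    using inner_form_sym[OF inner_form_g[of y]]
    by (intro conjI allI impI linearI)
       (simp_all add: inner_form_simps[OF inner_form_g[of y]] linear_add[OF l] linear_cmul[OF l]
         inner_form_pos[OF inner_form_g[of y]] ctrans_eq_0_iff[OF y(1) centre_in_cdom])
qed

lemma smooth_gc: "smooth_on (crange x) (\<lambda>z. gc x z w w')"
  using riemannian by (simp add: riemannian_metric_def gc_def crange_def Let_def)

end

locale weyl_metric = mfd_connection A D + riemannian_mfd A g
  for A :: "('m::{t2_space, second_countable_topology}, 'e::euclidean_space) atlas" and D g +
  fixes \<theta> :: "'m \<Rightarrow> 'e \<Rightarrow> real"
  assumes compat: "\<And>U x v Y Z. open U \<Longrightarrow> x \<in> U \<Longrightarrow> smooth_field_on A U Y \<Longrightarrow> smooth_field_on A U Z \<Longrightarrow>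
        fun_diff A (\<lambda>y. g y (Y y) (Z y)) x v - g x (D x v Y) (Z x) - g x (Y x) (D x v Z)
          = \<theta> x v * g x (Y x) (Z x)"
begin

lemma compat_chart:
  assumes "z \<in> crange x"
  shows "fderiv (\<lambda>z. gc x z w w') z v =
    \<theta> (cinv A x z) (coord_field A x v (cinv A x z)) * gc x z w w' + gc x z (chr x z v w) w' + gc x z w (chr x z v w')"
proof -
  obtain y where y: "y \<in> cdom A x" "z = cmap A x y" using assms by (auto simp: crange_def)
  define f where "f y = g y (coord_field A x w y) (coord_field A x w' y)" for y
  have f: "(\<lambda>z. f (cinv A x z)) = (\<lambda>z. gc x z w w')" by (simp add: f_def gc_def)
  have "smooth_fun_on A (cdom A x) f"
    by (rule smooth_fun_onI[OF open_cdom order_refl]) (use smooth_gc[of x w w'] in \<open>simp add: f crange_def\<close>)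
  from fun_diff_chart[OF open_cdom y(1) y(1) this, of v]
  have "fderiv (\<lambda>z. gc x z w w') z v = fun_diff A f y (coord_field A x v y)"
    by (simp add: f y(2) coord_field_def)
  then show ?thesis
    using compat[OF open_cdom y(1) smooth_coord[of x w] smooth_coord[of x w'], where v = "coord_field A x v y"]
    unfolding f_def[abs_def] D_coord[OF y(1)] by (simp add: gc_def y(2) cinv_cmap[OF y(1)])
qed

text \<open>The Gram operator acquires \<open>adjoint ?J\<close> on the left and \<open>?J\<close>
  on the right, which have the same determinant.\<close>

lemma endo_det_gram_chart:
  assumes "y \<in> cdom A a"
  shows "endo_det (gram_map (gc a (cmap A a y))) = (endo_det (ctrans A a y y))\<^sup>2 * endo_det (gram_map (g y))"
proof -
  let ?J = "ctrans A a y y" and ?G = "gram_map (g y)"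
  have l: "linear ?J" by (rule linear_ctrans[OF assms centre_in_cdom])
  have G: "linear ?G" by (rule linear_gram_map[OF inner_form_g])
  have "endo_det (gram_map (gc a (cmap A a y))) = endo_det (\<lambda>b. adjoint ?J (?G (?J b)))"
  proof (rule endo_det_cong, rule euclidean_eqI)
    fix b c :: 'e
    have "gram_map (gc a (cmap A a y)) b \<bullet> c = ?G (?J b) \<bullet> ?J c"
      by (simp add: gram_map_inner[OF inner_form_gc[OF cmap_in_crange[OF assms]]] gram_map_inner[OF inner_form_g]
          gc_def cinv_cmap[OF assms] coord_field_def)
    then show "gram_map (gc a (cmap A a y)) b \<bullet> c = adjoint ?J (?G (?J b)) \<bullet> c"
      using adjoint_works[OF l, of c "?G (?J b)"] by (simp add: inner_commute)
  qed
  also have "\<dots> = endo_det (adjoint ?J) * (endo_det ?G * endo_det ?J)"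
    using endo_det_mult[OF adjoint_linear[OF l], of "\<lambda>b. ?G (?J b)"] endo_det_mult[OF G, of ?J] by simp
  also have "endo_det (adjoint ?J) = endo_det ?J"
    by (rule endo_det_adjoint) (use adjoint_works[OF l] inner_commute in metis)
  finally show ?thesis by (simp add: power2_eq_square)
qed

text \<open>A metric \<open>h\<close> determines the section \<open>|det h|^(-1/(2n))\<close> of the
  weight bundle. This is the section of \<open>e^(-\<psi>) g\<close>, the metric that is
  \<open>D\<close>-parallel when \<open>d\<psi> = \<theta>\<close>. Squaring the determinant and
  halving the exponent avoids its sign.\<close>

definition metric_weight :: "('m \<Rightarrow> real) \<Rightarrow> 'm \<Rightarrow> real" where
  "metric_weight \<psi> y = ((endo_det (gram_map (g y)))\<^sup>2) powr (- 1 / (4 * DIM('e))) * exp (\<psi> y / 2)"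

lemma weight_comp_metric_weight:
  assumes "y \<in> cdom A a"
  shows "weight_comp A a (metric_weight \<psi>) (cmap A a y) =
    ((endo_det (gram_map (gc a (cmap A a y))))\<^sup>2) powr (- 1 / (4 * DIM('e))) * exp (\<psi> y / 2)"
proof -
  let ?J = "endo_det (ctrans A y a y)" and ?J' = "endo_det (ctrans A a y y)"
  let ?r = "- 1 / (4 * real DIM('e))"
  have l: "linear (ctrans A y a y)" by (rule linear_ctrans[OF centre_in_cdom assms])
  have JJ: "?J * ?J' = 1"
    using endo_det_mult[OF l, of "ctrans A a y y"] by (simp add: ctrans_inverse[OF assms centre_in_cdom] endo_det_id)
  then have J0: "\<bar>?J\<bar> > 0" by auto
  \<comment> \<open>The squared Gram determinants differ by the fourth power of \<open>?J'\<close>,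
    which the exponent \<open>?r\<close> turns into the transition factor of the weight
    bundle.\<close>
  have "?J' = 1 / ?J" using JJ by (metis nonzero_eq_divide_eq mult.commute mult_zero_left zero_neq_one)
  then have "?J' ^ 4 = \<bar>?J\<bar> powr (- 4)"
    using J0 by (simp add: powr_minus power_inverse powr_numeral divide_inverse)
  then have "(?J' ^ 4) powr ?r = \<bar>?J\<bar> powr (1 / DIM('e))"
    by (simp add: powr_powr)
  moreover have "((endo_det (gram_map (gc a (cmap A a y))))\<^sup>2) powr ?r
      = (?J' ^ 4) powr ?r * ((endo_det (gram_map (g y)))\<^sup>2) powr ?r"
    unfolding endo_det_gram_chart[OF assms]
    by (simp add: power_mult_distrib power_mult[symmetric] powr_mult)
  ultimately show ?thesis
    by (simp add: weight_comp_def cinv_cmap[OF assms] metric_weight_def)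
qed

lemma endo_det_gc_nonzero:
  assumes "z \<in> crange a"
  shows "endo_det (gram_map (gc a z)) \<noteq> 0"
proof -
  obtain h where "\<And>u. gram_map (gc a z) (h u) = u"
    by (rule gram_map_inverse[OF inner_form_gc[OF assms]]) blast
  then show ?thesis using endo_det_nonzero(1)[OF linear_gram_map[OF inner_form_gc[OF assms]], of h] by simp
qed

lemma smooth_weight_section_metric_weight:
  assumes "open U" "smooth_fun_on A U \<psi>"
  shows "smooth_weight_section_on A U (metric_weight \<psi>)"
  unfolding smooth_weight_section_on_def
proof
  fix a
  let ?S = "cmap A a ` (U \<inter> cdom A a)"
  have S: "open ?S" by (rule open_chart_image[OF assms(1)])
  have sub: "?S \<subseteq> crange a" by (auto simp: crange_def)
  have "smooth_on ?S (\<lambda>z. endo_det (gram_map (gc a z)))"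
  proof (rule smooth_on_endo_det[OF S, where G = "\<lambda>z. gram_map (gc a z)"])
    fix b c :: 'e
    show "smooth_on ?S (\<lambda>z. gram_map (gc a z) b \<bullet> c)"
      by (rule smooth_on_cong[OF S _ smooth_on_subset[OF smooth_gc[of a b c] sub]])
         (rule gram_map_inner[OF inner_form_gc[OF subsetD[OF sub]], symmetric])
  qed
  then have "smooth_on ?S (\<lambda>z. (endo_det (gram_map (gc a z)))\<^sup>2)"
    using smooth_on_mult[OF S] by (simp add: power2_eq_square)
  then have 1: "smooth_on ?S (\<lambda>z. ((endo_det (gram_map (gc a z)))\<^sup>2) powr (- 1 / (4 * DIM('e))))"
    by (rule smooth_on_powr[OF S]) (use endo_det_gc_nonzero sub in auto)
  have "smooth_on ?S (\<lambda>z. (1/2) * \<psi> (cinv A a z))"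
    by (rule smooth_on_mult[OF S smooth_on_const[OF S] smooth_fun_on_chart[OF assms(2)]])
  then have "smooth_on ?S (\<lambda>z. exp ((1/2) * \<psi> (cinv A a z)))"
    by (rule smooth_on_compose[OF S open_UNIV _ smooth_on_exp, rotated]) simp
  from smooth_on_mult[OF S 1 this]
  show "smooth_on ?S (weight_comp A a (metric_weight \<psi>))"
    by (rule smooth_on_cong[OF S, rotated]) (auto simp: weight_comp_metric_weight cinv_cmap)
qed

lemma endo_trace_id: "endo_trace (\<lambda>b. r *\<^sub>R b :: 'e) = r * DIM('e)"
  by (simp add: endo_trace_def)

text \<open>By Jacobi's formula the logarithmic derivative of the Gram determinant is
  \<open>n \<theta> + 2 tr \<Gamma>\<close>, which the exponents turn into
  \<open>- \<theta> / 2 - tr \<Gamma> / n\<close>. The exponential contributes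
  \<open>\<theta> / 2\<close> and the connection of the weight bundle
  \<open>tr \<Gamma> / n\<close>.\<close>

lemma weight_deriv_metric_weight:
  assumes U: "open U" "y \<in> U" and \<psi>: "smooth_fun_on A U \<psi>" and d\<psi>: "fun_diff A \<psi> y v = \<theta> y v"
  shows "weight_deriv A D y v (metric_weight \<psi>) = 0"
proof -
  have yy: "y \<in> cdom A y" by (rule centre_in_cdom)
  define z where "z = cmap A y y"
  define r :: real where "r = - 1 / (4 * DIM('e))"
  have z: "z \<in> crange y" by (simp add: z_def cmap_in_crange yy)
  have cz: "cinv A y z = y" by (simp add: z_def cinv_cmap yy)
  have coord_y: "coord_field A y w y = w" for w by (simp add: coord_field_def ctrans_refl yy)
  let ?S = "cmap A y ` (U \<inter> cdom A y)"
  have S: "open ?S" "z \<in> ?S" using open_chart_image[OF U(1)] U(2) yy by (auto simp: z_def)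
  define G where "G p = gram_map (gc y p)" for p
  have lG: "linear (G z)" unfolding G_def by (rule linear_gram_map[OF inner_form_gc[OF z]])
  obtain h where h: "linear h" "\<And>u. h (G z u) = u" "\<And>u. G z (h u) = u"
    unfolding G_def by (rule gram_map_inverse[OF inner_form_gc[OF z]]) blast
  define \<Gamma> where "\<Gamma> v w = chr y z v w" for v w
  have l\<Gamma>: "linear (\<Gamma> v)" for v
    using bilinear_chr[OF z] by (simp add: \<Gamma>_def[abs_def] bilinear_def)
  \<comment> \<open>The derivative of the Gram operator as metric compatibility gives it; the
    adjoint stems from the Christoffel term in the second argument of the metric.\<close>
  define G' where "G' v b = \<theta> y v *\<^sub>R G z b + G z (\<Gamma> v b) + adjoint (\<Gamma> v) (G z b)" for v b
  have Gi: "G p b \<bullet> c = gc y p b c" if "p \<in> crange y" for p b c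
    unfolding G_def by (rule gram_map_inner[OF inner_form_gc[OF that]])
  have dG: "((\<lambda>p. G p b \<bullet> c) has_derivative (\<lambda>v. G' v b \<bullet> c)) (at z)" for b c
  proof -
    have "((\<lambda>p. gc y p b c) has_derivative fderiv (\<lambda>p. gc y p b c) z) (at z)"
      by (rule smooth_on_has_derivative[OF smooth_gc z])
    moreover have "fderiv (\<lambda>p. gc y p b c) z = (\<lambda>v. G' v b \<bullet> c)"
    proof
      fix v
      have "adjoint (\<Gamma> v) (G z b) \<bullet> c = gc y z b (\<Gamma> v c)"
        using adjoint_works[OF l\<Gamma>, of c v "G z b"] Gi[OF z, of b "\<Gamma> v c"] by (simp add: inner_commute)
      then show "fderiv (\<lambda>p. gc y p b c) z v = G' v b \<bullet> c"
        by (simp add: compat_chart[OF z] G'_def inner_add_left Gi[OF z] cz coord_y \<Gamma>_def)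
    qed
    ultimately have "((\<lambda>p. gc y p b c) has_derivative (\<lambda>v. G' v b \<bullet> c)) (at z)" by simp
    then show ?thesis
      by (rule has_derivative_transform_within_open[OF _ open_crange z]) (simp add: Gi)
  qed
  define T where "T v = endo_trace (\<lambda>b. h (G' v b))" for v
  have dd: "((\<lambda>p. endo_det (G p)) has_derivative (\<lambda>v. endo_det (G z) * T v)) (at z)"
    unfolding T_def by (rule has_derivative_endo_det[OF dG lG h(1) h(3) h(2)])
  define \<tau> where "\<tau> v = endo_trace (\<Gamma> v)" for v
  have T: "T v = \<theta> y v * DIM('e) + 2 * \<tau> v" for v
  proof -
    have la: "linear (\<lambda>b. adjoint (\<Gamma> v) (G z b))"
      using linear_compose[OF lG adjoint_linear[OF l\<Gamma>[of v]]] by (simp add: comp_def)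
    have "T v = endo_trace (\<lambda>b. \<theta> y v *\<^sub>R b :: 'e) + \<tau> v + endo_trace (\<lambda>b. h (adjoint (\<Gamma> v) (G z b)))"
      by (simp add: T_def \<tau>_def G'_def linear_add[OF h(1)] linear_cmul[OF h(1)] h(2) endo_trace_def
          inner_add_left sum.distrib)
    \<comment> \<open>The Gram operator and its inverse cancel under the trace, and the adjoint has
      the same trace, so both Christoffel terms contribute equally.\<close>
    also have "endo_trace (\<lambda>b. h (adjoint (\<Gamma> v) (G z b))) = endo_trace (\<lambda>b. adjoint (\<Gamma> v) (G z (h b)))"
      by (rule endo_trace_commute[OF h(1) la])
    also have "\<dots> = \<tau> v"
      unfolding endo_trace_def \<tau>_def h(3)
      by (rule sum.cong[OF refl]) (use adjoint_works[OF l\<Gamma>] inner_commute in metis)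
    finally show ?thesis by (simp add: endo_trace_id)
  qed
  define \<delta> where "\<delta> = endo_det (G z)"
  have \<delta>: "\<delta> \<noteq> 0" unfolding \<delta>_def G_def by (rule endo_det_gc_nonzero[OF z])
  have \<delta>2: "0 < \<delta> * \<delta>" using \<delta> not_real_square_gt_zero by blast
  define P where "P = (\<delta>\<^sup>2) powr r"
  define e where "e = exp (\<psi> y / 2)"
  have "((\<lambda>t. (t\<^sup>2) powr r) has_real_derivative (2 * r * P / \<delta>)) (at \<delta>)"
  proof -
    have "((\<lambda>t. (t\<^sup>2) powr r) has_real_derivative (r * (\<delta>\<^sup>2) powr (r - 1) * (2 * \<delta>))) (at \<delta>)"
      using \<delta> \<delta>2
      by (auto intro!: derivative_eq_intros simp: powr_diff power2_eq_square field_simps)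
    moreover have "r * (\<delta>\<^sup>2) powr (r - 1) * (2 * \<delta>) = 2 * r * P / \<delta>"
      using \<delta> by (simp add: P_def powr_diff power2_eq_square field_simps)
    ultimately show ?thesis by simp
  qed
  from DERIV_compose_FDERIV[OF this[unfolded \<delta>_def] dd]
  have d1: "((\<lambda>p. ((endo_det (G p))\<^sup>2) powr r) has_derivative (\<lambda>v. 2 * r * P * T v)) (at z)"
    using \<delta> by (simp add: \<delta>_def[symmetric] mult_ac)
  have "((\<lambda>p. \<psi> (cinv A y p)) has_derivative fun_diff A \<psi> y) (at z)"
    using smooth_on_has_derivative[OF smooth_fun_on_chart[OF \<psi>] S(2)] by (simp add: fun_diff_def comp_def z_def)
  then have d2: "((\<lambda>p. exp (\<psi> (cinv A y p) / 2)) has_derivative (\<lambda>v. e * (fun_diff A \<psi> y v / 2))) (at z)"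
    by (auto intro!: derivative_eq_intros simp: cz e_def)
  have "(weight_comp A y (metric_weight \<psi>) has_derivative
      (\<lambda>v. P * (e * (fun_diff A \<psi> y v / 2)) + 2 * r * P * T v * e)) (at z)"
  proof (rule has_derivative_transform_within_open[OF _ open_crange z])
    show "((\<lambda>p. ((endo_det (G p))\<^sup>2) powr r * exp (\<psi> (cinv A y p) / 2)) has_derivative
      (\<lambda>v. P * (e * (fun_diff A \<psi> y v / 2)) + 2 * r * P * T v * e)) (at z)"
      using has_derivative_mult[OF d1 d2] by (simp add: P_def \<delta>_def e_def cz)
    fix p assume "p \<in> crange y"
    then show "((endo_det (G p))\<^sup>2) powr r * exp (\<psi> (cinv A y p) / 2) = weight_comp A y (metric_weight \<psi>) p"
      using weight_comp_metric_weight[of "cinv A y p" y \<psi>] by (simp add: cinv_in_cdom cmap_cinv G_def r_def)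
  qed
  then have w: "fderiv (weight_comp A y (metric_weight \<psi>)) (cmap A y y) v
      = P * (e * (\<theta> y v / 2)) + 2 * r * P * T v * e"
    by (simp add: frechet_derivative_eqI z_def d\<psi>)
  have "endo_det (ctrans A y y y) = endo_det (\<lambda>x. x :: 'e)"
    by (rule endo_det_cong) (rule ctrans_refl[OF yy])
  then have l: "metric_weight \<psi> y = P * e"
    using endo_det_gram_chart[OF yy]
    by (simp add: metric_weight_def P_def e_def \<delta>_def G_def z_def r_def endo_det_id)
  have tr: "endo_trace (\<lambda>b. D y v (coord_field A y b)) = \<tau> v"
    unfolding \<tau>_def \<Gamma>_def z_def
    by (simp add: endo_trace_def chr_cmap[OF yy] coord_y ctrans_refl[OF yy])
  define n where "n = real DIM('e)"
  have n: "n > 0" and r: "r = - 1 / (4 * n)" by (simp_all add: n_def r_def)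
  have "weight_deriv A D y v (metric_weight \<psi>) =
      P * (e * (\<theta> y v / 2)) + 2 * r * P * (\<theta> y v * n + 2 * \<tau> v) * e + (1 / n) * \<tau> v * (P * e)"
    by (simp only: weight_deriv_def w l T tr n_def)
  also have "\<dots> = P * e * (\<theta> y v / 2 + 2 * r * (\<theta> y v * n + 2 * \<tau> v) + \<tau> v / n)"
    by (simp add: algebra_simps)
  also have "\<theta> y v / 2 + 2 * r * (\<theta> y v * n + 2 * \<tau> v) + \<tau> v / n = 0"
    unfolding r using n by (simp add: field_simps)
  finally show ?thesis by simp
qed

lemma closed_of_potential:
  assumes "\<And>x. \<exists>U \<psi>. open U \<and> x \<in> U \<and> smooth_fun_on A U \<psi> \<and> (\<forall>y\<in>U. \<forall>v. fun_diff A \<psi> y v = \<theta> y v)"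
  shows "closed_weyl A D"
  unfolding closed_weyl_def
proof
  fix x
  from assms[of x] obtain U \<psi> where U: "open U" "x \<in> U" "smooth_fun_on A U \<psi>"
    and d: "\<forall>y\<in>U. \<forall>v. fun_diff A \<psi> y v = \<theta> y v"
    by (elim exE conjE)
  have nz: "metric_weight \<psi> y \<noteq> 0" for y
  proof -
    obtain h where "\<And>u. gram_map (g y) (h u) = u"
      by (rule gram_map_inverse[OF inner_form_g]) blast
    then show ?thesis
      using endo_det_nonzero(1)[OF linear_gram_map[OF inner_form_g], of y h] by (simp add: metric_weight_def)
  qed
  have "open U \<and> x \<in> U \<and> smooth_weight_section_on A U (metric_weight \<psi>) \<and>
        (\<forall>y\<in>U. metric_weight \<psi> y \<noteq> 0) \<and> (\<forall>y\<in>U. \<forall>v. weight_deriv A D y v (metric_weight \<psi>) = 0)"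
    by (intro conjI ballI allI U(1,2) nz smooth_weight_section_metric_weight[OF U(1,3)]
        weight_deriv_metric_weight[OF U(1) _ U(3) d[rule_format]])
  then show "\<exists>U l. open U \<and> x \<in> U \<and> smooth_weight_section_on A U l \<and>
        (\<forall>y\<in>U. l y \<noteq> 0) \<and> (\<forall>y\<in>U. \<forall>v. weight_deriv A D y v l = 0)" by blast
qed

end

section \<open>Propagation of parallel distributions\<close>

text \<open>The differential inequality says that \<open>q t * exp (- C * t)\<close> does not
  increase.\<close>

lemma gronwall_zero:
  fixes q :: "real \<Rightarrow> real"
  assumes d: "\<And>t. 0 \<le> t \<Longrightarrow> t \<le> 1 \<Longrightarrow> (q has_real_derivative q' t) (at t)"
    and le: "\<And>t. 0 \<le> t \<Longrightarrow> t \<le> 1 \<Longrightarrow> q' t \<le> C * q t"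
    and "q 0 = 0"
  shows "q 1 \<le> 0"
proof -
  have "q 1 * exp (- C * 1) \<le> q 0 * exp (- C * 0)"
  proof (rule DERIV_nonpos_imp_nonincreasing[where f = "\<lambda>t. q t * exp (- C * t)"])
    fix t :: real assume t: "0 \<le> t" "t \<le> 1"
    have "((\<lambda>t. q t * exp (- C * t)) has_real_derivative (q' t - C * q t) * exp (- C * t)) (at t)"
      by (auto intro!: derivative_eq_intros d[OF t] simp: algebra_simps)
    moreover have "(q' t - C * q t) * exp (- C * t) \<le> 0"
      using le[OF t] by (simp add: mult_nonpos_nonneg)
    ultimately show "\<exists>y. ((\<lambda>t. q t * exp (- C * t)) has_real_derivative y) (at t) \<and> y \<le> 0" by blast
  qed simp
  then show ?thesis using assms(3) by (simp add: mult_le_0_iff)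
qed

lemma continuous_on_cball_bounded:
  fixes f :: "'a::euclidean_space \<Rightarrow> real"
  assumes "continuous_on (cball z r) f"
  obtains M where "\<And>x. x \<in> cball z r \<Longrightarrow> f x \<le> M"
proof -
  have "bdd_above (f ` cball z r)"
    by (rule bounded_imp_bdd_above[OF compact_imp_bounded[OF compact_continuous_image[OF assms compact_cball]]])
  then obtain M where "\<forall>y\<in>f ` cball z r. y \<le> M" unfolding bdd_above_def by blast
  then show ?thesis by (intro that[of M]) simp
qed

lemma linear_frame: "linear (\<lambda>c. \<Sum>b\<in>Basis. (c \<bullet> b) *\<^sub>R F b)"
  by (rule linearI) (simp_all add: inner_add_left scaleR_add_left sum.distrib scaleR_sum_right)

lemma range_frame:
  fixes F :: "'k::euclidean_space \<Rightarrow> 'e::euclidean_space"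
  shows "range (\<lambda>c. \<Sum>b\<in>Basis. (c \<bullet> b) *\<^sub>R F b) = span (F ` Basis)"
proof -
  let ?K = "\<lambda>c. \<Sum>b\<in>Basis. (c \<bullet> b) *\<^sub>R F b"
  have "?K b = F b" if "b \<in> Basis" for b
    using that by (simp add: inner_Basis if_distrib[of "\<lambda>r. r *\<^sub>R _"] cong: if_cong)
  then have "?K ` Basis = F ` Basis" by (rule image_cong[OF refl])
  then show ?thesis using span_linear_image[OF linear_frame, of F Basis] by simp
qed

text \<open>Near \<open>z0\<close> the coefficients of a combination of the frame are controlled
  uniformly by its norm. Injectivity gives a bound \<open>B\<close> at \<open>z0\<close>; if each
  frame vector moves by less than \<open>e\<close>, at most half of it is lost.\<close>

lemma linear_lower_bound_nearby:
  fixes f :: "'k::euclidean_space \<Rightarrow> 'z::metric_space \<Rightarrow> 'e::euclidean_space"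
  assumes inj: "\<And>c. (\<Sum>b\<in>Basis. (c \<bullet> b) *\<^sub>R f b z0) = 0 \<Longrightarrow> c = 0"
    and cont: "\<And>b. b \<in> Basis \<Longrightarrow> continuous (at z0) (f b)"
  obtains r m where "r > 0" "m > 0"
    "\<And>z c. dist z z0 < r \<Longrightarrow> m * norm c \<le> norm (\<Sum>b\<in>Basis. (c \<bullet> b) *\<^sub>R f b z)"
proof -
  define K where "K z c = (\<Sum>b\<in>Basis. (c \<bullet> b) *\<^sub>R f b z)" for z c
  have lin: "linear (K z)" for z unfolding K_def by (rule linear_frame)
  have "inj (K z0)"
    using inj lin by (simp add: linear_injective_0 K_def)
  then obtain B where B: "B > 0" "\<And>c. B * norm c \<le> norm (K z0 c)"
    using linear_inj_bounded_below_pos[OF lin] by metis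
  define e where "e = B / (2 * DIM('k))"
  have e: "e > 0" using B(1) by (simp add: e_def)
  have "\<forall>b\<in>Basis. \<exists>d>0. \<forall>z. dist z z0 < d \<longrightarrow> dist (f b z) (f b z0) < e"
    using cont e unfolding continuous_at_eps_delta by blast
  then obtain d where d: "\<And>b. b \<in> Basis \<Longrightarrow> d b > 0"
    "\<And>b z. b \<in> Basis \<Longrightarrow> dist z z0 < d b \<Longrightarrow> dist (f b z) (f b z0) < e" by metis
  define r where "r = Min (d ` Basis)"
  have r: "r > 0" "\<And>b. b \<in> Basis \<Longrightarrow> r \<le> d b" using d(1) by (auto simp: r_def)
  show ?thesis
  proof (rule that[of r "B / 2"])
    fix z c assume z: "dist z z0 < r"
    have "norm (K z c - K z0 c) = norm (\<Sum>b\<in>Basis. (c \<bullet> b) *\<^sub>R (f b z - f b z0))"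
      by (simp add: K_def sum_subtractf scaleR_diff_right)
    also have "\<dots> \<le> (\<Sum>b\<in>(Basis :: 'k set). norm c * e)"
    proof (rule sum_norm_le)
      fix b :: 'k assume b: "b \<in> Basis"
      have "norm (f b z - f b z0) \<le> e" using d(2)[OF b, of z] z r(2)[OF b] by (simp add: dist_norm)
      then show "norm ((c \<bullet> b) *\<^sub>R (f b z - f b z0)) \<le> norm c * e"
        by (simp add: mult_mono Basis_le_norm b)
    qed
    also have "\<dots> = B / 2 * norm c" by (simp add: e_def)
    finally have "norm (K z c - K z0 c) \<le> B / 2 * norm c" .
    moreover have "norm (K z0 c) \<le> norm (K z c) + norm (K z c - K z0 c)"
      using norm_triangle_ineq4[of "K z c" "K z c - K z0 c"] by simp
    ultimately have "B / 2 * norm c \<le> norm (K z c)" using B(2)[of c] by (simp add: field_simps)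
    then show "B / 2 * norm c \<le> norm (\<Sum>b\<in>Basis. (c \<bullet> b) *\<^sub>R f b z)" by (simp add: K_def)
  qed (use r B in auto)
qed

text \<open>Frames are indexed by the basis of an auxiliary type \<open>'k\<close> whose dimension
  is the rank, so that coefficients form a vector. Followed by an isomorphism of the span with
  \<open>'k\<close>, the coefficient map is a surjective endomorphism, hence injective.\<close>

lemma frame_independent:
  fixes F :: "'k::euclidean_space \<Rightarrow> 'e::euclidean_space"
  assumes "dim (span (F ` Basis)) = DIM('k)" "(\<Sum>b\<in>Basis. (c \<bullet> b) *\<^sub>R F b) = 0"
  shows "c = 0"
proof -
  define K where "K c = (\<Sum>b\<in>Basis. (c \<bullet> b) *\<^sub>R F b)" for c
  have lin: "linear K" unfolding K_def by (rule linear_frame)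
  have "dim (range K) = DIM('k)" using assms(1) unfolding K_def range_frame .
  then obtain \<phi> :: "'e \<Rightarrow> 'k" where \<phi>: "linear \<phi>" "\<phi> ` range K = UNIV"
    using subspace_isomorphism[of "range K" "UNIV :: 'k set"] linear_subspace_image[OF lin subspace_UNIV]
    by auto
  have l: "linear (\<phi> \<circ> K)" using lin \<phi>(1) linear_compose by blast
  have "surj (\<phi> \<circ> K)" using \<phi>(2) by (simp add: image_comp)
  then have "inj (\<phi> \<circ> K)" using l linear_surjective_imp_injective by blast
  then have "inj K" by (rule inj_on_imageI2)
  then show ?thesis using assms(2) lin by (simp add: K_def linear_injective_0)
qed

lemma span_Basis_image:
  fixes F :: "'k::euclidean_space \<Rightarrow> 'e::euclidean_space"
  assumes "w \<in> span (F ` Basis)"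
  obtains c where "w = (\<Sum>b\<in>Basis. (c \<bullet> b) *\<^sub>R F b)"
  using assms unfolding range_frame[symmetric] by blast

lemma parallel_distribution_subspace:
  assumes "parallel_distribution A D E" shows "subspace (E y)"
proof -
  obtain S where "E y = span S" using assms unfolding parallel_distribution_def distribution_def by metis
  then show ?thesis by simp
qed

section \<open>Distributions in the kernel of a parallel endomorphism\<close>

context mfd_connection
begin

text \<open>The rank is the same everywhere, so its value at \<open>x0\<close> fixes the index type
  of the frames near any \<open>x\<close>.\<close>

lemma distribution_frame:
  assumes "distribution A E" "dim (E x0) = DIM('k::euclidean_space)"
  obtains U F where "open U" "x \<in> U" "\<And>b::'k. b \<in> Basis \<Longrightarrow> smooth_field_on A U (F b)"
    "\<And>y. y \<in> U \<Longrightarrow> E y = span ((\<lambda>b. F b y) ` Basis)" "\<And>y. y \<in> U \<Longrightarrow> dim (E y) = DIM('k)"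
proof -
  obtain k where k: "\<And>x. \<exists>U Y. open U \<and> x \<in> U \<and> (\<forall>i<k. smooth_field_on A U (Y i)) \<and>
        (\<forall>y\<in>U. E y = span ((\<lambda>i. Y i y) ` {..<k}) \<and> dim (E y) = k)"
    using assms(1) by (auto simp: distribution_def)
  have kk: "k = DIM('k)" using k[of x0] assms(2) by auto
  from k[of x] obtain U Y where UY: "open U \<and> x \<in> U \<and> (\<forall>i<k. smooth_field_on A U (Y i)) \<and>
        (\<forall>y\<in>U. E y = span ((\<lambda>i. Y i y) ` {..<k}) \<and> dim (E y) = k)"
    by (elim exE)
  have UYy: "E y = span ((\<lambda>i. Y i y) ` {..<k}) \<and> dim (E y) = k" if "y \<in> U" for y
    using UY that by (elim conjE) (rule bspec)
  have U: "open U" "x \<in> U" using conjunct1[OF UY] conjunct1[OF conjunct2[OF UY]] by simp_all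
  have UYi: "\<forall>i<k. smooth_field_on A U (Y i)" by (rule conjunct1[OF conjunct2[OF conjunct2[OF UY]]])
  have "\<exists>i. bij_betw i (Basis :: 'k set) {..<k}"
    by (rule finite_same_card_bij) (simp_all add: kk)
  then obtain i :: "'k \<Rightarrow> nat" where i: "bij_betw i Basis {..<k}" ..
  show ?thesis
  proof (rule that[of U "\<lambda>b. Y (i b)"])
    show "smooth_field_on A U (Y (i b))" if "b \<in> Basis" for b
      using UYi bij_betwE[OF i] that by (metis lessThan_iff)
    show "E y = span ((\<lambda>b. Y (i b) y) ` Basis)" if "y \<in> U" for y
    proof -
      have "(\<lambda>i. Y i y) ` {..<k} = (\<lambda>i. Y i y) ` i ` Basis" using i by (simp add: bij_betw_imp_surj_on)
      also have "\<dots> = (\<lambda>b. Y (i b) y) ` Basis" by (simp add: image_image)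
      finally show ?thesis using conjunct1[OF UYy[OF that]] by (simp only:)
    qed
    show "dim (E y) = DIM('k)" if "y \<in> U" for y
      using conjunct2[OF UYy[OF that]] kk by (simp only:)
  qed (rule U)+
qed

text \<open>A frame of the parallel distribution solves a linear differential equation along rays in a chart,
  and its image under the parallel projection \<open>\<pi>\<close> solves the same equation; Gronwall's inequality
  shows that the image vanishes if it vanishes at the origin of the ray.\<close>

lemma parallel_in_kernel_nearby:
  fixes f :: "'k::euclidean_space \<Rightarrow> 'e \<Rightarrow> 'e"
  assumes V: "open V" "V \<subseteq> crange x" "z0 \<in> V"
    and f: "\<And>b. b \<in> Basis \<Longrightarrow> smooth_on V (f b)"
    and ind: "\<And>c. (\<Sum>b\<in>Basis. (c \<bullet> b) *\<^sub>R f b z0) = 0 \<Longrightarrow> c = 0"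
    and par: "\<And>z v b. z \<in> V \<Longrightarrow> b \<in> Basis \<Longrightarrow>
        fderiv (f b) z v + chr x z v (f b z) \<in> span ((\<lambda>b. f b z) ` Basis)"
    and \<pi>: "linear \<pi>" "\<And>z v w. z \<in> crange x \<Longrightarrow> chr x z v (\<pi> w) = \<pi> (chr x z v w)"
    and z0: "\<And>b. b \<in> Basis \<Longrightarrow> \<pi> (f b z0) = 0"
  obtains r where "r > 0" "ball z0 r \<subseteq> V" "\<And>z b. z \<in> ball z0 r \<Longrightarrow> b \<in> Basis \<Longrightarrow> \<pi> (f b z) = 0"
proof -
  have "continuous (at z0) (f b)" if "b \<in> Basis" for b
    using smooth_on_continuous_on[OF f[OF that]] V by (simp add: continuous_on_eq_continuous_at)
  then obtain r1 m where r1: "r1 > 0" "m > 0"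
    "\<And>z c. dist z z0 < r1 \<Longrightarrow> m * norm c \<le> norm (\<Sum>b\<in>Basis. (c \<bullet> b) *\<^sub>R f b z)"
    using linear_lower_bound_nearby[of f z0, OF ind] by metis
  obtain r2 where r2: "r2 > 0" "cball z0 r2 \<subseteq> V" using V open_contains_cball by blast
  define r where "r = min r1 r2"
  have r: "r > 0" using r1 r2 by (simp add: r_def)
  have "\<pi> (f b z1) = 0" if z1: "z1 \<in> ball z0 r" and b: "b \<in> Basis" for z1 b
  proof -
    define v where "v = z1 - z0"
    define \<Gamma> where "\<Gamma> z w = chr x z v w" for z w
    define p where "p t = z0 + t *\<^sub>R v" for t
    have pin: "dist (p t) z0 < r1" "p t \<in> cball z0 r2" "p t \<in> V" if "0 \<le> t" "t \<le> 1" for t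
    proof -
      have "dist (p t) z0 = \<bar>t\<bar> * norm v" by (simp add: p_def dist_norm)
      also have "\<dots> \<le> 1 * norm v" using that by (intro mult_right_mono) auto
      also have "\<dots> < r" using z1 by (simp add: v_def dist_norm norm_minus_commute)
      finally have *: "dist (p t) z0 < r" .
      then show "dist (p t) z0 < r1" "p t \<in> cball z0 r2" by (simp_all add: r_def dist_commute)
      then show "p t \<in> V" using r2 by auto
    qed
    have l\<Gamma>: "linear (\<Gamma> z)" if "z \<in> V" for z
      using bilinear_chr[of z x] that V(2) by (auto simp: \<Gamma>_def[abs_def] bilinear_def)
    have \<Gamma>s: "\<Gamma> z w = (\<Sum>e\<in>Basis. (w \<bullet> e) *\<^sub>R \<Gamma> z e)" if "z \<in> V" for z w
      by (rule linear_Basis_sum[OF l\<Gamma>[OF that]])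
    have c\<Gamma>: "continuous_on (cball z0 r2) (\<lambda>z. \<Gamma> z e)" for e
      unfolding \<Gamma>_def using smooth_on_continuous_on[OF smooth_chr[of x v e]] r2(2) V(2)
      by (rule continuous_on_subset[OF _ order_trans])
    have "continuous_on (cball z0 r2) (\<lambda>z. \<Sum>e\<in>Basis. norm (\<Gamma> z e))"
      by (rule continuous_on_sum, rule continuous_on_norm, rule c\<Gamma>)
    from continuous_on_cball_bounded[OF this] obtain M2
      where M2: "\<And>z. z \<in> cball z0 r2 \<Longrightarrow> (\<Sum>e\<in>Basis. norm (\<Gamma> z e)) \<le> M2" by blast
    have \<Gamma>b: "norm (\<Gamma> z w) \<le> M2 * norm w" if "z \<in> cball z0 r2" for z w
    proof -
      have "norm (\<Gamma> z w) \<le> (\<Sum>e\<in>Basis. norm w * norm (\<Gamma> z e))"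
        unfolding \<Gamma>s[OF subsetD[OF r2(2) that], of w]
      proof (rule sum_norm_le)
        fix e :: 'e assume "e \<in> Basis"
        then show "norm ((w \<bullet> e) *\<^sub>R \<Gamma> z e) \<le> norm w * norm (\<Gamma> z e)"
          by (simp add: mult_mono Basis_le_norm)
      qed
      also have "\<dots> = norm w * (\<Sum>e\<in>Basis. norm (\<Gamma> z e))" by (rule sum_distrib_left[symmetric])
      also have "\<dots> \<le> norm w * M2" by (rule mult_left_mono[OF M2[OF that] norm_ge_zero])
      finally show ?thesis by (simp add: mult.commute)
    qed
    \<comment> \<open>The covariant derivative of a frame vector along the ray. By
      \<open>par\<close> it lies in the span of the frame, with coefficients of size at most
      \<open>M3 / m\<close>.\<close>
    define df where "df b z = fderiv (f b) z v + \<Gamma> z (f b z)" for b z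
    have cdf: "continuous_on (cball z0 r2) (df b)" if "b \<in> Basis" for b
    proof -
      have c1: "continuous_on (cball z0 r2) (\<lambda>z. fderiv (f b) z v)"
        by (rule continuous_on_subset[OF smooth_on_continuous_on[OF smooth_on_derivative[OF f[OF that]]] r2(2)])
      have c2: "continuous_on (cball z0 r2) (f b)"
        by (rule continuous_on_subset[OF smooth_on_continuous_on[OF f[OF that]] r2(2)])
      have "continuous_on (cball z0 r2) (\<lambda>z. \<Sum>e\<in>Basis. (f b z \<bullet> e) *\<^sub>R \<Gamma> z e)"
        by (intro continuous_on_sum continuous_on_scaleR continuous_on_inner c2 c\<Gamma> continuous_on_const)
      then have "continuous_on (cball z0 r2) (\<lambda>z. \<Gamma> z (f b z))"
        by (rule continuous_on_eq) (use \<Gamma>s r2(2) in \<open>metis subsetD\<close>)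
      then show ?thesis unfolding df_def by (rule continuous_on_add[OF c1])
    qed
    have "continuous_on (cball z0 r2) (\<lambda>z. \<Sum>b\<in>Basis. norm (df b z))"
      by (rule continuous_on_sum, rule continuous_on_norm, rule cdf)
    from continuous_on_cball_bounded[OF this] obtain M3
      where M3: "\<And>z. z \<in> cball z0 r2 \<Longrightarrow> (\<Sum>b\<in>Basis. norm (df b z)) \<le> M3" by blast
    have dfb: "norm (df b z) \<le> M3" if "b \<in> Basis" "z \<in> cball z0 r2" for b z
    proof -
      have "norm (df b z) \<le> (\<Sum>b\<in>Basis. norm (df b z))" using that(1) by (intro member_le_sum) auto
      then show ?thesis using M3[OF that(2)] by linarith
    qed
    define u where "u b t = \<pi> (f b (p t))" for b t
    define u' where "u' b t = \<pi> (fderiv (f b) (p t) v)" for b t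
    define q where "q t = (\<Sum>b\<in>Basis. u b t \<bullet> u b t)" for t
    define q' where "q' t = (\<Sum>b\<in>Basis. 2 * (u b t \<bullet> u' b t))" for t
    have bl: "bounded_linear \<pi>" using \<pi>(1) by (simp add: linear_conv_bounded_linear)
    have du: "(u b has_vector_derivative u' b t) (at t)" if "b \<in> Basis" "0 \<le> t" "t \<le> 1" for b t
    proof -
      have "((\<lambda>t. f b (z0 + t *\<^sub>R v)) has_vector_derivative fderiv (f b) (p t) v) (at t)"
        using has_vector_derivative_along_line[OF smooth_on_has_derivative[OF f[OF that(1)] pin(3)[OF that(2,3), unfolded p_def]]]
        by (simp add: p_def)
      from bounded_linear.has_vector_derivative[OF bl this]
      show ?thesis by (simp add: u_def[abs_def] u'_def p_def)
    qed
    have dq: "(q has_real_derivative q' t) (at t)" if "0 \<le> t" "t \<le> 1" for t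
    proof -
      have "((\<lambda>t. u b t \<bullet> u b t) has_real_derivative 2 * (u b t \<bullet> u' b t)) (at t)" if "b \<in> Basis" for b
        using bounded_bilinear.has_vector_derivative[OF bounded_bilinear_inner
            du[OF that \<open>0 \<le> t\<close> \<open>t \<le> 1\<close>] du[OF that \<open>0 \<le> t\<close> \<open>t \<le> 1\<close>]]
        by (simp add: has_real_derivative_iff_has_vector_derivative inner_commute[of "u' b t"])
      then show ?thesis unfolding q_def q'_def by (intro DERIV_sum)
    qed
    define k where "k = real DIM('k)"
    \<comment> \<open>Each of the \<open>k\<close> summands of \<open>q'\<close> is at most
      \<open>2 * ((M3 / m) * k + \<bar>M2\<bar>)\<close> times \<open>q\<close>: the first part
      stems from the \<open>k\<close> frame coefficients, the second from the Christoffel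
      symbols.\<close>
    define C where "C = 2 * k * ((M3 / m) * k + \<bar>M2\<bar>)"
    have qle: "q' t \<le> C * q t" if t: "0 \<le> t" "t \<le> 1" for t
    proof -
      note P = pin[OF t]
      have nq: "norm (u b t) * norm (u b' t) \<le> q t" if "b \<in> Basis" "b' \<in> Basis" for b b'
      proof -
        have s: "u b t \<bullet> u b t \<le> q t" if "b \<in> Basis" for b
          unfolding q_def using that by (intro member_le_sum) auto
        have "norm (u b t) * norm (u b' t) \<le> ((norm (u b t))\<^sup>2 + (norm (u b' t))\<^sup>2) / 2"
          using sum_squares_bound[of "norm (u b t)" "norm (u b' t)"] by simp
        also have "\<dots> \<le> q t" using s[OF that(1)] s[OF that(2)] by (simp add: power2_norm_eq_inner)
        finally show ?thesis .
      qed
      have "2 * (u b t \<bullet> u' b t) \<le> 2 * ((M3 / m) * k + \<bar>M2\<bar>) * q t" if b: "b \<in> Basis" for b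
      proof -
        obtain c where c: "df b (p t) = (\<Sum>b'\<in>Basis. (c \<bullet> b') *\<^sub>R f b' (p t))"
          using span_Basis_image par[OF P(3) b, of v] unfolding df_def \<Gamma>_def by metis
        have "m * norm c \<le> M3" using r1(3)[OF P(1), of c] dfb[OF b P(2)] c by simp
        then have cn: "norm c \<le> M3 / m" using r1(2) by (simp add: field_simps)
        have "\<pi> (df b (p t)) = (\<Sum>b'\<in>Basis. (c \<bullet> b') *\<^sub>R u b' t)"
          by (simp add: c u_def linear_sum[OF \<pi>(1)] linear_cmul[OF \<pi>(1)])
        moreover have "\<pi> (df b (p t)) = u' b t + \<Gamma> (p t) (u b t)"
          using \<pi>(2)[of "p t" v "f b (p t)"] V(2) P(3)
          by (auto simp: df_def u'_def u_def \<Gamma>_def linear_add[OF \<pi>(1)])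
        \<comment> \<open>Since \<open>\<pi>\<close> commutes with the Christoffel symbols, the
          images of the frame satisfy the same linear system as the frame.\<close>
        ultimately have u': "u' b t = (\<Sum>b'\<in>Basis. (c \<bullet> b') *\<^sub>R u b' t) - \<Gamma> (p t) (u b t)"
          by (simp add: eq_diff_eq)
        have a1: "u b t \<bullet> (\<Sum>b'\<in>Basis. (c \<bullet> b') *\<^sub>R u b' t) \<le> (\<Sum>b'\<in>(Basis::'k set). (M3 / m) * q t)"
          unfolding inner_sum_right
        proof (rule sum_mono)
          fix b' :: 'k assume b': "b' \<in> Basis"
          have "u b t \<bullet> ((c \<bullet> b') *\<^sub>R u b' t) \<le> norm (u b t) * norm ((c \<bullet> b') *\<^sub>R u b' t)"
            by (rule norm_cauchy_schwarz)
          also have "\<dots> = \<bar>c \<bullet> b'\<bar> * (norm (u b t) * norm (u b' t))" by simp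
          also have "\<dots> \<le> (M3 / m) * q t"
            using nq[OF b b'] Basis_le_norm[OF b', of c] cn by (intro mult_mono) auto
          finally show "u b t \<bullet> ((c \<bullet> b') *\<^sub>R u b' t) \<le> (M3 / m) * q t" .
        qed
        have a2: "- (u b t \<bullet> \<Gamma> (p t) (u b t)) \<le> \<bar>M2\<bar> * q t"
        proof -
          have "- (u b t \<bullet> \<Gamma> (p t) (u b t)) \<le> norm (u b t) * norm (\<Gamma> (p t) (u b t))"
            using norm_cauchy_schwarz[of "- u b t" "\<Gamma> (p t) (u b t)"] by simp
          also have "\<dots> \<le> norm (u b t) * (\<bar>M2\<bar> * norm (u b t))"
            using order_trans[OF \<Gamma>b[OF P(2), of "u b t"] mult_right_mono[OF abs_ge_self[of M2] norm_ge_zero]]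
            by (intro mult_left_mono) simp_all
          also have "\<dots> = \<bar>M2\<bar> * (norm (u b t) * norm (u b t))" by simp
          also have "\<dots> \<le> \<bar>M2\<bar> * q t" using nq[OF b b] by (intro mult_left_mono) auto
          finally show ?thesis .
        qed
        have "u b t \<bullet> u' b t = u b t \<bullet> (\<Sum>b'\<in>Basis. (c \<bullet> b') *\<^sub>R u b' t) - u b t \<bullet> \<Gamma> (p t) (u b t)"
          by (simp only: u' inner_diff_right)
        also have "\<dots> \<le> k * ((M3 / m) * q t) + \<bar>M2\<bar> * q t"
          using add_mono[OF a1 a2] by (simp add: k_def)
        also have "\<dots> = ((M3 / m) * k + \<bar>M2\<bar>) * q t" by (simp add: algebra_simps)
        finally have "2 * (u b t \<bullet> u' b t) \<le> 2 * (((M3 / m) * k + \<bar>M2\<bar>) * q t)" by (rule mult_left_mono) simp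
        then show ?thesis by (simp only: mult.assoc)
      qed
      then have "q' t \<le> (\<Sum>b\<in>(Basis::'k set). 2 * ((M3 / m) * k + \<bar>M2\<bar>) * q t)"
        unfolding q'_def by (rule sum_mono)
      then show ?thesis by (simp add: C_def k_def mult_ac)
    qed
    have "q 0 = 0" by (simp add: q_def u_def p_def z0)
    from gronwall_zero[OF dq qle this] have "q 1 \<le> 0" by simp
    then have "q 1 = 0" unfolding q_def by (intro antisym sum_nonneg) auto
    then have "u b 1 = 0" using b by (simp add: q_def sum_nonneg_eq_0_iff)
    then show ?thesis by (simp add: u_def p_def v_def)
  qed
  then show ?thesis using r r2 by (intro that[of r]) (auto simp: r_def)
qed

text \<open>A constant \<open>\<pi>\<close> that commutes with all changes of chart and all
  Christoffel symbols is a parallel endomorphism of the tangent bundle. The points where the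
  distribution lies in its kernel form an open set by uniqueness along rays; the complement is open
  by continuity of a frame, and the manifold is connected.\<close>

lemma parallel_in_kernel:
  assumes E: "parallel_distribution A D E" and rank: "dim (E x0) = DIM('k::euclidean_space)"
    and \<pi>: "linear \<pi>" "\<And>z x v w. z \<in> crange x \<Longrightarrow> chr x z v (\<pi> w) = \<pi> (chr x z v w)"
    and \<pi>c: "\<And>x y v. y \<in> cdom A x \<Longrightarrow> ctrans A y x y (\<pi> v) = \<pi> (ctrans A y x y v)"
    and x0: "\<And>e. e \<in> E x0 \<Longrightarrow> \<pi> e = 0" and e: "e \<in> E x"
  shows "\<pi> e = 0"
proof -
  define S where "S = {x. \<forall>e\<in>E x. \<pi> e = 0}"
  have \<pi>_iff: "\<pi> (ctrans A y x y v) = 0 \<longleftrightarrow> \<pi> v = 0" if "y \<in> cdom A x" for x y v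
    using ctrans_eq_0_iff[OF centre_in_cdom that] \<pi>c[OF that, of v] by metis
  have dist: "distribution A E" using E by (simp add: parallel_distribution_def)
  have "\<exists>W. open W \<and> x \<in> W \<and> (if x \<in> S then W \<subseteq> S else W \<inter> S = {})" for x
  proof -
    obtain U' F where U': "open U'" "x \<in> U'" "\<And>b::'k. b \<in> Basis \<Longrightarrow> smooth_field_on A U' (F b)"
      "\<And>y. y \<in> U' \<Longrightarrow> E y = span ((\<lambda>b. F b y) ` Basis)" "\<And>y. y \<in> U' \<Longrightarrow> dim (E y) = DIM('k)"
      by (rule distribution_frame[OF dist rank, of x]) blast
    define U where "U = U' \<inter> cdom A x"
    have U: "open U" "x \<in> U" "U \<subseteq> cdom A x" "\<And>b::'k. b \<in> Basis \<Longrightarrow> smooth_field_on A U (F b)"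
      "\<And>y. y \<in> U \<Longrightarrow> E y = span ((\<lambda>b. F b y) ` Basis)" "\<And>y. y \<in> U \<Longrightarrow> dim (E y) = DIM('k)"
      using U' open_cdom centre_in_cdom smooth_field_on_subset[of U' _ U] by (auto simp: U_def)
    define V where "V = cmap A x ` U"
    have V: "open V" "V \<subseteq> crange x"
      using open_chart_image[OF U'(1), of x] by (auto simp: V_def U_def crange_def)
    define f where "f b = field_comp A x (F b)" for b
    define z0 where "z0 = cmap A x x"
    have z0: "z0 \<in> V" using U(2) by (simp add: z0_def V_def)
    have f: "smooth_on V (f b)" if "b \<in> Basis" for b
      using smooth_field_on_chart[OF U'(3)[OF that], of x] by (simp add: f_def V_def U_def)
    have fc: "f b (cmap A x y) = ctrans A y x y (F b y)" if "y \<in> U" for b y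
      using that U(3) by (auto simp: f_def field_comp_cmap)
    have S_iff: "y \<in> S \<longleftrightarrow> (\<forall>b\<in>Basis. \<pi> (f b (cmap A x y)) = 0)" if y: "y \<in> U" for y
    proof -
      have yx: "y \<in> cdom A x" using y U(3) by auto
      have "y \<in> S \<longleftrightarrow> (\<forall>b\<in>Basis. \<pi> (F b y) = 0)"
      proof
        assume "y \<in> S"
        then show "\<forall>b\<in>Basis. \<pi> (F b y) = 0" using U(5)[OF y] by (auto simp: S_def span_base)
      next
        assume b: "\<forall>b\<in>Basis. \<pi> (F b y) = 0"
        have "\<pi> w = 0" if "w \<in> span ((\<lambda>b. F b y) ` Basis)" for w
          by (rule linear_eq_0_on_span[OF \<pi>(1) _ that]) (use b in auto)
        then show "y \<in> S" using U(5)[OF y] by (simp add: S_def)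
      qed
      then show ?thesis by (simp add: fc[OF y] \<pi>_iff[OF yx])
    qed
    have cont: "continuous_on U (cmap A x)"
      using chart_homeomorphism[of x] U(3) continuous_on_subset by (auto simp: homeomorphism_def)
    show ?thesis
    proof (cases "x \<in> S")
      case True
      have ind: "c = 0" if "(\<Sum>b\<in>Basis. (c \<bullet> b) *\<^sub>R f b z0) = 0" for c :: 'k
        by (rule frame_independent[of "\<lambda>b. F b x"])
           (use U(5,6)[OF U(2)] that in \<open>simp_all add: z0_def fc[OF U(2)] ctrans_refl centre_in_cdom\<close>)
      have par: "fderiv (f b) z v + chr x z v (f b z) \<in> span ((\<lambda>b. f b z) ` Basis)"
        if zV: "z \<in> V" and b: "b \<in> Basis" for z v and b :: 'k
      proof -
        obtain y where y: "y \<in> U" "z = cmap A x y" using zV by (auto simp: V_def)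
        have yx: "y \<in> cdom A x" using y U(3) by auto
        have "\<forall>y\<in>U. F b y \<in> E y" using U(5) b by (auto simp: span_base)
        then have "D y (coord_field A x v y) (F b) \<in> E y"
          using E U(1,4) y b unfolding parallel_distribution_def by blast
        then have "ctrans A y x y (D y (coord_field A x v y) (F b)) \<in> ctrans A y x y ` span ((\<lambda>b. F b y) ` Basis)"
          using U(5)[OF y(1)] by blast
        also have "\<dots> = span (ctrans A y x y ` (\<lambda>b. F b y) ` Basis)"
          using linear_span_image[OF linear_ctrans[OF centre_in_cdom yx]] by simp
        also have "ctrans A y x y ` (\<lambda>b. F b y) ` Basis = (\<lambda>b. f b z) ` Basis"
          by (simp add: image_image y fc[OF y(1)])
        finally show ?thesis
          using covariant_derivative_chart[OF U(1,3) y(1) U(4)[OF b], of v] by (simp add: y(2) f_def)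
      qed
      have "\<pi> (f b z0) = 0" if "b \<in> Basis" for b using S_iff[OF U(2)] True that by (simp add: z0_def)
      then obtain r where r: "r > 0" "ball z0 r \<subseteq> V" "\<And>z b. z \<in> ball z0 r \<Longrightarrow> b \<in> Basis \<Longrightarrow> \<pi> (f b z) = 0"
        using parallel_in_kernel_nearby[OF V z0 f ind par \<pi>(1) \<pi>(2)] by metis
      have "open (U \<inter> cmap A x -` ball z0 r)"
        by (rule continuous_open_preimage[OF cont U(1) open_ball])
      moreover have "U \<inter> cmap A x -` ball z0 r \<subseteq> S" using S_iff r(3) by auto
      ultimately show ?thesis using True U(2) r(1)
        by (intro exI[of _ "U \<inter> cmap A x -` ball z0 r"]) (auto simp: z0_def)
    next
      case False
      then obtain b where b: "b \<in> Basis" "\<pi> (f b z0) \<noteq> 0" using S_iff[OF U(2)] by (auto simp: z0_def)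
      have "continuous_on V (\<lambda>z. \<pi> (f b z))"
        by (rule smooth_on_continuous_on[OF smooth_on_linear_comp[OF \<pi>(1) V(1) f[OF b(1)]]])
      then have "continuous_on U (\<lambda>y. \<pi> (f b (cmap A x y)))"
        by (rule continuous_on_compose2[OF _ cont]) (simp add: V_def)
      then have "open (U \<inter> (\<lambda>y. \<pi> (f b (cmap A x y))) -` (- {0}))"
        by (rule continuous_open_preimage[OF _ U(1)]) auto
      moreover have "(U \<inter> (\<lambda>y. \<pi> (f b (cmap A x y))) -` (- {0})) \<inter> S = {}" using S_iff b(1) by auto
      ultimately show ?thesis using False U(2) b(2)
        by (intro exI[of _ "U \<inter> (\<lambda>y. \<pi> (f b (cmap A x y))) -` (- {0})"]) (auto simp: z0_def)
    qed
  qed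
  then obtain W where W: "\<And>x. open (W x)" "\<And>x. x \<in> W x" "\<And>x. if x \<in> S then W x \<subseteq> S else W x \<inter> S = {}"
    by metis
  have W': "x \<in> S \<Longrightarrow> W x \<subseteq> S" "x \<notin> S \<Longrightarrow> W x \<subseteq> - S" for x
    using W(3)[of x] by (auto split: if_splits)
  have "S = \<Union> (W ` S)" "- S = \<Union> (W ` (- S))"
    using W(2) W' by blast+
  then have "open S" "open (- S)" using W(1) by (metis open_UN)+
  moreover have "x0 \<in> S" using x0 by (simp add: S_def)
  moreover have "connected (UNIV :: 'm set)" using smooth_manifold by (simp add: smooth_manifold_def)
  ultimately have "S = UNIV"
    using connectedD[of UNIV S "- S"] by auto
  then show ?thesis using e by (auto simp: S_def)
qed

end

section \<open>Curvature and product charts\<close>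

text \<open>The Koszul formula, differentiated with respect to the parameter \<open>s\<close> of a family of Weyl
  connections of the conformal class of a fixed inner product.\<close>

lemma weyl_connection_variation:
  fixes \<Gamma> :: "real \<Rightarrow> 'c::euclidean_space \<Rightarrow> 'c \<Rightarrow> 'c"
  assumes h: "inner_form h" and "d > 0"
    and sym: "\<And>s u y. \<bar>s\<bar> < d \<Longrightarrow> \<Gamma> s u y = \<Gamma> s y u"
    and K: "\<And>s u y y'. \<bar>s\<bar> < d \<Longrightarrow> K u y y' = \<phi> s u * h y y' + h (\<Gamma> s u y) y' + h y (\<Gamma> s u y')"
    and d\<phi>: "\<And>u. ((\<lambda>s. \<phi> s u) has_vector_derivative \<tau> u) (at 0)"
    and d\<Gamma>: "\<And>u y. ((\<lambda>s. \<Gamma> s u y) has_vector_derivative T u y) (at 0)"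
  shows "2 * h (T u y) z = - \<tau> u * h y z - \<tau> y * h u z + \<tau> z * h u y"
proof -
  have ball: "open {- d<..<d}" "0 \<in> {- d<..<d}" using assms(2) by auto
  have T_sym: "T u y = T y u" for u y
  proof -
    have "((\<lambda>s. \<Gamma> s u y) has_vector_derivative T y u) (at 0)"
      by (rule has_vector_derivative_transform_within_open[OF d\<Gamma>[of y u] ball]) (auto intro: sym)
    then show ?thesis using d\<Gamma>[of u y] vector_derivative_unique_at by blast
  qed
  have bl: "bounded_linear (\<lambda>w. h w y)" "bounded_linear (h y)" for y
    using inner_form_bilinear[OF h] by (simp_all add: bilinear_def linear_conv_bounded_linear)
  have S: "h (T u y) y' + h (T u y') y = - \<tau> u * h y y'" for u y y'
  proof -
    have m: "((\<lambda>s. \<phi> s u * h y y') has_vector_derivative \<tau> u * h y y') (at 0)"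
      by (rule bounded_linear.has_vector_derivative[OF bounded_linear_mult_left d\<phi>])
    note b1 = bounded_linear.has_vector_derivative[OF bl(1)[of y'] d\<Gamma>[of u y]]
    note b2 = bounded_linear.has_vector_derivative[OF bl(2)[of y] d\<Gamma>[of u y']]
    have "((\<lambda>s. K u y y') has_vector_derivative \<tau> u * h y y' + h (T u y) y' + h y (T u y')) (at 0)"
      by (rule has_vector_derivative_transform_within_open[OF
            has_vector_derivative_add[OF has_vector_derivative_add[OF m b1] b2] ball])
         (rule K[symmetric], auto)
    \<comment> \<open>\<open>K\<close> does not involve \<open>s\<close>, so differentiating the
      compatibility equations leaves an equation for the variation \<open>T\<close> alone.\<close>
    moreover have "((\<lambda>s. K u y y') has_vector_derivative 0) (at 0)"
      by (rule has_vector_derivative_const)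
    ultimately have "\<tau> u * h y y' + h (T u y) y' + h y (T u y') = 0"
      by (rule vector_derivative_unique_at)
    then show ?thesis using inner_form_sym[OF h, of y "T u y'"] by simp
  qed
  \<comment> \<open>The sum of the first two instances minus the third isolates
    \<open>h (T u y) z\<close>.\<close>
  show ?thesis
    using S[of u y z] S[of y u z] S[of z u y] inner_form_sym[OF h, of y u]
    by (simp add: T_sym[of y u] T_sym[of z u] T_sym[of z y])
qed

section \<open>Curvature in a chart\<close>

context mfd_connection
begin

text \<open>Curvature involves derivatives, so a single vector must be extended to a section.
  Combinations of the frame with constant coefficients do this, as induction over the span
  shows.\<close>

lemma distribution_section:
  assumes "distribution A E" "e \<in> E y"
  obtains U Y where "open U" "y \<in> U" "smooth_field_on A U Y" "\<And>p. p \<in> U \<Longrightarrow> Y p \<in> E p" "Y y = e"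
proof -
  obtain k where k: "\<And>x. \<exists>U Y. open U \<and> x \<in> U \<and> (\<forall>i<k. smooth_field_on A U (Y i)) \<and>
        (\<forall>y\<in>U. E y = span ((\<lambda>i. Y i y) ` {..<k}) \<and> dim (E y) = k)"
    using assms(1) by (auto simp: distribution_def)
  from k[of y] obtain U Y where UY: "open U \<and> y \<in> U \<and> (\<forall>i<k. smooth_field_on A U (Y i)) \<and>
        (\<forall>y\<in>U. E y = span ((\<lambda>i. Y i y) ` {..<k}) \<and> dim (E y) = k)"
    by (elim exE)
  have Ey: "E p = span ((\<lambda>i. Y i p) ` {..<k})" if "p \<in> U" for p using UY that by (elim conjE) (drule (1) bspec, elim conjE)
  have U: "open U" "y \<in> U" using conjunct1[OF UY] conjunct1[OF conjunct2[OF UY]] by simp_all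
  have sY: "\<forall>i<k. smooth_field_on A U (Y i)" by (rule conjunct1[OF conjunct2[OF conjunct2[OF UY]]])
  define P where "P e \<longleftrightarrow> (\<exists>X. smooth_field_on A U X \<and> (\<forall>p\<in>U. X p \<in> E p) \<and> X y = e)" for e
  have sub: "subspace (E p)" if "p \<in> U" for p unfolding Ey[OF that] by (rule subspace_span)
  have "subspace {e. P e}"
  proof (rule subspaceI)
    show "0 \<in> {e. P e}"
      using smooth_field_zero[OF U(1)] subspace_0[OF sub] by (auto simp: P_def intro!: exI[of _ "\<lambda>_. 0"])
  next
    fix a b assume "a \<in> {e. P e}" "b \<in> {e. P e}"
    then obtain X1 X2 where "smooth_field_on A U X1" "\<forall>p\<in>U. X1 p \<in> E p" "X1 y = a"
      "smooth_field_on A U X2" "\<forall>p\<in>U. X2 p \<in> E p" "X2 y = b" unfolding P_def by auto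
    then have "smooth_field_on A U (\<lambda>p. X1 p + X2 p)" "\<forall>p\<in>U. X1 p + X2 p \<in> E p" "X1 y + X2 y = a + b"
      using smooth_field_add[OF U(1)] subspace_add[OF sub] by auto
    then show "a + b \<in> {e. P e}" unfolding P_def by (auto intro!: exI[of _ "\<lambda>p. X1 p + X2 p"])
  next
    fix c a assume "a \<in> {e. P e}"
    then obtain X where "smooth_field_on A U X" "\<forall>p\<in>U. X p \<in> E p" "X y = a" unfolding P_def by auto
    then have "smooth_field_on A U (\<lambda>p. c *\<^sub>R X p)" "\<forall>p\<in>U. c *\<^sub>R X p \<in> E p" "c *\<^sub>R X y = c *\<^sub>R a"
      using smooth_field_scale[OF U(1) smooth_fun_const[OF U(1)]] subspace_scale[OF sub] by auto
    then show "c *\<^sub>R a \<in> {e. P e}" unfolding P_def by (auto intro!: exI[of _ "\<lambda>p. c *\<^sub>R X p"])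
  qed
  moreover have "e \<in> span ((\<lambda>i. Y i y) ` {..<k})" using assms(2) Ey[OF U(2)] by simp
  moreover have "P x" if x: "x \<in> (\<lambda>i. Y i y) ` {..<k}" for x
  proof -
    obtain i where i: "i < k" "x = Y i y" using x by auto
    have "Y i p \<in> E p" if "p \<in> U" for p
      unfolding Ey[OF that] by (rule span_base) (use i in auto)
    then show ?thesis unfolding P_def using sY i by auto
  qed
  ultimately have "P e" using span_induct[of e _ P] by metis
  then show ?thesis using that U unfolding P_def by auto
qed

text \<open>The expression is the curvature \<open>R(u, v) w\<close> in the chart. It equals
  \<open>D_u D_v Y - D_v D_u Y\<close> for coordinate directions and any section \<open>Y\<close>
  through \<open>w\<close>: first derivatives of \<open>Y\<close> cancel between the two terms and
  second ones by symmetry, while each covariant derivative stays in the distribution.\<close>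

lemma curvature_invariant:
  assumes E: "parallel_distribution A D E" and y: "y \<in> cdom A x" and z: "z = cmap A x y"
    and w: "w \<in> ctrans A y x y ` E y"
  shows "fderiv (\<lambda>z. chr x z v w) z u - fderiv (\<lambda>z. chr x z u w) z v
    + chr x z u (chr x z v w) - chr x z v (chr x z u w) \<in> ctrans A y x y ` E y"
proof -
  obtain e where e: "e \<in> E y" "w = ctrans A y x y e" using w by blast
  obtain U' Y where U': "open U'" "y \<in> U'" "smooth_field_on A U' Y" "\<And>p. p \<in> U' \<Longrightarrow> Y p \<in> E p" "Y y = e"
    using E e(1) unfolding parallel_distribution_def by (metis distribution_section)
  define U where "U = U' \<inter> cdom A x"
  have U: "open U" "U \<subseteq> cdom A x" "y \<in> U" "smooth_field_on A U Y" "\<And>p. p \<in> U \<Longrightarrow> Y p \<in> E p"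
    using U' y open_cdom smooth_field_on_subset[of U' Y U] by (auto simp: U_def)
  define V where "V = cmap A x ` U"
  have V: "open V" "V \<subseteq> crange x" "z \<in> V"
    using open_chart_image[OF U'(1), of x] U(3) by (auto simp: V_def U_def crange_def z)
  define f where "f = field_comp A x Y"
  have sf: "smooth_on V f"
    using smooth_field_on_chart[OF U(4), of x] U(2) by (simp add: f_def V_def Int_absorb2)
  have fz: "f z = w" by (simp add: f_def z field_comp_cmap[OF y] U'(5) e(2))
  let ?D = "\<lambda>v p. D p (coord_field A x v p) Y"
  have par: "D p v X \<in> E p" if "smooth_field_on A U X" "\<forall>p\<in>U. X p \<in> E p" "p \<in> U" for p v X
    using E U(1) that unfolding parallel_distribution_def by blast
  have sD: "smooth_field_on A U (?D v)" for v
    by (rule D_smooth[OF U(1) smooth_coord_field[OF U(1,2)] U(4)])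
  have DE: "\<forall>p\<in>U. ?D v p \<in> E p" for v using par[OF U(4)] U(5) by blast
  have fD: "field_comp A x (?D v) p = fderiv f p v + chr x p v (f p)" if "p \<in> V" for v p
  proof -
    obtain q where q: "q \<in> U" "p = cmap A x q" using \<open>p \<in> V\<close> by (auto simp: V_def)
    then have "q \<in> cdom A x" using U(2) by auto
    then show ?thesis
      using covariant_derivative_chart[OF U(1,2) q(1) U(4), of v] by (simp add: q(2) field_comp_cmap f_def)
  qed
  have bil: "bilinear (chr x p)" if "p \<in> V" for p using bilinear_chr V(2) that by auto
  have chr_sum: "chr x p v (f p) = (\<Sum>b\<in>Basis. (f p \<bullet> b) *\<^sub>R chr x p v b)" if "p \<in> V" for p v
    by (rule linear_Basis_sum) (use bil[OF that] in \<open>simp add: bilinear_def\<close>)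
  have dchr: "((\<lambda>p. chr x p v w) has_derivative fderiv (\<lambda>p. chr x p v w) z) (at z)" for v w
    by (rule smooth_on_has_derivative[OF smooth_chr]) (use V in auto)
  have df: "(f has_derivative fderiv f z) (at z)"
    by (rule smooth_on_has_derivative[OF sf V(3)])
  \<comment> \<open>Both the symbols and their argument \<open>f p\<close> vary; the basis expansion
    reduces this to products of scalar functions with symbols of fixed arguments.\<close>
  have d_chr_f: "((\<lambda>p. chr x p v (f p)) has_derivative
      (\<lambda>u. fderiv (\<lambda>p. chr x p v w) z u + chr x z v (fderiv f z u))) (at z)" for v
  proof -
    have l: "linear (chr x z v)" using bil[OF V(3)] by (simp add: bilinear_def)
    have 1: "((\<lambda>p. \<Sum>b\<in>Basis. (f p \<bullet> b) *\<^sub>R chr x p v b) has_derivative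
       (\<lambda>u. \<Sum>b\<in>Basis. (f z \<bullet> b) *\<^sub>R fderiv (\<lambda>p. chr x p v b) z u
          + (fderiv f z u \<bullet> b) *\<^sub>R chr x z v b)) (at z)"
      by (intro has_derivative_sum has_derivative_scaleR has_derivative_inner_left df dchr)
    have "((\<lambda>p. \<Sum>b\<in>Basis. (w \<bullet> b) *\<^sub>R chr x p v b) has_derivative
       (\<lambda>u. \<Sum>b\<in>Basis. (w \<bullet> b) *\<^sub>R fderiv (\<lambda>p. chr x p v b) z u)) (at z)"
      by (intro has_derivative_sum has_derivative_scaleR_right dchr)
    then have "((\<lambda>p. chr x p v w) has_derivative
       (\<lambda>u. \<Sum>b\<in>Basis. (w \<bullet> b) *\<^sub>R fderiv (\<lambda>p. chr x p v b) z u)) (at z)"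
    proof (rule has_derivative_transform_within_open[OF _ V(1,3)])
      fix p assume p: "p \<in> V"
      show "(\<Sum>b\<in>Basis. (w \<bullet> b) *\<^sub>R chr x p v b) = chr x p v w"
        by (rule linear_Basis_sum[symmetric]) (use bil[OF p] in \<open>simp add: bilinear_def\<close>)
    qed
    then have 2: "fderiv (\<lambda>p. chr x p v w) z u =
        (\<Sum>b\<in>Basis. (w \<bullet> b) *\<^sub>R fderiv (\<lambda>p. chr x p v b) z u)" for u
      by (rule frechet_derivative_eqI)
    have 3: "chr x z v q = (\<Sum>b\<in>Basis. (q \<bullet> b) *\<^sub>R chr x z v b)" for q
      by (rule linear_Basis_sum[OF l])
    have "((\<lambda>p. chr x p v (f p)) has_derivative
       (\<lambda>u. \<Sum>b\<in>Basis. (f z \<bullet> b) *\<^sub>R fderiv (\<lambda>p. chr x p v b) z u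
          + (fderiv f z u \<bullet> b) *\<^sub>R chr x z v b)) (at z)"
      by (rule has_derivative_transform_within_open[OF 1 V(1,3)]) (rule chr_sum[symmetric])
    then show ?thesis
      by (rule has_derivative_eq_rhs) (simp add: fz 2 3[of "fderiv f z _"] sum.distrib)
  qed
  have DD: "ctrans A y x y (D y (coord_field A x u y) (?D v)) =
      fderiv (\<lambda>p. fderiv f p v) z u
      + fderiv (\<lambda>p. chr x p v w) z u + chr x z v (fderiv f z u)
      + chr x z u (fderiv f z v) + chr x z u (chr x z v w)" for u v
  proof -
    have 1: "((\<lambda>p. fderiv f p v) has_derivative
        fderiv (\<lambda>p. fderiv f p v) z) (at z)"
      by (rule smooth_on_has_derivative[OF smooth_on_derivative[OF sf] V(3)])
    have "(field_comp A x (?D v) has_derivative (\<lambda>u. fderiv (\<lambda>p. fderiv f p v) z u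
      + (fderiv (\<lambda>p. chr x p v w) z u + chr x z v (fderiv f z u)))) (at z)"
      by (rule has_derivative_transform_within_open[OF has_derivative_add[OF 1 d_chr_f] V(1,3)])
         (rule fD[symmetric])
    then have "fderiv (field_comp A x (?D v)) z u =
        fderiv (\<lambda>p. fderiv f p v) z u
      + (fderiv (\<lambda>p. chr x p v w) z u + chr x z v (fderiv f z u))"
      by (rule frechet_derivative_eqI)
    then show ?thesis
      using covariant_derivative_chart[OF U(1-3) sD, of u v] fD[OF V(3), of v] bilinear_radd[OF bil[OF V(3)]]
      by (simp add: z[symmetric] fz add.assoc)
  qed
  have l: "linear (ctrans A y x y)" by (rule linear_ctrans[OF centre_in_cdom y])
  have sub: "subspace (ctrans A y x y ` E y)"
    by (rule linear_subspace_image[OF l parallel_distribution_subspace[OF E]])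
  have in1: "ctrans A y x y (D y (coord_field A x u y) (?D v)) \<in> ctrans A y x y ` E y" for u v
    using par[OF sD DE U(3)] by blast
  have "ctrans A y x y (D y (coord_field A x u y) (?D v)) - ctrans A y x y (D y (coord_field A x v y) (?D u))
      \<in> ctrans A y x y ` E y"
    by (rule subspace_diff[OF sub in1 in1])
  then show ?thesis
    unfolding DD using mixed_derivatives_commute[OF V(1) sf V(3), of u v] by (simp add: algebra_simps)
qed

end

section \<open>Product charts and the two projections\<close>

lemma cdom_prod: "cdom (prod_atlas A B) (a, b) = cdom A a \<times> cdom B b"
  by (simp add: cdom_def prod_atlas_def)

lemma cmap_prod: "cmap (prod_atlas A B) (a, b) (p, q) = (cmap A a p, cmap B b q)"
  by (simp add: cmap_def prod_atlas_def)

lemma cmap_prod': "cmap (prod_atlas A B) (a, b) = (\<lambda>y. (cmap A a (fst y), cmap B b (snd y)))"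
  by (auto simp: cmap_def prod_atlas_def)

locale product_mfd = M1: smooth_mfd A1 + M2: smooth_mfd A2
  for A1 :: "('m1::{t2_space, second_countable_topology}, 'a::euclidean_space) atlas"
    and A2 :: "('m2::{t2_space, second_countable_topology}, 'b::euclidean_space) atlas"
begin

abbreviation "P \<equiv> prod_atlas A1 A2"

lemma cmap_prod_image: "cmap P (a, b) ` (S \<times> T) = (cmap A1 a ` S) \<times> (cmap A2 b ` T)"
  by (auto simp: cmap_prod' image_iff)

lemma cinv_prod:
  assumes "z1 \<in> M1.crange a" "z2 \<in> M2.crange b"
  shows "cinv P (a, b) (z1, z2) = (cinv A1 a z1, cinv A2 b z2)"
proof -
  have inj: "inj_on (cmap P (a, b)) (cdom P (a, b))"
    by (rule inj_onI) (auto simp: cdom_prod cmap_prod, (metis M1.cinv_cmap M2.cinv_cmap)+)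
  have "(z1, z2) = cmap P (a, b) (cinv A1 a z1, cinv A2 b z2)"
    using assms by (simp add: cmap_prod M1.cmap_cinv M2.cmap_cinv)
  moreover have "(cinv A1 a z1, cinv A2 b z2) \<in> cdom P (a, b)"
    using assms by (simp add: cdom_prod M1.cinv_in_cdom M2.cinv_in_cdom)
  ultimately show ?thesis using inv_into_f_f[OF inj] by (simp add: cinv_def[of P])
qed

lemma smooth_manifold_prod: "smooth_manifold P"
  unfolding smooth_manifold_def
proof (intro conjI allI)
  show "connected (UNIV :: ('m1 \<times> 'm2) set)"
    using M1.smooth_manifold M2.smooth_manifold
    by (simp add: smooth_manifold_def UNIV_Times_UNIV[symmetric] connected_Times del: UNIV_Times_UNIV)
next
  fix x :: "'m1 \<times> 'm2"
  obtain a b where x: "x = (a, b)" by force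
  show "open (cdom P x)" by (simp add: x cdom_prod open_Times M1.open_cdom M2.open_cdom)
  show "x \<in> cdom P x" by (simp add: x cdom_prod M1.centre_in_cdom M2.centre_in_cdom)
  have img: "cmap P x ` cdom P x = M1.crange a \<times> M2.crange b"
    by (simp add: x cdom_prod cmap_prod_image M1.crange_def M2.crange_def)
  show "open (cmap P x ` cdom P x)" by (simp add: img open_Times M1.open_crange M2.open_crange)
  show "homeomorphism (cdom P x) (cmap P x ` cdom P x) (cmap P x) (cinv P x)"
  proof (rule homeomorphismI)
    have c1: "continuous_on (cdom A1 a) (cmap A1 a)" "continuous_on (cdom A2 b) (cmap A2 b)"
      using M1.chart_homeomorphism[of a] M2.chart_homeomorphism[of b] by (simp_all add: homeomorphism_def)
    show "continuous_on (cdom P x) (cmap P x)"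
      unfolding x cdom_prod cmap_prod'
      by (rule continuous_on_Pair; rule continuous_on_compose2[OF c1(1)] continuous_on_compose2[OF c1(2)])
         (auto intro: continuous_on_fst continuous_on_snd continuous_on_id)
    have "continuous_on (M1.crange a \<times> M2.crange b) (\<lambda>z. (cinv A1 a (fst z), cinv A2 b (snd z)))"
      by (rule continuous_on_Pair; rule continuous_on_compose2[OF M1.continuous_cinv] continuous_on_compose2[OF M2.continuous_cinv])
         (auto intro: continuous_on_fst continuous_on_snd continuous_on_id)
    then show "continuous_on (cmap P x ` cdom P x) (cinv P x)"
      unfolding img by (rule continuous_on_eq) (auto simp: x cinv_prod)
    show "cinv P x ` cmap P x ` cdom P x \<subseteq> cdom P x"
      unfolding img by (auto simp: x cinv_prod cdom_prod M1.cinv_in_cdom M2.cinv_in_cdom)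
    show "cinv P x (cmap P x y) = y" if "y \<in> cdom P x" for y
      using that by (auto simp: x cdom_prod cmap_prod cinv_prod M1.cmap_in_crange M2.cmap_in_crange M1.cinv_cmap M2.cinv_cmap)
    show "cmap P x (cinv P x z) = z" if "z \<in> cmap P x ` cdom P x" for z
      using that unfolding img by (auto simp: x cinv_prod cmap_prod M1.cmap_cinv M2.cmap_cinv)
  qed simp
next
  fix x y :: "'m1 \<times> 'm2"
  obtain a b where x: "x = (a, b)" by force
  obtain a' b' where y: "y = (a', b')" by force
  let ?S1 = "cmap A1 a ` (cdom A1 a \<inter> cdom A1 a')" and ?S2 = "cmap A2 b ` (cdom A2 b \<inter> cdom A2 b')"
  have o1: "open ?S1" unfolding Int_commute[of "cdom A1 a"] by (rule M1.open_chart_image[OF M1.open_cdom])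
  have o2: "open ?S2" unfolding Int_commute[of "cdom A2 b"] by (rule M2.open_chart_image[OF M2.open_cdom])
  have o: "open (?S1 \<times> ?S2)" by (rule open_Times[OF o1 o2])
  have img: "cmap P x ` (cdom P x \<inter> cdom P y) = ?S1 \<times> ?S2"
    by (simp add: x y cdom_prod cmap_prod_image Times_Int_Times)
  have s1: "smooth_on (?S1 \<times> ?S2) (\<lambda>z. cmap A1 a' (cinv A1 a (fst z)))"
    by (rule smooth_on_compose[OF o o1 _ M1.smooth_on_transition[OF order_refl] smooth_on_fst[OF o smooth_on_id[OF o]]]) auto
  have s2: "smooth_on (?S1 \<times> ?S2) (\<lambda>z. cmap A2 b' (cinv A2 b (snd z)))"
    by (rule smooth_on_compose[OF o o2 _ M2.smooth_on_transition[OF order_refl] smooth_on_snd[OF o smooth_on_id[OF o]]]) auto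
  show "smooth_on (cmap P x ` (cdom P x \<inter> cdom P y)) (cmap P y \<circ> cinv P x)"
    unfolding img
    by (rule smooth_on_cong[OF o _ smooth_on_Pair[OF o s1 s2]])
       (auto simp: x y cinv_prod cmap_prod M1.cmap_in_crange M2.cmap_in_crange M1.cinv_cmap M2.cinv_cmap)
qed

sublocale PM: smooth_mfd P
  by unfold_locales (rule smooth_manifold_prod)

lemma crange_prod: "PM.crange (a, b) = M1.crange a \<times> M2.crange b"
  by (simp add: PM.crange_def cdom_prod cmap_prod_image M1.crange_def M2.crange_def)

lemma ctrans_prod:
  assumes "p \<in> cdom A1 a" "p \<in> cdom A1 a'" "q \<in> cdom A2 b" "q \<in> cdom A2 b'"
  shows "ctrans P (a, b) (a', b') (p, q) (u, v) = (ctrans A1 a a' p u, ctrans A2 b b' q v)"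
proof -
  let ?z = "cmap P (a, b) (p, q)"
  have z: "?z = (cmap A1 a p, cmap A2 b q)" by (simp add: cmap_prod)
  have f: "((\<lambda>z. cmap A1 a' (cinv A1 a (fst z))) has_derivative (\<lambda>w. ctrans A1 a a' p (fst w))) (at ?z)"
    by (rule has_derivative_compose[OF has_derivative_fst[OF has_derivative_ident]])
       (simp add: z M1.ctrans_has_derivative assms)
  have s: "((\<lambda>z. cmap A2 b' (cinv A2 b (snd z))) has_derivative (\<lambda>w. ctrans A2 b b' q (snd w))) (at ?z)"
    by (rule has_derivative_compose[OF has_derivative_snd[OF has_derivative_ident]])
       (simp add: z M2.ctrans_has_derivative assms)
  have "((\<lambda>z. cmap P (a', b') (cinv P (a, b) z)) has_derivative (\<lambda>w. (ctrans A1 a a' p (fst w), ctrans A2 b b' q (snd w)))) (at ?z)"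
  proof (rule has_derivative_transform_within_open[OF has_derivative_Pair[OF f s] PM.open_crange])
    show "?z \<in> PM.crange (a, b)" by (rule PM.cmap_in_crange) (simp add: cdom_prod assms)
  qed (auto simp: crange_prod cinv_prod cmap_prod)
  then have "fderiv (cmap P (a', b') \<circ> cinv P (a, b)) ?z (u, v) = (ctrans A1 a a' p u, ctrans A2 b b' q v)"
    by (simp add: frechet_derivative_eqI comp_def)
  then show ?thesis by (simp add: ctrans_def)
qed

lemma map_diff_fst: "map_diff P A1 fst y w = fst w"
proof -
  obtain p q where y: "y = (p, q)" by force
  have "((\<lambda>z. cmap A1 p (fst (cinv P y z))) has_derivative fst) (at (cmap P y y))"
    by (rule has_derivative_transform_within_open[OF has_derivative_fst[OF has_derivative_ident] PM.open_crange
          PM.cmap_in_crange[OF PM.centre_in_cdom]])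
       (auto simp: y crange_prod cinv_prod M1.cmap_cinv)
  then show ?thesis by (simp add: map_diff_def y frechet_derivative_eqI comp_def)
qed

lemma map_diff_snd: "map_diff P A2 snd y w = snd w"
proof -
  obtain p q where y: "y = (p, q)" by force
  have "((\<lambda>z. cmap A2 q (snd (cinv P y z))) has_derivative snd) (at (cmap P y y))"
    by (rule has_derivative_transform_within_open[OF has_derivative_snd[OF has_derivative_ident] PM.open_crange
          PM.cmap_in_crange[OF PM.centre_in_cdom]])
       (auto simp: y crange_prod cinv_prod M2.cmap_cinv)
  then show ?thesis by (simp add: map_diff_def y frechet_derivative_eqI comp_def)
qed

text \<open>In product charts the projection is linear, so its kernel is one and the same coordinate
  subspace at every point.\<close>

lemma ker_diff_fst: "ker_diff P A1 fst = (\<lambda>_. {0} \<times> UNIV)"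
  by (auto simp: ker_diff_def map_diff_fst fun_eq_iff)

lemma ker_diff_snd: "ker_diff P A2 snd = (\<lambda>_. UNIV \<times> {0})"
  by (auto simp: ker_diff_def map_diff_snd fun_eq_iff)

lemma coord_field_prod:
  assumes "p \<in> cdom A1 a" "q \<in> cdom A2 b"
  shows "coord_field P (a, b) (u, v) (p, q) = (coord_field A1 a u p, coord_field A2 b v q)"
  by (simp add: coord_field_def ctrans_prod assms M1.centre_in_cdom M2.centre_in_cdom)

end

section \<open>Adapted Weyl structures\<close>

text \<open>One representative of each of the three conformal classes. \<open>\<alpha>\<close> and
  \<open>\<beta>\<close> are given pointwise and may depend on both variables; their smoothness
  follows from that of the metrics.\<close>

locale adapted_metric = product_mfd A1 A2 + W: weyl_metric "prod_atlas A1 A2" D g \<theta> +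
    R1: riemannian_mfd A1 g1 + R2: riemannian_mfd A2 g2
  for A1 :: "('m1::{t2_space, second_countable_topology}, 'a::euclidean_space) atlas"
    and A2 :: "('m2::{t2_space, second_countable_topology}, 'b::euclidean_space) atlas"
    and D g \<theta> g1 g2 +
  fixes \<alpha> \<beta> :: "'m1 \<times> 'm2 \<Rightarrow> real"
  assumes torsion: "torsion_free (prod_atlas A1 A2) D"
    and parallel1: "parallel_distribution (prod_atlas A1 A2) D (\<lambda>_. UNIV \<times> {0})"
    and parallel2: "parallel_distribution (prod_atlas A1 A2) D (\<lambda>_. {0} \<times> UNIV)"
    and metric: "\<And>y u v u' v'. g y (u, v) (u', v') = \<alpha> y * g1 (fst y) u u' + \<beta> y * g2 (snd y) v v'"
    and pos: "\<And>y. \<alpha> y > 0" "\<And>y. \<beta> y > 0"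
begin

context
  fixes a :: 'm1 and b :: 'm2
begin

abbreviation "X \<equiv> PM.crange (a, b)"
abbreviation "ch \<equiv> W.chr (a, b)"

definition \<alpha>c where "\<alpha>c z = \<alpha> (cinv P (a, b) z)"
definition \<beta>c where "\<beta>c z = \<beta> (cinv P (a, b) z)"

text \<open>Another metric in the class of \<open>g\<close> scales \<open>\<alpha>\<close> and
  \<open>\<beta>\<close> alike, so \<open>F\<close> depends only on that class and on
  \<open>g1\<close> and \<open>g2\<close>.\<close>

definition F where "F z = ln (\<beta>c z) - ln (\<alpha>c z)"

definition th where "th z w = \<theta> (cinv P (a, b) z) (coord_field P (a, b) w (cinv P (a, b) z))"

text \<open>The form \<open>B\<close>. Up to sign it is the mixed part of \<open>d\<theta>\<close>,
  whose parts inside each factor vanish.\<close>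

definition mixed where
  "mixed z u v = fderiv (\<lambda>z. fderiv F z (u, 0)) z (0, v)"

definition \<Gamma>1 where "\<Gamma>1 z u y = fst (ch z (u, 0) (y, 0))"
definition \<Gamma>2 where "\<Gamma>2 z v w = snd (ch z (0, v) (0, w))"

lemma crange_fst_snd: "z \<in> X \<Longrightarrow> fst z \<in> M1.crange a \<and> snd z \<in> M2.crange b"
  by (auto simp: crange_prod)

lemma gc_prod:
  assumes "z \<in> X"
  shows "W.gc (a, b) z (u, v) (u', v') = \<alpha>c z * R1.gc a (fst z) u u' + \<beta>c z * R2.gc b (snd z) v v'"
proof -
  obtain z1 z2 where z: "z = (z1, z2)" "z1 \<in> M1.crange a" "z2 \<in> M2.crange b"
    using assms by (auto simp: crange_prod)
  show ?thesis
    by (simp add: W.gc_def R1.gc_def R2.gc_def \<alpha>c_def \<beta>c_def z cinv_prod coord_field_prod M1.cinv_in_cdom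
        M2.cinv_in_cdom metric)
qed

lemma \<alpha>c_pos: "\<alpha>c z > 0" and \<beta>c_pos: "\<beta>c z > 0"
  by (simp_all add: \<alpha>c_def \<beta>c_def pos)

lemma R1_pos: "z1 \<in> M1.crange a \<Longrightarrow> u \<noteq> 0 \<Longrightarrow> R1.gc a z1 u u > 0"
  by (rule inner_form_pos[OF R1.inner_form_gc])

lemma R2_pos: "z2 \<in> M2.crange b \<Longrightarrow> v \<noteq> 0 \<Longrightarrow> R2.gc b z2 v v > 0"
  by (rule inner_form_pos[OF R2.inner_form_gc])

section \<open>Smoothness of the conformal factors\<close>

lemma smooth_gc_fst: "smooth_on X (\<lambda>z. R1.gc a (fst z) u u')"
  by (rule smooth_on_compose[OF PM.open_crange M1.open_crange _ R1.smooth_gc smooth_on_fst[OF PM.open_crange smooth_on_id[OF PM.open_crange]]])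
     (simp add: crange_fst_snd)

lemma smooth_gc_snd: "smooth_on X (\<lambda>z. R2.gc b (snd z) v v')"
  by (rule smooth_on_compose[OF PM.open_crange M2.open_crange _ R2.smooth_gc smooth_on_snd[OF PM.open_crange smooth_on_id[OF PM.open_crange]]])
     (simp add: crange_fst_snd)

lemma smooth_\<alpha>c: "smooth_on X \<alpha>c"
proof -
  obtain i :: 'a where i: "i \<in> Basis" using nonempty_Basis by blast
  have p: "R1.gc a (fst z) i i > 0" if "z \<in> X" for z
    by (rule R1_pos) (use crange_fst_snd[OF that] i in auto)
  \<comment> \<open>On one nonzero vector \<open>i\<close> the metric identity exhibits
    \<open>\<alpha>c\<close> as a quotient of smooth functions with positive denominator.\<close>
  have "smooth_on X (\<lambda>z. W.gc (a, b) z (i, 0) (i, 0) / R1.gc a (fst z) i i)"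
    by (rule smooth_on_divide[OF PM.open_crange W.smooth_gc smooth_gc_fst p])
  then show ?thesis
  proof (rule smooth_on_cong[OF PM.open_crange, rotated])
    fix z assume z: "z \<in> X"
    show "W.gc (a, b) z (i, 0) (i, 0) / R1.gc a (fst z) i i = \<alpha>c z"
      using p[OF z] crange_fst_snd[OF z]
      by (simp add: gc_prod[OF z] bilinear_lzero[OF inner_form_bilinear[OF R2.inner_form_gc]])
  qed
qed

lemma smooth_\<beta>c: "smooth_on X \<beta>c"
proof -
  obtain i :: 'b where i: "i \<in> Basis" using nonempty_Basis by blast
  have p: "R2.gc b (snd z) i i > 0" if "z \<in> X" for z
    by (rule R2_pos) (use crange_fst_snd[OF that] i in auto)
  have "smooth_on X (\<lambda>z. W.gc (a, b) z (0, i) (0, i) / R2.gc b (snd z) i i)"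
    by (rule smooth_on_divide[OF PM.open_crange W.smooth_gc smooth_gc_snd p])
  then show ?thesis
  proof (rule smooth_on_cong[OF PM.open_crange, rotated])
    fix z assume z: "z \<in> X"
    show "W.gc (a, b) z (0, i) (0, i) / R2.gc b (snd z) i i = \<beta>c z"
      using p[OF z] crange_fst_snd[OF z]
      by (simp add: gc_prod[OF z] bilinear_lzero[OF inner_form_bilinear[OF R1.inner_form_gc]])
  qed
qed

lemma d\<alpha>c: "z \<in> X \<Longrightarrow> (\<alpha>c has_derivative fderiv \<alpha>c z) (at z)"
  and d\<beta>c: "z \<in> X \<Longrightarrow> (\<beta>c has_derivative fderiv \<beta>c z) (at z)"
  by (rule smooth_on_has_derivative[OF smooth_\<alpha>c] smooth_on_has_derivative[OF smooth_\<beta>c]; assumption)+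

lemma smooth_F: "smooth_on X F"
  unfolding F_def
proof (rule smooth_on_diff[OF PM.open_crange])
  show "smooth_on X (\<lambda>z. ln (\<beta>c z))"
    by (rule smooth_on_compose[OF PM.open_crange open_greaterThan _ smooth_on_ln smooth_\<beta>c]) (simp add: \<beta>c_pos)
  show "smooth_on X (\<lambda>z. ln (\<alpha>c z))"
    by (rule smooth_on_compose[OF PM.open_crange open_greaterThan _ smooth_on_ln smooth_\<alpha>c]) (simp add: \<alpha>c_pos)
qed

lemma dln\<alpha>c: "z \<in> X \<Longrightarrow> ((\<lambda>z. ln (\<alpha>c z)) has_derivative (\<lambda>w. fderiv \<alpha>c z w / \<alpha>c z)) (at z)"
  by (rule has_derivative_eq_rhs[OF has_derivative_ln[OF \<alpha>c_pos d\<alpha>c]]) (auto simp: field_simps)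

lemma dln\<beta>c: "z \<in> X \<Longrightarrow> ((\<lambda>z. ln (\<beta>c z)) has_derivative (\<lambda>w. fderiv \<beta>c z w / \<beta>c z)) (at z)"
  by (rule has_derivative_eq_rhs[OF has_derivative_ln[OF \<beta>c_pos d\<beta>c]]) (auto simp: field_simps)

lemma dF: "z \<in> X \<Longrightarrow> fderiv F z w =
    fderiv \<beta>c z w / \<beta>c z - fderiv \<alpha>c z w / \<alpha>c z"
  unfolding F_def[abs_def]
  by (rule frechet_derivative_eqI[OF has_derivative_diff[OF dln\<beta>c dln\<alpha>c]])

text \<open>A coordinate field with values in one factor is a section of that parallel distribution,
  so its covariant derivatives stay in it.\<close>

lemma ch_parallel:
  assumes "z \<in> X"
  shows "snd (ch z v (w, 0)) = 0" "fst (ch z v (0, w')) = 0"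
proof -
  obtain y1 y2 where y: "y1 \<in> cdom A1 a" "y2 \<in> cdom A2 b" "z = cmap P (a, b) (y1, y2)"
    using assms by (auto simp: PM.crange_def cdom_prod)
  let ?y = "(y1, y2)"
  have yd: "?y \<in> cdom P (a, b)" using y by (simp add: cdom_prod)
  have ct: "ctrans P ?y (a, b) ?y (u, v) = (ctrans A1 y1 a y1 u, ctrans A2 y2 b y2 v)" for u v
    by (rule ctrans_prod) (simp_all add: y M1.centre_in_cdom M2.centre_in_cdom)
  have l: "linear (ctrans A1 y1 a y1)" "linear (ctrans A2 y2 b y2)"
    by (rule M1.linear_ctrans[OF M1.centre_in_cdom y(1)] M2.linear_ctrans[OF M2.centre_in_cdom y(2)])+
  have l': "linear (ctrans A1 a p p)" if "p \<in> cdom A1 a" for p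
    by (rule M1.linear_ctrans[OF that M1.centre_in_cdom])
  have l'': "linear (ctrans A2 b p p)" if "p \<in> cdom A2 b" for p
    by (rule M2.linear_ctrans[OF that M2.centre_in_cdom])
  have "D ?y (coord_field P (a, b) v ?y) (coord_field P (a, b) (w, 0)) \<in> UNIV \<times> {0}"
  proof -
    have "\<forall>p\<in>cdom P (a, b). coord_field P (a, b) (w, 0) p \<in> UNIV \<times> {0}"
      using linear_0[OF l''] by (auto simp: cdom_prod coord_field_prod) (simp add: coord_field_def)
    then show ?thesis
      using parallel1 PM.open_cdom[of "(a, b)"] yd W.smooth_coord[of "(a, b)" "(w, 0)"]
      unfolding parallel_distribution_def by blast
  qed
  then show "snd (ch z v (w, 0)) = 0"
    by (auto simp: y(3) W.chr_cmap[OF yd] ct linear_0[OF l(2)])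
  have "D ?y (coord_field P (a, b) v ?y) (coord_field P (a, b) (0, w')) \<in> {0} \<times> UNIV"
  proof -
    have "\<forall>p\<in>cdom P (a, b). coord_field P (a, b) (0, w') p \<in> {0} \<times> UNIV"
      using linear_0[OF l'] by (auto simp: cdom_prod coord_field_prod) (simp add: coord_field_def)
    then show ?thesis
      using parallel2 PM.open_cdom[of "(a, b)"] yd W.smooth_coord[of "(a, b)" "(0, w')"]
      unfolding parallel_distribution_def by blast
  qed
  then show "fst (ch z v (0, w')) = 0"
    by (auto simp: y(3) W.chr_cmap[OF yd] ct linear_0[OF l(1)])
qed

text \<open>By symmetry the value on one vector from each factor lies in both factors, so it
  vanishes and the symbols are block diagonal.\<close>

lemma ch_prod:
  assumes z: "z \<in> X"
  shows "ch z (u, v) (y, w) = (\<Gamma>1 z u y, \<Gamma>2 z v w)"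
proof -
  note B = W.bilinear_chr[OF z]
  note s = W.chr_sym[OF torsion z]
  have 1: "ch z (u, 0) (0, w) = 0"
    using ch_parallel(2)[OF z, of "(u, 0)" w] ch_parallel(1)[OF z, of "(0, w)" u] s[of "(u, 0)" "(0, w)"]
    by (simp add: prod_eq_iff)
  have 2: "ch z (0, v) (y, 0) = 0"
    using ch_parallel(1)[OF z, of "(0, v)" y] ch_parallel(2)[OF z, of "(y, 0)" v] s[of "(0, v)" "(y, 0)"]
    by (simp add: prod_eq_iff)
  have 3: "ch z (u, 0) (y, 0) = (\<Gamma>1 z u y, 0)" "ch z (0, v) (0, w) = (0, \<Gamma>2 z v w)"
    using ch_parallel[OF z] by (simp_all add: \<Gamma>1_def \<Gamma>2_def prod_eq_iff)
  have "ch z (u, v) (y, w) = ch z ((u, 0) + (0, v)) ((y, 0) + (0, w))" by simp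
  also have "\<dots> = ch z (u, 0) (y, 0) + ch z (u, 0) (0, w) + (ch z (0, v) (y, 0) + ch z (0, v) (0, w))"
    by (simp only: bilinear_ladd[OF B] bilinear_radd[OF B] add_ac)
  finally show ?thesis by (simp add: 1 2 3)
qed

lemma \<Gamma>_sym: "z \<in> X \<Longrightarrow> \<Gamma>1 z u y = \<Gamma>1 z y u" "z \<in> X \<Longrightarrow> \<Gamma>2 z v w = \<Gamma>2 z w v"
  by (simp_all add: \<Gamma>1_def \<Gamma>2_def W.chr_sym[OF torsion, of z "(a, b)" "(u, 0)"]
      W.chr_sym[OF torsion, of z "(a, b)" "(0, v)"])

lemma \<Gamma>_zero: "z \<in> X \<Longrightarrow> \<Gamma>1 z 0 y = 0" "z \<in> X \<Longrightarrow> \<Gamma>1 z u 0 = 0"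
  "z \<in> X \<Longrightarrow> \<Gamma>2 z 0 w = 0" "z \<in> X \<Longrightarrow> \<Gamma>2 z v 0 = 0"
  using bilinear_lzero[OF W.bilinear_chr] bilinear_rzero[OF W.bilinear_chr]
  by (simp_all add: \<Gamma>1_def \<Gamma>2_def zero_prod_def[symmetric])

lemma smooth_\<Gamma>1: "smooth_on X (\<lambda>z. \<Gamma>1 z u y)"
  unfolding \<Gamma>1_def by (rule smooth_on_fst[OF PM.open_crange W.smooth_chr])

lemma smooth_\<Gamma>2: "smooth_on X (\<lambda>z. \<Gamma>2 z v w)"
  unfolding \<Gamma>2_def by (rule smooth_on_snd[OF PM.open_crange W.smooth_chr])

section \<open>The form \<theta> in terms of the conformal factors\<close>

lemma linear_th:
  assumes z: "z \<in> X" shows "linear (th z)"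
proof -
  obtain i :: 'a where i: "i \<in> Basis" using nonempty_Basis by blast
  let ?w = "(i, 0 :: 'b)"
  have "W.gc (a, b) z ?w ?w > 0"
    by (rule inner_form_pos[OF W.inner_form_gc[OF z]]) (use i in \<open>auto simp: zero_prod_def\<close>)
  \<comment> \<open>\<open>\<theta>\<close> is a bare function in the compatibility equation. On a
    nonzero vector the equation can be solved for it, and the solution is linear in
    \<open>v\<close>.\<close>
  then have th: "th z v = (1 / W.gc (a, b) z ?w ?w) * (fderiv (\<lambda>z. W.gc (a, b) z ?w ?w) z v
      - W.gc (a, b) z (ch z v ?w) ?w - W.gc (a, b) z ?w (ch z v ?w))" for v
    using W.compat_chart[OF z, of ?w ?w v] by (simp add: th_def field_simps)
  have l: "linear (fderiv (\<lambda>z. W.gc (a, b) z ?w ?w) z)"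
    by (rule smooth_on_linear_derivative[OF W.smooth_gc z])
  show ?thesis
    by (rule linearI)
       (simp_all add: th linear_add[OF l] linear_cmul[OF l] bilinear_ladd[OF W.bilinear_chr[OF z]]
         bilinear_lmul[OF W.bilinear_chr[OF z]] inner_form_simps[OF W.inner_form_gc[OF z]] algebra_simps)
qed

lemma compat_fst:
  assumes z: "z \<in> X"
  shows "\<alpha>c z * fderiv (\<lambda>z. R1.gc a z y y') (fst z) u
      + fderiv \<alpha>c z (u, v) * R1.gc a (fst z) y y'
    = th z (u, v) * (\<alpha>c z * R1.gc a (fst z) y y') + \<alpha>c z * R1.gc a (fst z) (\<Gamma>1 z u y) y'
      + \<alpha>c z * R1.gc a (fst z) y (\<Gamma>1 z u y')"
proof -
  have f: "fst z \<in> M1.crange a" "snd z \<in> M2.crange b" using crange_fst_snd[OF z] by auto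
  note z2 = bilinear_lzero[OF inner_form_bilinear[OF R2.inner_form_gc[OF f(2)]]]
    bilinear_rzero[OF inner_form_bilinear[OF R2.inner_form_gc[OF f(2)]]]
  have 1: "((\<lambda>z. R1.gc a (fst z) y y') has_derivative
      (\<lambda>w. fderiv (\<lambda>z. R1.gc a z y y') (fst z) (fst w))) (at z)"
    by (rule has_derivative_compose[OF has_derivative_fst[OF has_derivative_ident]
        smooth_on_has_derivative[OF R1.smooth_gc f(1)]])
  have "((\<lambda>z. W.gc (a, b) z (y, 0) (y', 0)) has_derivative
      (\<lambda>w. \<alpha>c z * fderiv (\<lambda>z. R1.gc a z y y') (fst z) (fst w)
      + fderiv \<alpha>c z w * R1.gc a (fst z) y y')) (at z)"
  proof (rule has_derivative_transform_within_open[OF has_derivative_mult[OF d\<alpha>c[OF z] 1] PM.open_crange z])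
    fix p assume p: "p \<in> X"
    show "\<alpha>c p * R1.gc a (fst p) y y' = W.gc (a, b) p (y, 0) (y', 0)"
      using crange_fst_snd[OF p]
      by (simp add: gc_prod[OF p] bilinear_lzero[OF inner_form_bilinear[OF R2.inner_form_gc]])
  qed
  from frechet_derivative_eqI[OF this, of "(u, v)"] W.compat_chart[OF z, of "(y, 0)" "(y', 0)" "(u, v)"]
  show ?thesis by (simp add: gc_prod[OF z] ch_prod[OF z] z2 \<Gamma>_zero[OF z] th_def)
qed

lemma compat_snd:
  assumes z: "z \<in> X"
  shows "\<beta>c z * fderiv (\<lambda>z. R2.gc b z y y') (snd z) v
      + fderiv \<beta>c z (u, v) * R2.gc b (snd z) y y'
    = th z (u, v) * (\<beta>c z * R2.gc b (snd z) y y') + \<beta>c z * R2.gc b (snd z) (\<Gamma>2 z v y) y'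
      + \<beta>c z * R2.gc b (snd z) y (\<Gamma>2 z v y')"
proof -
  have f: "fst z \<in> M1.crange a" "snd z \<in> M2.crange b" using crange_fst_snd[OF z] by auto
  note z2 = bilinear_lzero[OF inner_form_bilinear[OF R1.inner_form_gc[OF f(1)]]]
    bilinear_rzero[OF inner_form_bilinear[OF R1.inner_form_gc[OF f(1)]]]
  have 1: "((\<lambda>z. R2.gc b (snd z) y y') has_derivative
      (\<lambda>w. fderiv (\<lambda>z. R2.gc b z y y') (snd z) (snd w))) (at z)"
    by (rule has_derivative_compose[OF has_derivative_snd[OF has_derivative_ident]
        smooth_on_has_derivative[OF R2.smooth_gc f(2)]])
  have "((\<lambda>z. W.gc (a, b) z (0, y) (0, y')) has_derivative
      (\<lambda>w. \<beta>c z * fderiv (\<lambda>z. R2.gc b z y y') (snd z) (snd w)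
      + fderiv \<beta>c z w * R2.gc b (snd z) y y')) (at z)"
  proof (rule has_derivative_transform_within_open[OF has_derivative_mult[OF d\<beta>c[OF z] 1] PM.open_crange z])
    fix p assume p: "p \<in> X"
    show "\<beta>c p * R2.gc b (snd p) y y' = W.gc (a, b) p (0, y) (0, y')"
      using crange_fst_snd[OF p]
      by (simp add: gc_prod[OF p] bilinear_lzero[OF inner_form_bilinear[OF R1.inner_form_gc]])
  qed
  from frechet_derivative_eqI[OF this, of "(u, v)"] W.compat_chart[OF z, of "(0, y)" "(0, y')" "(u, v)"]
  show ?thesis by (simp add: gc_prod[OF z] ch_prod[OF z] z2 \<Gamma>_zero[OF z] th_def)
qed

text \<open>Along the second factor \<open>g1\<close> does not change and the first block of the
  symbols is zero, so only the derivative of \<open>\<alpha>\<close> is left in the compatibility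
  equation of the first factor.\<close>

lemma th_snd:
  assumes z: "z \<in> X"
  shows "th z (0, v) = fderiv \<alpha>c z (0, v) / \<alpha>c z"
proof -
  have f: "fst z \<in> M1.crange a" using crange_fst_snd[OF z] by auto
  obtain i :: 'a where i: "i \<in> Basis" using nonempty_Basis by blast
  have p: "R1.gc a (fst z) i i > 0" by (rule R1_pos[OF f]) (use i in auto)
  have "fderiv (\<lambda>z. R1.gc a z i i) (fst z) 0 = 0"
    by (rule linear_0[OF smooth_on_linear_derivative[OF R1.smooth_gc f]])
  then have "fderiv \<alpha>c z (0, v) * R1.gc a (fst z) i i = th z (0, v) * \<alpha>c z * R1.gc a (fst z) i i"
    using compat_fst[OF z, of i i 0 v]
    by (simp add: \<Gamma>_zero[OF z] inner_form_simps[OF R1.inner_form_gc[OF f]])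
  then show ?thesis using p \<alpha>c_pos[of z] by (simp add: field_simps)
qed

lemma th_fst:
  assumes z: "z \<in> X"
  shows "th z (u, 0) = fderiv \<beta>c z (u, 0) / \<beta>c z"
proof -
  have f: "snd z \<in> M2.crange b" using crange_fst_snd[OF z] by auto
  obtain i :: 'b where i: "i \<in> Basis" using nonempty_Basis by blast
  have p: "R2.gc b (snd z) i i > 0" by (rule R2_pos[OF f]) (use i in auto)
  have "fderiv (\<lambda>z. R2.gc b z i i) (snd z) 0 = 0"
    by (rule linear_0[OF smooth_on_linear_derivative[OF R2.smooth_gc f]])
  then have "fderiv \<beta>c z (u, 0) * R2.gc b (snd z) i i = th z (u, 0) * \<beta>c z * R2.gc b (snd z) i i"
    using compat_snd[OF z, of i i 0 u]
    by (simp add: \<Gamma>_zero[OF z] inner_form_simps[OF R2.inner_form_gc[OF f]])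
  then show ?thesis using p \<beta>c_pos[of z] by (simp add: field_simps)
qed

text \<open>On the slices of the two factors, \<open>D\<close> induces Weyl connections of the constant conformal
  classes of \<open>g1\<close> and \<open>g2\<close>, with Lee forms \<open>dF\<close> and \<open>- dF\<close>.\<close>

lemma slice_fst:
  assumes z: "z \<in> X"
  shows "fderiv (\<lambda>z. R1.gc a z y y') (fst z) u = fderiv F z (u, 0) * R1.gc a (fst z) y y'
      + R1.gc a (fst z) (\<Gamma>1 z u y) y' + R1.gc a (fst z) y (\<Gamma>1 z u y')"
proof -
  have "\<alpha>c z * fderiv (\<lambda>z. R1.gc a z y y') (fst z) u =
    \<alpha>c z * (fderiv F z (u, 0) * R1.gc a (fst z) y y'
      + R1.gc a (fst z) (\<Gamma>1 z u y) y' + R1.gc a (fst z) y (\<Gamma>1 z u y'))"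
    using compat_fst[OF z, of y y' u 0] \<alpha>c_pos[of z]
    by (simp add: dF[OF z] th_fst[OF z] algebra_simps)
  then show ?thesis using \<alpha>c_pos[of z] by simp
qed

lemma slice_snd:
  assumes z: "z \<in> X"
  shows "fderiv (\<lambda>z. R2.gc b z y y') (snd z) v = - fderiv F z (0, v) * R2.gc b (snd z) y y'
      + R2.gc b (snd z) (\<Gamma>2 z v y) y' + R2.gc b (snd z) y (\<Gamma>2 z v y')"
proof -
  have "\<beta>c z * fderiv (\<lambda>z. R2.gc b z y y') (snd z) v =
    \<beta>c z * (- fderiv F z (0, v) * R2.gc b (snd z) y y'
      + R2.gc b (snd z) (\<Gamma>2 z v y) y' + R2.gc b (snd z) y (\<Gamma>2 z v y'))"
    using compat_snd[OF z, of y y' v 0] \<beta>c_pos[of z]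
    by (simp add: dF[OF z] th_snd[OF z] algebra_simps)
  then show ?thesis using \<beta>c_pos[of z] by simp
qed

section \<open>Mixed second derivatives as curvature\<close>

lemma mixed_sym: "z \<in> X \<Longrightarrow> fderiv (\<lambda>z. fderiv F z (0, v)) z (u, 0) = mixed z u v"
  unfolding mixed_def by (rule mixed_derivatives_commute[OF PM.open_crange smooth_F])

lemma segment_in_X:
  assumes "z \<in> X"
  obtains d where "d > 0" "\<And>s. \<bar>s\<bar> < d \<Longrightarrow> z + s *\<^sub>R w \<in> X"
proof -
  obtain r where r: "r > 0" "ball z r \<subseteq> X" using PM.open_crange assms openE by blast
  define d where "d = r / (norm w + 1)"
  have n: "norm w + 1 > 0" by (smt (verit) norm_ge_zero)
  show ?thesis
  proof (rule that)
    show "d > 0" using r n by (simp add: d_def)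
    fix s assume "\<bar>s\<bar> < d"
    then have "\<bar>s\<bar> * (norm w + 1) < r" using n by (simp add: d_def field_simps)
    moreover have "\<bar>s\<bar> * norm w \<le> \<bar>s\<bar> * (norm w + 1)" by (intro mult_left_mono) auto
    ultimately have "dist z (z + s *\<^sub>R w) < r" by (simp add: dist_norm)
    then show "z + s *\<^sub>R w \<in> X" using r(2) by auto
  qed
qed

text \<open>In the slice equation at \<open>z + s *\<^sub>R (0, v)\<close> the metric
  \<open>g1\<close> and its derivative stay at \<open>fst z\<close>. Only the symbols and the Lee
  form \<open>dF\<close> vary with \<open>s\<close>, and the latter has the derivative
  \<open>mixed z u v\<close>.\<close>

lemma variation_fst:
  assumes z: "z \<in> X"
  shows "2 * R1.gc a (fst z) (fderiv (\<lambda>z. \<Gamma>1 z u y) z (0, v)) y' =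
    - mixed z u v * R1.gc a (fst z) y y' - mixed z y v * R1.gc a (fst z) u y' + mixed z y' v * R1.gc a (fst z) u y"
proof -
  obtain d where d: "d > 0" "\<And>s. \<bar>s\<bar> < d \<Longrightarrow> z + s *\<^sub>R (0, v) \<in> X" using segment_in_X[OF z] by metis
  have f: "fst z \<in> M1.crange a" using crange_fst_snd[OF z] by auto
  show ?thesis
  proof (rule weyl_connection_variation[OF R1.inner_form_gc[OF f] d(1),
        where \<Gamma> = "\<lambda>s. \<Gamma>1 (z + s *\<^sub>R (0, v))" and \<phi> = "\<lambda>s u. fderiv F (z + s *\<^sub>R (0, v)) (u, 0)"
          and K = "\<lambda>u y y'. fderiv (\<lambda>z. R1.gc a z y y') (fst z) u"
          and \<tau> = "\<lambda>u. mixed z u v" and T = "\<lambda>u y. fderiv (\<lambda>z. \<Gamma>1 z u y) z (0, v)"])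
    show "\<Gamma>1 (z + s *\<^sub>R (0, v)) u y = \<Gamma>1 (z + s *\<^sub>R (0, v)) y u" if "\<bar>s\<bar> < d" for s u y
      by (rule \<Gamma>_sym(1)[OF d(2)[OF that]])
    show "fderiv (\<lambda>z. R1.gc a z y y') (fst z) u =
        fderiv F (z + s *\<^sub>R (0, v)) (u, 0) * R1.gc a (fst z) y y'
        + R1.gc a (fst z) (\<Gamma>1 (z + s *\<^sub>R (0, v)) u y) y' + R1.gc a (fst z) y (\<Gamma>1 (z + s *\<^sub>R (0, v)) u y')"
      if "\<bar>s\<bar> < d" for s u y y'
      using slice_fst[OF d(2)[OF that], of y y' u] by simp
    show "((\<lambda>s. fderiv F (z + s *\<^sub>R (0, v)) (u, 0)) has_vector_derivative mixed z u v) (at 0)" for u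
      unfolding mixed_def
      by (rule has_vector_derivative_along_line)
         (simp add: smooth_on_has_derivative[OF smooth_on_derivative[OF smooth_F] z] zero_prod_def[symmetric])
    show "((\<lambda>s. \<Gamma>1 (z + s *\<^sub>R (0, v)) u y) has_vector_derivative fderiv (\<lambda>z. \<Gamma>1 z u y) z (0, v)) (at 0)" for u y
      by (rule has_vector_derivative_along_line)
         (simp add: smooth_on_has_derivative[OF smooth_\<Gamma>1 z] zero_prod_def[symmetric])
  qed
qed

text \<open>The Lee form is now \<open>- dF\<close>, which reverses all signs compared with the
  first factor.\<close>

lemma variation_snd:
  assumes z: "z \<in> X"
  shows "2 * R2.gc b (snd z) (fderiv (\<lambda>z. \<Gamma>2 z v w) z (u, 0)) w' =
    mixed z u v * R2.gc b (snd z) w w' + mixed z u w * R2.gc b (snd z) v w' - mixed z u w' * R2.gc b (snd z) v w"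
proof -
  obtain d where d: "d > 0" "\<And>s. \<bar>s\<bar> < d \<Longrightarrow> z + s *\<^sub>R (u, 0) \<in> X" using segment_in_X[OF z] by metis
  have f: "snd z \<in> M2.crange b" using crange_fst_snd[OF z] by auto
  have "2 * R2.gc b (snd z) (fderiv (\<lambda>z. \<Gamma>2 z v w) z (u, 0)) w' =
    - (- mixed z u v) * R2.gc b (snd z) w w' - (- mixed z u w) * R2.gc b (snd z) v w' + (- mixed z u w') * R2.gc b (snd z) v w"
  proof (rule weyl_connection_variation[OF R2.inner_form_gc[OF f] d(1),
        where \<Gamma> = "\<lambda>s. \<Gamma>2 (z + s *\<^sub>R (u, 0))" and \<phi> = "\<lambda>s v. - fderiv F (z + s *\<^sub>R (u, 0)) (0, v)"
          and K = "\<lambda>v y y'. fderiv (\<lambda>z. R2.gc b z y y') (snd z) v"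
          and \<tau> = "\<lambda>v. - mixed z u v" and T = "\<lambda>v w. fderiv (\<lambda>z. \<Gamma>2 z v w) z (u, 0)"])
    show "\<Gamma>2 (z + s *\<^sub>R (u, 0)) v w = \<Gamma>2 (z + s *\<^sub>R (u, 0)) w v" if "\<bar>s\<bar> < d" for s v w
      by (rule \<Gamma>_sym(2)[OF d(2)[OF that]])
    show "fderiv (\<lambda>z. R2.gc b z y y') (snd z) v =
        - fderiv F (z + s *\<^sub>R (u, 0)) (0, v) * R2.gc b (snd z) y y'
        + R2.gc b (snd z) (\<Gamma>2 (z + s *\<^sub>R (u, 0)) v y) y' + R2.gc b (snd z) y (\<Gamma>2 (z + s *\<^sub>R (u, 0)) v y')"
      if "\<bar>s\<bar> < d" for s v y y'
      using slice_snd[OF d(2)[OF that], of y y' v] by simp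
    show "((\<lambda>s. - fderiv F (z + s *\<^sub>R (u, 0)) (0, v)) has_vector_derivative - mixed z u v) (at 0)" for v
      unfolding mixed_sym[OF z, symmetric]
      by (rule has_vector_derivative_minus, rule has_vector_derivative_along_line)
         (simp add: smooth_on_has_derivative[OF smooth_on_derivative[OF smooth_F] z] zero_prod_def[symmetric])
    show "((\<lambda>s. \<Gamma>2 (z + s *\<^sub>R (u, 0)) v w) has_vector_derivative fderiv (\<lambda>z. \<Gamma>2 z v w) z (u, 0)) (at 0)" for v w
      by (rule has_vector_derivative_along_line)
         (simp add: smooth_on_has_derivative[OF smooth_\<Gamma>2 z] zero_prod_def[symmetric])
  qed
  then show ?thesis by simp
qed

text \<open>Linearity in the first argument needs the exchange of the two differentiations.\<close>

lemma bilinear_mixed: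
  assumes z: "z \<in> X" shows "bilinear (mixed z)"
proof -
  have l: "linear (\<lambda>v. mixed z u v)" for u
  proof -
    have "linear (fderiv (\<lambda>z. fderiv F z (u, 0)) z)"
      by (rule smooth_on_linear_derivative[OF smooth_on_derivative[OF smooth_F] z])
    from linear_compose[OF _ this, of "\<lambda>v. (0, v)"] show ?thesis
      by (simp add: comp_def mixed_def linear_iff)
  qed
  have r: "linear (\<lambda>u. mixed z u v)" for v
  proof -
    have "linear (fderiv (\<lambda>z. fderiv F z (0, v)) z)"
      by (rule smooth_on_linear_derivative[OF smooth_on_derivative[OF smooth_F] z])
    from linear_compose[OF _ this, of "\<lambda>u. (u, 0)"] show ?thesis
      by (simp add: comp_def mixed_sym[OF z] linear_iff)
  qed
  show ?thesis unfolding bilinear_def using l r by simp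
qed

text \<open>The curvature for one direction from each factor. The symbols being block diagonal,
  every product of them has a zero argument, and only the derivative of each block along the other
  factor survives, with opposite signs.\<close>

lemma curvature_invariant_prod:
  assumes E: "parallel_distribution P D E" and y: "y \<in> cdom P (a, b)" and z: "z = cmap P (a, b) y"
    and w: "(y1, w2) \<in> ctrans P y (a, b) y ` E y"
  shows "(- fderiv (\<lambda>z. \<Gamma>1 z u y1) z (0, v), fderiv (\<lambda>z. \<Gamma>2 z v w2) z (u, 0))
    \<in> ctrans P y (a, b) y ` E y"
proof -
  have zX: "z \<in> X" unfolding z by (rule PM.cmap_in_crange[OF y])
  have 1: "fderiv (\<lambda>z. ch z (0, v) (y1, w2)) z (u, 0) = (0, fderiv (\<lambda>z. \<Gamma>2 z v w2) z (u, 0))"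
  proof (rule frechet_derivative_eqI[where f' = "\<lambda>q. (0, fderiv (\<lambda>z. \<Gamma>2 z v w2) z q)"])
    show "((\<lambda>z. ch z (0, v) (y1, w2)) has_derivative (\<lambda>q. (0, fderiv (\<lambda>z. \<Gamma>2 z v w2) z q))) (at z)"
      by (rule has_derivative_transform_within_open[OF has_derivative_Pair[OF has_derivative_const
            smooth_on_has_derivative[OF smooth_\<Gamma>2 zX]] PM.open_crange zX])
         (simp add: ch_prod \<Gamma>_zero)
  qed
  have 2: "fderiv (\<lambda>z. ch z (u, 0) (y1, w2)) z (0, v) = (fderiv (\<lambda>z. \<Gamma>1 z u y1) z (0, v), 0)"
  proof (rule frechet_derivative_eqI[where f' = "\<lambda>q. (fderiv (\<lambda>z. \<Gamma>1 z u y1) z q, 0)"])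
    show "((\<lambda>z. ch z (u, 0) (y1, w2)) has_derivative (\<lambda>q. (fderiv (\<lambda>z. \<Gamma>1 z u y1) z q, 0))) (at z)"
      by (rule has_derivative_transform_within_open[OF has_derivative_Pair[OF
            smooth_on_has_derivative[OF smooth_\<Gamma>1 zX] has_derivative_const] PM.open_crange zX])
         (simp add: ch_prod \<Gamma>_zero)
  qed
  show ?thesis
    using W.curvature_invariant[OF E y z w, of "(0, v)" "(u, 0)"]
    by (simp add: 1 2 ch_prod[OF zX] \<Gamma>_zero[OF zX])
qed

lemma parallel_distribution_point:
  assumes E: "parallel_distribution P D E" and y: "y \<in> cdom P (a, b)" and z: "z = cmap P (a, b) y"
    and nz: "mixed z u0 v0 \<noteq> 0" and dims: "DIM('a) + DIM('b) \<noteq> 2" "DIM('a) + DIM('b) \<noteq> 4"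
  shows "E y \<in> {{0}, UNIV, UNIV \<times> {0}, {0} \<times> UNIV}"
proof -
  have zX: "z \<in> X" unfolding z by (rule PM.cmap_in_crange[OF y])
  have f: "fst z \<in> M1.crange a" "snd z \<in> M2.crange b" using crange_fst_snd[OF zX] by auto
  define G1 where "G1 = R1.gc a (fst z)"
  define G2 where "G2 = R2.gc b (snd z)"
  have G: "inner_form G1" "inner_form G2"
    unfolding G1_def G2_def by (rule R1.inner_form_gc[OF f(1)] R2.inner_form_gc[OF f(2)])+
  have B: "bilinear (mixed z)" by (rule bilinear_mixed[OF zX])
  then have B': "bilinear (\<lambda>v u. mixed z u v)" by (simp add: bilinear_def)
  obtain \<beta>' where \<beta>': "\<And>v y. G1 (\<beta>' v) y = mixed z y v"
    by (rule inner_form_represent[OF G(1) B']) blast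
  obtain \<gamma>' where \<gamma>': "\<And>u w. G2 (\<gamma>' u) w = mixed z u w"
    by (rule inner_form_represent[OF G(2) B]) blast
  define J where "J = ctrans P y (a, b) y"
  have lJ: "linear J" unfolding J_def by (rule PM.linear_ctrans[OF PM.centre_in_cdom y])
  define H where "H = J ` E y"
  have H: "subspace H"
    unfolding H_def by (rule linear_subspace_image[OF lJ parallel_distribution_subspace[OF E]])
  have inv: "(mixed z y1 v *\<^sub>R u - G1 u y1 *\<^sub>R \<beta>' v, mixed z u w2 *\<^sub>R v - G2 v w2 *\<^sub>R \<gamma>' u) \<in> H"
    if "(y1, w2) \<in> H" for u v y1 w2
  proof -
    define T1 where "T1 = fderiv (\<lambda>z. \<Gamma>1 z u y1) z (0, v)"
    define T2 where "T2 = fderiv (\<lambda>z. \<Gamma>2 z v w2) z (u, 0)"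
    have T: "(- T1, T2) \<in> H"
      using curvature_invariant_prod[OF E y z, of y1 w2 u v] that by (simp add: H_def J_def T1_def T2_def)
    have "2 *\<^sub>R (- T1) = mixed z u v *\<^sub>R y1 + (mixed z y1 v *\<^sub>R u - G1 u y1 *\<^sub>R \<beta>' v)"
      by (rule inner_form_eqI[OF G(1)])
         (use variation_fst[OF zX, of u y1 v] in \<open>simp add: inner_form_simps[OF G(1)] \<beta>' T1_def[symmetric] G1_def[symmetric]\<close>)
    moreover have "2 *\<^sub>R T2 = mixed z u v *\<^sub>R w2 + (mixed z u w2 *\<^sub>R v - G2 v w2 *\<^sub>R \<gamma>' u)"
      by (rule inner_form_eqI[OF G(2)])
         (use variation_snd[OF zX, of v w2 u] in \<open>simp add: inner_form_simps[OF G(2)] \<gamma>' T2_def[symmetric] G2_def[symmetric]\<close>)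
    \<comment> \<open>Removing the multiple \<open>mixed z u v\<close> of the identity leaves the
      operator of \<open>product_form\<close>.\<close>
    ultimately have "(mixed z y1 v *\<^sub>R u - G1 u y1 *\<^sub>R \<beta>' v, mixed z u w2 *\<^sub>R v - G2 v w2 *\<^sub>R \<gamma>' u)
        = 2 *\<^sub>R (- T1, T2) - mixed z u v *\<^sub>R (y1, w2)"
      by simp
    then show ?thesis using T that H subspace_scale subspace_diff by metis
  qed
  interpret pf: product_form G1 G2 "mixed z" \<beta>' \<gamma>' H
    by unfold_locales (fact G B \<beta>' \<gamma>' H inv)+
  \<comment> \<open>The algebraic result treats the two factors differently; the second
    interpretation exchanges them.\<close>
  have "subspace (prod.swap ` H)"
    by (rule linear_subspace_image[OF _ H]) (auto intro: linearI)
  then interpret fp: product_form G2 G1 "\<lambda>v u. mixed z u v" \<gamma>' \<beta>' "prod.swap ` H"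
    by unfold_locales (use inv in \<open>auto simp: G B' \<beta>' \<gamma>'\<close>)
  \<comment> \<open>Dimensions are positive, so if both are at most 2, the excluded sums leave only
    1 + 2 and 2 + 1.\<close>
  have dims': "(DIM('b) \<ge> 3 \<or> DIM('a) = 1 \<and> DIM('b) = 2) \<or> (DIM('a) \<ge> 3 \<or> DIM('b) = 1 \<and> DIM('a) = 2)"
    using dims DIM_positive[where 'a = 'a] DIM_positive[where 'a = 'b] by linarith
  have "H \<in> {{0}, UNIV, UNIV \<times> {0}, {0} \<times> UNIV}"
  proof (rule disjE[OF dims'])
    assume "DIM('b) \<ge> 3 \<or> DIM('a) = 1 \<and> DIM('b) = 2"
    then show ?thesis by (rule pf.invariant_subspace[OF nz])
  next
    assume "DIM('a) \<ge> 3 \<or> DIM('b) = 1 \<and> DIM('a) = 2"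
    then have "prod.swap ` H \<in> {{0}, UNIV, UNIV \<times> {0}, {0} \<times> UNIV}" by (rule fp.invariant_subspace[OF nz])
    moreover have "H = prod.swap ` prod.swap ` H" by (simp add: image_image)
    moreover have "prod.swap ` {0 :: 'b \<times> 'a} = {0}" "range (prod.swap :: 'b \<times> 'a \<Rightarrow> _) = UNIV"
      "prod.swap ` (UNIV \<times> {0 :: 'a}) = {0} \<times> (UNIV :: 'b set)" "prod.swap ` ({0 :: 'b} \<times> UNIV) = (UNIV :: 'a set) \<times> {0}"
      by (auto simp: zero_prod_def product_swap)
    ultimately show ?thesis by auto
  qed
  moreover have "w \<in> E y \<longleftrightarrow> J w \<in> H" for w
  proof -
    have "inj J" using PM.ctrans_eq_0_iff[OF PM.centre_in_cdom y] lJ by (simp add: linear_injective_0 J_def)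
    then show ?thesis by (auto simp: H_def inj_image_mem_iff)
  qed
  \<comment> \<open>The change to the chart is block diagonal, so the four candidate subspaces
    correspond to themselves.\<close>
  moreover have "fst (J w) = 0 \<longleftrightarrow> fst w = 0" "snd (J w) = 0 \<longleftrightarrow> snd w = 0" for w
  proof -
    obtain p q where pq: "y = (p, q)" "p \<in> cdom A1 a" "q \<in> cdom A2 b" using y by (cases y) (auto simp: cdom_prod)
    have "J w = (ctrans A1 p a p (fst w), ctrans A2 q b q (snd w))"
      using ctrans_prod[of p p a q q b "fst w" "snd w"]
      by (simp add: J_def pq M1.centre_in_cdom M2.centre_in_cdom)
    then show "fst (J w) = 0 \<longleftrightarrow> fst w = 0" "snd (J w) = 0 \<longleftrightarrow> snd w = 0"
      by (simp_all add: M1.ctrans_eq_0_iff[OF M1.centre_in_cdom pq(2)] M2.ctrans_eq_0_iff[OF M2.centre_in_cdom pq(3)])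
  qed
  ultimately show ?thesis
    by (elim insertE emptyE) (auto simp: set_eq_iff mem_Times_iff prod_eq_iff)
qed

end

text \<open>A potential of \<open>\<theta>\<close> needs the derivative of
  \<open>ln \<alpha>\<close> along the second factor and that of
  \<open>ln \<beta> = ln \<alpha> + F\<close> along the first. If the mixed derivatives vanish,
  \<open>dF(u, 0)\<close> does not depend on the second coordinate, so \<open>F\<close> can be
  frozen there at \<open>q0\<close>.\<close>

lemma closed_of_mixed_zero:
  assumes mixed0: "\<And>a b z u v. z \<in> PM.crange (a, b) \<Longrightarrow> mixed a b z u v = 0"
  shows "closed_weyl P D"
proof (rule W.closed_of_potential)
  fix x :: "'m1 \<times> 'm2"
  obtain a b where x: "x = (a, b)" by force
  let ?F = "F a b" and ?X = "PM.crange (a, b)"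
  define q0 where "q0 = cmap A2 b b"
  \<comment> \<open>A ball in the second chart, so that a segment joins \<open>q0\<close> to every
    second coordinate.\<close>
  obtain r where r: "r > 0" "ball q0 r \<subseteq> M2.crange b"
    using openE[OF M2.open_crange M2.cmap_in_crange[OF M2.centre_in_cdom]] unfolding q0_def by blast
  define U where "U = cdom A1 a \<times> (cdom A2 b \<inter> cmap A2 b -` ball q0 r)"
  define S where "S = M1.crange a \<times> ball q0 r"
  have S: "open S" "S \<subseteq> ?X" using r(2) by (auto simp: S_def crange_prod open_Times M1.open_crange)
  have "continuous_on (cdom A2 b) (cmap A2 b)"
    using M2.chart_homeomorphism[of b] by (simp add: homeomorphism_def)
  then have "open (cdom A2 b \<inter> cmap A2 b -` ball q0 r)"
    by (rule continuous_open_preimage[OF _ M2.open_cdom open_ball])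
  then have U: "open U" "x \<in> U" "U \<subseteq> cdom P x"
    using r(1) by (auto simp: U_def x open_Times M1.open_cdom M1.centre_in_cdom M2.centre_in_cdom q0_def cdom_prod)
  have US: "cmap P x ` U \<subseteq> S" by (auto simp: U_def S_def x cmap_prod M1.cmap_in_crange)
  define \<psi> where "\<psi> y = ln (\<alpha> y) + ?F (cmap A1 a (fst y), q0)" for y
  define \<psi>' where "\<psi>' z = ln (\<alpha>c a b z) + ?F (fst z, q0)" for z
  have q0: "q0 \<in> ball q0 r" using r(1) by simp
  have fz: "(fst z, q0) \<in> ?X" if "z \<in> S" for z
    using that r(2) q0 by (auto simp: S_def crange_prod)
  have \<psi>\<psi>': "\<psi> (cinv P x z) = \<psi>' z" if "z \<in> S" for z
    using that r(2) by (auto simp: \<psi>_def \<psi>'_def \<alpha>c_def x S_def cinv_prod M1.cmap_cinv)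
  have sF: "smooth_on S (\<lambda>z. ?F (fst z, q0))"
    by (rule smooth_on_compose[OF S(1) PM.open_crange fz smooth_F
        smooth_on_Pair[OF S(1) smooth_on_fst[OF S(1) smooth_on_id[OF S(1)]] smooth_on_const[OF S(1)]]])
  have s\<alpha>: "smooth_on S (\<lambda>z. ln (\<alpha>c a b z))"
    by (rule smooth_on_compose[OF S(1) open_greaterThan _ smooth_on_ln smooth_on_subset[OF smooth_\<alpha>c S(2)]])
       (simp add: \<alpha>c_pos)
  have s\<psi>: "smooth_on S \<psi>'"
    unfolding \<psi>'_def by (rule smooth_on_add[OF S(1) s\<alpha> sF])
  have "smooth_on S (\<lambda>z. \<psi> (cinv P x z))"
    by (rule smooth_on_cong[OF S(1) _ s\<psi>]) (rule \<psi>\<psi>'[symmetric])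
  then have sm: "smooth_fun_on P U \<psi>"
    by (intro PM.smooth_fun_onI[OF U(1,3)] smooth_on_subset[OF _ US])
  have const: "fderiv ?F (fst z, q0) (u, 0) = fderiv ?F z (u, 0)" if z: "z \<in> S" for z u
  proof -
    define v where "v = snd z - q0"
    have seg: "(fst z, q0) + s *\<^sub>R (0, v) \<in> ?X" if "0 \<le> s" "s \<le> 1" for s
    proof -
      have "norm (s *\<^sub>R v) \<le> 1 * norm v" unfolding norm_scaleR using that by (intro mult_right_mono) auto
      also have "\<dots> < r" using z by (auto simp: v_def S_def dist_norm norm_minus_commute mem_Times_iff)
      finally have "q0 + s *\<^sub>R v \<in> ball q0 r" by (simp add: dist_norm)
      then show ?thesis using z r(2) by (auto simp: S_def crange_prod mem_Times_iff)
    qed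
    define h where "h s = fderiv ?F ((fst z, q0) + s *\<^sub>R (0, v)) (u, 0)" for s
    have "(h has_real_derivative 0) (at s)" if "0 \<le> s" "s \<le> 1" for s
      using has_vector_derivative_along_line[OF smooth_on_has_derivative[OF smooth_on_derivative[OF smooth_F[of a b], of "(u, 0)"] seg[OF that]]]
        mixed0[OF seg[OF that], of u v]
      by (simp add: h_def[abs_def] has_real_derivative_iff_has_vector_derivative mixed_def)
    from MVT2[OF zero_less_one this] have "h 1 = h 0" by auto
    then show ?thesis by (simp add: h_def v_def)
  qed
  have d\<psi>: "fderiv \<psi>' z w = th a b z w" if z: "z \<in> S" for z w
  proof -
    obtain u v where w: "w = (u, v)" by force
    have zX: "z \<in> ?X" using z S(2) by blast
    have "((\<lambda>z. (fst z, q0)) has_derivative (\<lambda>w. (fst w, 0))) (at z)"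
      by (auto intro!: derivative_eq_intros)
    from has_derivative_compose[OF this smooth_on_has_derivative[OF smooth_F fz[OF z]]]
    have "((\<lambda>z. ?F (fst z, q0)) has_derivative (\<lambda>w. fderiv ?F (fst z, q0) (fst w, 0))) (at z)" .
    from frechet_derivative_eqI[OF has_derivative_add[OF dln\<alpha>c[OF zX] this], of w]
    have "fderiv \<psi>' z w =
        fderiv (\<alpha>c a b) z (u, v) / \<alpha>c a b z + fderiv ?F z (u, 0)"
      by (simp add: \<psi>'_def[abs_def] w const[OF z])
    also have "fderiv (\<alpha>c a b) z (u, v) =
        fderiv (\<alpha>c a b) z (u, 0) + fderiv (\<alpha>c a b) z (0, v)"
      using linear_add[OF smooth_on_linear_derivative[OF smooth_\<alpha>c zX], of "(u, 0)" "(0, v)"] by simp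
    also have "(fderiv (\<alpha>c a b) z (u, 0) + fderiv (\<alpha>c a b) z (0, v)) / \<alpha>c a b z
        + fderiv ?F z (u, 0) = th a b z (u, 0) + th a b z (0, v)"
      by (simp add: dF[OF zX] th_fst[OF zX] th_snd[OF zX] add_divide_distrib)
    also have "\<dots> = th a b z w"
      using linear_add[OF linear_th[OF zX], of "(u, 0)" "(0, v)"] by (simp add: w)
    finally show ?thesis .
  qed
  have "fun_diff P \<psi> y v = \<theta> y v" if y: "y \<in> U" for y v
  proof -
    have yx: "y \<in> cdom P x" using y U(3) by blast
    define w where "w = ctrans P y x y v"
    have v: "v = ctrans P x y y w" by (simp add: w_def PM.ctrans_inverse[OF PM.centre_in_cdom yx])
    have zS: "cmap P x y \<in> S" using US y by blast
    have "fun_diff P \<psi> y v = fderiv (\<lambda>z. \<psi> (cinv P x z)) (cmap P x y) w"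
      unfolding v by (rule PM.fun_diff_chart[OF U(1) y yx sm])
    also have "\<dots> = fderiv \<psi>' (cmap P x y) w"
      by (rule fun_cong[OF frechet_derivative_cong_open[OF S(1) zS \<psi>\<psi>']])
    also have "\<dots> = \<theta> y v"
      by (simp add: d\<psi>[OF zS] th_def x[symmetric] PM.cinv_cmap[OF yx] coord_field_def v[symmetric])
    finally show ?thesis .
  qed
  then show "\<exists>U \<psi>. open U \<and> x \<in> U \<and> smooth_fun_on P U \<psi> \<and> (\<forall>y\<in>U. \<forall>v. fun_diff P \<psi> y v = \<theta> y v)"
    using U(1,2) sm by blast
qed

text \<open>Constant rank carries the two trivial cases from one point to all. A factor is carried
  along as the kernel of the projection to the other factor, and equal dimensions turn the inclusion
  into an equality.\<close>

lemma parallel_distribution_cases: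
  assumes E: "parallel_distribution P D E" and "\<not> closed_weyl P D"
    and dims: "DIM('a) + DIM('b) \<noteq> 2" "DIM('a) + DIM('b) \<noteq> 4"
  shows "E \<in> {\<lambda>_. {0}, \<lambda>_. UNIV, \<lambda>_. UNIV \<times> {0}, \<lambda>_. {0} \<times> UNIV}"
proof -
  obtain a b z u v where z: "z \<in> PM.crange (a, b)" "mixed a b z u v \<noteq> 0"
    using closed_of_mixed_zero assms(2) by blast
  obtain y where y: "y \<in> cdom P (a, b)" "z = cmap P (a, b) y" using z(1) by (auto simp: PM.crange_def)
  have Ey: "E y \<in> {{0}, UNIV, UNIV \<times> {0}, {0} \<times> UNIV}"
    by (rule parallel_distribution_point[OF E y z(2) dims])
  have d: "dim (E x) = dim (E y)" for x
    using E unfolding parallel_distribution_def distribution_def by metis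
  note sub = parallel_distribution_subspace[OF E]
  have eqI: "E x = V" if "subspace V" "E x \<subseteq> V" "dim V = dim (E y)" for x V
    by (rule subspace_dim_equal[OF sub that(1,2)]) (simp only: that(3) d[of x] order_refl)
  have dim1: "dim ((UNIV :: 'a set) \<times> {0 :: 'b}) = DIM('a)" and dim2: "dim ({0 :: 'a} \<times> (UNIV :: 'b set)) = DIM('b)"
    using dim_Times[OF subspace_UNIV subspace_single_0, where 'a = 'a and 'b = 'b]
      dim_Times[OF subspace_single_0 subspace_UNIV, where 'a = 'a and 'b = 'b] by simp_all
  have sub1: "subspace ((UNIV :: 'a set) \<times> {0 :: 'b})" and sub2: "subspace ({0 :: 'a} \<times> (UNIV :: 'b set))"
    by (intro subspace_Times subspace_UNIV subspace_single_0)+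
  have ct: "ctrans P y x y (u, v) = (ctrans A1 (fst y) (fst x) (fst y) u, ctrans A2 (snd y) (snd x) (snd y) v)"
    if "y \<in> cdom P x" for x y u v
    using that ctrans_prod[of "fst y" "fst y" "fst x" "snd y" "snd y" "snd x" u v]
    by (cases x; cases y) (auto simp: cdom_prod M1.centre_in_cdom M2.centre_in_cdom)
  have ct0: "ctrans A1 (fst y) (fst x) (fst y) 0 = 0" "ctrans A2 (snd y) (snd x) (snd y) 0 = 0"
    if "y \<in> cdom P x" for x y
    using that linear_0[OF M1.linear_ctrans[OF M1.centre_in_cdom]] linear_0[OF M2.linear_ctrans[OF M2.centre_in_cdom]]
    by (cases x; cases y; auto simp: cdom_prod)+
  consider "E y = {0}" | "E y = UNIV" | "E y = UNIV \<times> {0}" | "E y = {0} \<times> UNIV" using Ey by blast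
  then show ?thesis
  proof cases
    case 1
    have "E x = {0}" for x
    proof -
      have "dim (E x) = 0" using d[of x] 1 by simp
      then have "E x \<subseteq> {0}" by (simp add: dim_eq_0)
      then show ?thesis using subspace_0[OF sub[of x]] by blast
    qed
    then show ?thesis by auto
  next
    case 2
    have "E x = UNIV" for x by (rule eqI) (simp_all add: 2)
    then show ?thesis by auto
  next
    case 3
    have "E x = UNIV \<times> {0}" for x
    proof (rule eqI[OF sub1])
      \<comment> \<open>The projection to the second factor plays the part of \<open>\<pi>\<close>;
        the rank is \<open>DIM('a)\<close>, so \<open>'a\<close> itself indexes the frames.\<close>
      have "(0, snd e) = (0 :: 'a \<times> 'b)" if e: "e \<in> E x" for e
      proof (rule W.parallel_in_kernel[where \<pi> = "\<lambda>e. (0, snd e)" and 'k = 'a, OF E _ _ _ _ _ e])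
        show "dim (E y) = DIM('a)" by (simp add: 3 dim1)
        show "W.chr x z v (0, snd w) = (0, snd (W.chr x z v w))" if "z \<in> PM.crange x" for x z v w
          using that ch_prod[of z "fst x" "snd x" "fst v" "snd v"]
          by (cases w) (auto simp: \<Gamma>_zero)
      qed (use ct ct0 in \<open>auto simp: 3 zero_prod_def intro: linearI\<close>)
      then show "E x \<subseteq> UNIV \<times> {0}" by (auto simp: zero_prod_def mem_Times_iff)
    qed (simp add: 3)
    then show ?thesis by auto
  next
    case 4
    have "E x = {0} \<times> UNIV" for x
    proof (rule eqI[OF sub2])
      have "(fst e, 0) = (0 :: 'a \<times> 'b)" if e: "e \<in> E x" for e
      proof (rule W.parallel_in_kernel[where \<pi> = "\<lambda>e. (fst e, 0)" and 'k = 'b, OF E _ _ _ _ _ e])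
        show "dim (E y) = DIM('b)" by (simp add: 4 dim2)
        show "W.chr x z v (fst w, 0) = (fst (W.chr x z v w), 0)" if "z \<in> PM.crange x" for x z v w
          using that ch_prod[of z "fst x" "snd x" "fst v" "snd v"]
          by (cases w) (auto simp: \<Gamma>_zero)
      qed (use ct ct0 in \<open>auto simp: 4 zero_prod_def intro: linearI\<close>)
      then show "E x \<subseteq> {0} \<times> UNIV" by (auto simp: zero_prod_def mem_Times_iff)
    qed (simp add: 4)
    then show ?thesis by auto
  qed
qed

end

section \<open>From the conformal product to an adapted metric\<close>

lemma conformal_structure_obtain:
  fixes A :: "('m::{t2_space, second_countable_topology}, 'e::euclidean_space) atlas"
  assumes "smooth_manifold A" "conformal_structure A c"
  obtains g where "g \<in> c" "riemannian_metric A g"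
proof -
  interpret smooth_mfd A by unfold_locales (rule assms(1))
  from assms(2) obtain g where g: "riemannian_metric A g"
    and c: "c = {\<lambda>x u v. f x * g x u v | f. smooth_fun_on A UNIV f \<and> (\<forall>x. f x > 0)}"
    unfolding conformal_structure_def by (elim exE conjE)
  have "smooth_fun_on A UNIV (\<lambda>_. 1)" by (rule smooth_fun_const) simp
  then have "g \<in> c" unfolding c by (intro CollectI exI[of _ "\<lambda>_. 1 :: real"]) simp
  then show ?thesis using that g by blast
qed

theorem corollary5p9:
  fixes A1 :: "('m1::{t2_space, second_countable_topology}, 'a::euclidean_space) atlas"
    and A2 :: "('m2::{t2_space, second_countable_topology}, 'b::euclidean_space) atlas"
    and c1 :: "('m1 \<Rightarrow> 'a \<Rightarrow> 'a \<Rightarrow> real) set"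
    and c2 :: "('m2 \<Rightarrow> 'b \<Rightarrow> 'b \<Rightarrow> real) set"
    and c :: "('m1 \<times> 'm2 \<Rightarrow> 'a \<times> 'b \<Rightarrow> 'a \<times> 'b \<Rightarrow> real) set"
    and D :: "'m1 \<times> 'm2 \<Rightarrow> 'a \<times> 'b \<Rightarrow> ('m1 \<times> 'm2 \<Rightarrow> 'a \<times> 'b) \<Rightarrow> 'a \<times> 'b"
  assumes "smooth_manifold A1" and "conformal_structure A1 c1"
    and "smooth_manifold A2" and "conformal_structure A2 c2"
    and "conformal_product A1 c1 A2 c2 c"
    and "adapted_weyl_structure A1 A2 c D"
    and "\<not> closed_weyl (prod_atlas A1 A2) D"
    and "DIM('a) + DIM('b) \<noteq> 2" and "DIM('a) + DIM('b) \<noteq> 4"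
  shows "{E. parallel_distribution (prod_atlas A1 A2) D E \<and> E \<noteq> (\<lambda>_. {0}) \<and> E \<noteq> (\<lambda>_. UNIV)}
       = {ker_diff (prod_atlas A1 A2) A1 fst, ker_diff (prod_atlas A1 A2) A2 snd}"
proof -
  interpret product_mfd A1 A2 by unfold_locales (rule assms(1,3))+
  have cP: "conformal_structure P c"
    and s1: "conformal_submersion P c A1 c1 fst" and s2: "conformal_submersion P c A2 c2 snd"
    and orth: "\<forall>g\<in>c. \<forall>x. \<forall>u\<in>{0} \<times> UNIV. \<forall>v\<in>UNIV \<times> {0}. g x u v = 0"
    using assms(5) unfolding conformal_product_def ker_diff_fst ker_diff_snd by simp_all
  have weyl: "weyl_structure P c D"
    and p1: "parallel_distribution P D (\<lambda>_. UNIV \<times> {0})" and p2: "parallel_distribution P D (\<lambda>_. {0} \<times> UNIV)"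
    using assms(6) unfolding adapted_weyl_structure_def ker_diff_fst ker_diff_snd by simp_all
  obtain g1 where g1: "g1 \<in> c1" "riemannian_metric A1 g1" by (rule conformal_structure_obtain[OF assms(1,2)])
  obtain g2 where g2: "g2 \<in> c2" "riemannian_metric A2 g2" by (rule conformal_structure_obtain[OF assms(3,4)])
  obtain g where g: "g \<in> c" "riemannian_metric P g" by (rule conformal_structure_obtain[OF smooth_manifold_prod cP])
  have lc: "linear_connection P D" and tf: "torsion_free P D" and pc: "preserves_conformal P c D"
    using weyl unfolding weyl_structure_def by simp_all
  obtain \<theta> where \<theta>: "\<forall>U x v Y Z. open U \<and> x \<in> U \<and> smooth_field_on P U Y \<and> smooth_field_on P U Z \<longrightarrow>
        fun_diff P (\<lambda>y. g y (Y y) (Z y)) x v - g x (D x v Y) (Z x) - g x (Y x) (D x v Z)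
          = \<theta> x v * g x (Y x) (Z x)"
    using bspec[OF pc[unfolded preserves_conformal_def] g(1)] by (elim exE)
  have ig: "inner_form (g y)" for y using g(2) unfolding riemannian_metric_def inner_form_def by blast
  have o1: "g y (0, v) (u, 0) = 0" for y u v
    using bspec[OF orth g(1), THEN spec[of _ y]] by blast
  then have o: "g y (0, v) (u, 0) = 0" "g y (u, 0) (0, v) = 0" for y u v
    using inner_form_sym[OF ig, of y "(u, 0)" "(0, v)"] by simp_all
  have "\<exists>r>0. \<forall>u u'. g y (u, 0) (u', 0) = r * g1 (fst y) u u'" for y
  proof -
    have "\<exists>r>0. \<forall>u\<in>{u. \<forall>w\<in>{0} \<times> UNIV. g y u w = 0}. \<forall>v\<in>{u. \<forall>w\<in>{0} \<times> UNIV. g y u w = 0}.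
        g1 (fst y) (fst u) (fst v) = r * g y u v"
      using conjunct2[OF bspec[OF bspec[OF spec[OF conjunct2[OF conjunct2[OF s1[unfolded conformal_submersion_def Let_def]]]] g(1)] g1(1)], of y]
      unfolding ker_diff_fst map_diff_fst .
    then obtain r where r: "r > 0" and eq: "\<forall>u\<in>{u. \<forall>w\<in>{0} \<times> UNIV. g y u w = 0}.
        \<forall>v\<in>{u. \<forall>w\<in>{0} \<times> UNIV. g y u w = 0}. g1 (fst y) (fst u) (fst v) = r * g y u v"
      by (elim exE conjE)
    \<comment> \<open>Orthogonality of the factors makes \<open>(u, 0)\<close> horizontal for the
      first projection, so the submersion condition applies; it expresses \<open>g1\<close> as
      \<open>r\<close> times \<open>g\<close>, and the factor sought is
      \<open>1 / r\<close>.\<close>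
    have H: "(u, 0) \<in> {u. \<forall>w\<in>{0} \<times> UNIV. g y u w = 0}" for u
      by (auto simp: o)
    have "g1 (fst y) u u' = r * g y (u, 0) (u', 0)" for u u'
      using bspec[OF bspec[OF eq H[of u]] H[of u']] by simp
    with r show ?thesis by (intro exI[of _ "1 / r"]) simp
  qed
  then obtain \<alpha> where \<alpha>: "\<And>y. \<alpha> y > 0" "\<And>y u u'. g y (u, 0) (u', 0) = \<alpha> y * g1 (fst y) u u'" by metis
  have "\<exists>r>0. \<forall>v v'. g y (0, v) (0, v') = r * g2 (snd y) v v'" for y
  proof -
    have "\<exists>r>0. \<forall>u\<in>{u. \<forall>w\<in>UNIV \<times> {0}. g y u w = 0}. \<forall>v\<in>{u. \<forall>w\<in>UNIV \<times> {0}. g y u w = 0}.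
        g2 (snd y) (snd u) (snd v) = r * g y u v"
      using conjunct2[OF bspec[OF bspec[OF spec[OF conjunct2[OF conjunct2[OF s2[unfolded conformal_submersion_def Let_def]]]] g(1)] g2(1)], of y]
      unfolding ker_diff_snd map_diff_snd .
    then obtain r where r: "r > 0" and eq: "\<forall>u\<in>{u. \<forall>w\<in>UNIV \<times> {0}. g y u w = 0}.
        \<forall>v\<in>{u. \<forall>w\<in>UNIV \<times> {0}. g y u w = 0}. g2 (snd y) (snd u) (snd v) = r * g y u v"
      by (elim exE conjE)
    have H: "(0, v) \<in> {u. \<forall>w\<in>UNIV \<times> {0}. g y u w = 0}" for v
      by (auto simp: o)
    have "g2 (snd y) v v' = r * g y (0, v) (0, v')" for v v'
      using bspec[OF bspec[OF eq H[of v]] H[of v']] by simp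
    with r show ?thesis by (intro exI[of _ "1 / r"]) simp
  qed
  then obtain \<beta> where \<beta>: "\<And>y. \<beta> y > 0" "\<And>y v v'. g y (0, v) (0, v') = \<beta> y * g2 (snd y) v v'" by metis
  have metric: "g y (u, v) (u', v') = \<alpha> y * g1 (fst y) u u' + \<beta> y * g2 (snd y) v v'" for y u v u' v'
  proof -
    have "g y (u, v) (u', v') = g y ((u, 0) + (0, v)) ((u', 0) + (0, v'))" by simp
    also have "\<dots> = g y (u, 0) (u', 0) + g y (0, v) (0, v')"
      by (simp only: inner_form_simps(1,2)[OF ig] o add_0_left add_0_right)
    finally show ?thesis by (simp add: \<alpha>(2) \<beta>(2))
  qed
  interpret adapted_metric A1 A2 D g \<theta> g1 g2 \<alpha> \<beta>
  proof unfold_locales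
    show "fun_diff P (\<lambda>y. g y (Y y) (Z y)) x v - g x (D x v Y) (Z x) - g x (Y x) (D x v Z) = \<theta> x v * g x (Y x) (Z x)"
      if "open U" "x \<in> U" "smooth_field_on P U Y" "smooth_field_on P U Z" for U x v Y Z
      by (rule \<theta>[rule_format, of U]) (intro conjI that)
  qed (fact lc g(2) g1(2) g2(2) tf p1 p2 metric \<alpha>(1) \<beta>(1))+
  \<comment> \<open>Both factors have positive dimension, so neither kernel is zero or the whole
    tangent space.\<close>
  obtain i :: 'a where "i \<in> Basis" using nonempty_Basis by blast
  moreover obtain j :: 'b where "j \<in> Basis" using nonempty_Basis by blast
  ultimately have ij: "i \<noteq> 0" "j \<noteq> 0" by auto
  have "(i, 0) \<in> (UNIV :: 'a set) \<times> {0 :: 'b}" "(i, 0) \<noteq> (0 :: 'a \<times> 'b)" "(0, j) \<notin> (UNIV :: 'a set) \<times> {0 :: 'b}"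
    using ij by (simp_all add: zero_prod_def)
  then have ne1: "(UNIV :: 'a set) \<times> {0 :: 'b} \<noteq> {0}" "(UNIV :: 'a set) \<times> {0 :: 'b} \<noteq> UNIV"
    by blast+
  have "(0, j) \<in> {0 :: 'a} \<times> (UNIV :: 'b set)" "(0, j) \<noteq> (0 :: 'a \<times> 'b)" "(i, 0) \<notin> {0 :: 'a} \<times> (UNIV :: 'b set)"
    using ij by (simp_all add: zero_prod_def)
  then have ne2: "{0 :: 'a} \<times> (UNIV :: 'b set) \<noteq> {0}" "{0 :: 'a} \<times> (UNIV :: 'b set) \<noteq> UNIV"
    by blast+
  show ?thesis
    unfolding ker_diff_fst ker_diff_snd
  proof (intro equalityI subsetI)
    fix E
    assume "E \<in> {E. parallel_distribution P D E \<and> E \<noteq> (\<lambda>_. {0}) \<and> E \<noteq> (\<lambda>_. UNIV)}"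
    then have E: "parallel_distribution P D E" "E \<noteq> (\<lambda>_. {0})" "E \<noteq> (\<lambda>_. UNIV)" by simp_all
    from parallel_distribution_cases[OF E(1) assms(7-9)] E(2,3)
    show "E \<in> {\<lambda>_. {0} \<times> UNIV, \<lambda>_. UNIV \<times> {0}}" by (simp only: insert_iff empty_iff simp_thms) blast
  next
    fix E :: "'m1 \<times> 'm2 \<Rightarrow> ('a \<times> 'b) set"
    assume "E \<in> {\<lambda>_. {0} \<times> UNIV, \<lambda>_. UNIV \<times> {0}}"
    then consider "E = (\<lambda>_. {0} \<times> UNIV)" | "E = (\<lambda>_. UNIV \<times> {0})" by (elim insertE emptyE)
    then show "E \<in> {E. parallel_distribution P D E \<and> E \<noteq> (\<lambda>_. {0}) \<and> E \<noteq> (\<lambda>_. UNIV)}"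
    proof cases
      case 1
      show ?thesis unfolding 1 using p2 ne2 by (simp add: fun_eq_iff)
    next
      case 2
      show ?thesis unfolding 2 using p1 ne1 by (simp add: fun_eq_iff)
    qed
  qed
qed

end
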